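(* Let $X$ be a Banach space with norm $\|\cdot\|$, let $A:D(A)\subset X\to X$ be the infinitesimal generator of an analytic semigroup $\mathrm{e}^{tA}$ on $X$ ($D(A)$ not necessarily dense), let $0\le\alpha<1$ and let $X_\alpha$, with norm $\|\cdot\|_\alpha$, be an intermediate space as described in the context. Let $T>0$ and $g:[0,T]\to X$ satisfy, for some constant $B_1$, $$\|g(t)\|\leq B_1,\quad 0\leq t\leq T,\qquad \|g'(t)\|\leq B_1t^{-1},\quad 0<t\leq T.$$ Let $u_0\in X_\alpha$ and let $u$ be the mild solution of $u'=Au+g(t)$, $u(0)=u_0$, on $[0,T]$. Let $u_n$ be the numerical solution, with time step $\tau>0$, given by the $s$-stage exponential Runge--Kutta method $$u_{n+1}=\mathrm{e}^{\tau A}u_n+\tau\sum_{i=1}^s b_i(\tau A)g(t_{ni}),\qquad t_{ni}=t_n+c_i\tau,\quad t_n=n\tau,$$ starting from $u_0$, whose weights satisfy $\sum_{i=1}^s b_i(z)=\varphi_1(z)$. Then $$\|u_n-u(t_n)\|_\alpha\leq C\tau^{1-\alpha}(|\log\tau|+1)$$ uniformly in $0\leq t_n\leq T$, where the constant $C$ depends on $B_1$ and $T$ but is independent of $n$ and $\tau$.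
   Context: Analytic semigroups. A linear operator $A:D(A)\subset X\to X$ on a Banach space $X$ is sectorial (equivalently, is the infinitesimal generator of an analytic semigroup in the sense used here) if there are $\omega\in\mathbb{R}$, $\theta\in(\pi/2,\pi)$, $M>0$ such that the resolvent set of $A$ contains $\{\lambda\neq\omega:|\arg(\lambda-\omega)|<\theta\}$ and $\|(\lambda I-A)^{-1}\|\le M/|\lambda-\omega|$ there. The domain is not assumed dense. $\mathrm{e}^{tA}$ ($t\ge0$) is the analytic semigroup generated by $A$ (Dunford integral for $t>0$, $\mathrm{e}^{0A}=I$); it need not be strongly continuous at $t=0$. Interpolation spaces. For $0<\alpha<1$, $1\le p\le\infty$, $D_A(\alpha,p)=\{x\in X: v(t)=\|t^{1-\alpha-1/p}A\mathrm{e}^{tA}x\|\in L^p(0,1)\}$ with norm $\|x\|+\|v\|_{L^p(0,1)}$; also $D_A(0,p)=X$. For $0<\alpha<1$, $X_\alpha$ is any Banach space with continuous embeddings $D_A(\alpha,1)\subset X_\alpha\subset D_A(\alpha,\infty)$, with norm $\|\cdot\|_\alpha$; $X_0=X$. Functions $\varphi_k$. $\varphi_0(z)=\mathrm{e}^z$ and $\varphi_k(z)=\int_0^1\mathrm{e}^{(1-\xi)z}\frac{\xi^{k-1}}{(k-1)!}\,\mathrm{d}\xi$ for $k\ge1$; $\varphi_k(tA)$ is defined by the same formula with $\mathrm{e}^{(1-\xi)tA}$. Method. The nodes satisfy $c_i\in[0,1]$, $1\le i\le s$, and the weights $b_i(z)$ are linear combinations of the functions $\varphi_k(z)$. Mild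 solution of the linear problem: $u(t)=\mathrm{e}^{tA}u_0+\int_0^t\mathrm{e}^{(t-\xi)A}g(\xi)\,\mathrm{d}\xi$, $0\le t\le T$. *)

theory Defs
  imports "HOL-Probability.Probability" "HOL-Complex_Analysis.Complex_Analysis"
begin

section \<open>Complex Banach spaces\<close>

text \<open>The libraries only provide real Banach spaces. A complex Banach space is one of these with a
  complex scalar multiplication extending the real one, for which the norm is homogeneous.\<close>

class complex_banach = banach +
  fixes scaleC :: "complex \<Rightarrow> 'a \<Rightarrow> 'a"  (infixr \<open>*\<^sub>C\<close> 75)
  assumes scaleC_add_right: "a *\<^sub>C (x + y) = a *\<^sub>C x + a *\<^sub>C y"
    and scaleC_add_left: "(a + b) *\<^sub>C x = a *\<^sub>C x + b *\<^sub>C x"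
    and scaleC_scaleC: "a *\<^sub>C b *\<^sub>C x = (a * b) *\<^sub>C x"
    and scaleC_of_real: "complex_of_real r *\<^sub>C x = r *\<^sub>R x"
    and norm_scaleC: "norm (a *\<^sub>C x) = cmod a * norm x"

instantiation complex :: complex_banach
begin
definition scaleC_complex :: "complex \<Rightarrow> complex \<Rightarrow> complex" where
  "scaleC_complex a x = a * x"
instance
  by standard (auto simp: scaleC_complex_def algebra_simps norm_mult scaleR_conv_of_real)
end

definition csubspace :: "'a::complex_banach set \<Rightarrow> bool" where
  "csubspace V \<longleftrightarrow> 0 \<in> V \<and> (\<forall>x\<in>V. \<forall>y\<in>V. x + y \<in> V) \<and> (\<forall>a. \<forall>x\<in>V. a *\<^sub>C x \<in> V)"

section \<open>Sectorial operators\<close>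

text \<open>An unbounded operator is a pair of its domain \<open>D\<close> and a total function \<open>A\<close>, of which only the
  values on \<open>D\<close> are used.\<close>

definition linear_operator :: "'a::complex_banach set \<Rightarrow> ('a \<Rightarrow> 'a) \<Rightarrow> bool" where
  "linear_operator D A \<longleftrightarrow> csubspace D \<and>
     (\<forall>x\<in>D. \<forall>y\<in>D. A (x + y) = A x + A y) \<and> (\<forall>a. \<forall>x\<in>D. A (a *\<^sub>C x) = a *\<^sub>C A x)"

definition resolvent :: "'a::complex_banach set \<Rightarrow> ('a \<Rightarrow> 'a) \<Rightarrow> complex \<Rightarrow> 'a \<Rightarrow> 'a" where
  "resolvent D A \<mu> = the_inv_into D (\<lambda>x. \<mu> *\<^sub>C x - A x)"

definition resolvent_set :: "'a::complex_banach set \<Rightarrow> ('a \<Rightarrow> 'a) \<Rightarrow> complex set" where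
  "resolvent_set D A =
     {\<mu>. bij_betw (\<lambda>x. \<mu> *\<^sub>C x - A x) D UNIV \<and> bounded_linear (resolvent D A \<mu>)}"

definition sectorial_with ::
  "real \<Rightarrow> real \<Rightarrow> real \<Rightarrow> 'a::complex_banach set \<Rightarrow> ('a \<Rightarrow> 'a) \<Rightarrow> bool" where
  "sectorial_with \<omega> \<theta> M D A \<longleftrightarrow> linear_operator D A \<and> pi / 2 < \<theta> \<and> \<theta> < pi \<and> 0 < M \<and>
     (\<forall>\<mu>. \<mu> \<noteq> of_real \<omega> \<and> \<bar>Arg (\<mu> - of_real \<omega>)\<bar> < \<theta> \<longrightarrow>
        \<mu> \<in> resolvent_set D A \<and> onorm (resolvent D A \<mu>) \<le> M / cmod (\<mu> - of_real \<omega>))"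

definition sectorial :: "'a::complex_banach set \<Rightarrow> ('a \<Rightarrow> 'a) \<Rightarrow> bool" where
  "sectorial D A \<longleftrightarrow> (\<exists>\<omega> \<theta> M. sectorial_with \<omega> \<theta> M D A)"

section \<open>The analytic semigroup\<close>

text \<open>The Dunford integral
  $\frac{1}{2\pi i}\int_{\omega+\gamma_{r,\eta}} e^{t\mu} (\mu I-A)^{-1} x \, d\mu$, where
  $\gamma_{r,\eta}$ consists of the two rays $|\arg\mu|=\eta$, $|\mu|\ge r$ and the arc
  $|\arg\mu|\le\eta$, $|\mu|=r$, oriented counterclockwise. The curve is parametrized
  explicitly, since the library's contour integrals are complex-valued; the first integral is that
  over the arc, the other two are those over the outgoing upper and the incoming lower ray.\<close>

definition dunford_integrand ::
  "'a::complex_banach set \<Rightarrow> ('a \<Rightarrow> 'a) \<Rightarrow> real \<Rightarrow> 'a \<Rightarrow> complex \<Rightarrow> 'a" where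
  "dunford_integrand D A t x \<mu> = exp (of_real t * \<mu>) *\<^sub>C resolvent D A \<mu> x"

definition dunford_integral ::
  "'a::complex_banach set \<Rightarrow> ('a \<Rightarrow> 'a) \<Rightarrow> real \<Rightarrow> real \<Rightarrow> real \<Rightarrow> real \<Rightarrow> 'a \<Rightarrow> 'a" where
  "dunford_integral D A \<omega> r \<eta> t x = (1 / (2 * of_real pi * \<i>)) *\<^sub>C
     (integral {-\<eta>..\<eta>} (\<lambda>s. (\<i> * of_real r * cis s) *\<^sub>C
          dunford_integrand D A t x (of_real \<omega> + of_real r * cis s))
      + integral {r..} (\<lambda>\<rho>. cis \<eta> *\<^sub>C
          dunford_integrand D A t x (of_real \<omega> + of_real \<rho> * cis \<eta>))
      - integral {r..} (\<lambda>\<rho>. cis (-\<eta>) *\<^sub>C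
          dunford_integrand D A t x (of_real \<omega> + of_real \<rho> * cis (-\<eta>))))"

definition dunford_contour ::
  "'a::complex_banach set \<Rightarrow> ('a \<Rightarrow> 'a) \<Rightarrow> real \<times> real \<times> real \<Rightarrow> bool" where
  "dunford_contour D A = (\<lambda>(\<omega>, r, \<eta>).
     0 < r \<and> (\<exists>\<theta> M. sectorial_with \<omega> \<theta> M D A \<and> pi / 2 < \<eta> \<and> \<eta> < \<theta>))"

text \<open>By Cauchy's theorem the integral does not depend on the admissible curve, so that an
  arbitrary one may be chosen. Only times \<open>t \<ge> 0\<close> are meaningful.\<close>

definition semigroup_of ::
  "'a::complex_banach set \<Rightarrow> ('a \<Rightarrow> 'a) \<Rightarrow> real \<Rightarrow> 'a \<Rightarrow> 'a" where
  "semigroup_of D A t x = (if t = 0 then x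
     else (case (SOME \<gamma>. dunford_contour D A \<gamma>) of (\<omega>, r, \<eta>) \<Rightarrow> dunford_integral D A \<omega> r \<eta> t x))"

section \<open>Interpolation and intermediate spaces\<close>

text \<open>$L^p(0,1)$ for $1 \le p \le \infty$; note that $1/\infty = 0$ in the extended nonnegative reals.\<close>

definition in_Lp01 :: "ennreal \<Rightarrow> (real \<Rightarrow> real) \<Rightarrow> bool" where
  "in_Lp01 p v \<longleftrightarrow> v \<in> borel_measurable (lebesgue_on {0<..<1}) \<and>
     (if p = \<infinity> then esssup (lebesgue_on {0<..<1}) (\<lambda>t. ennreal \<bar>v t\<bar>) < \<infinity>
      else integrable (lebesgue_on {0<..<1}) (\<lambda>t. \<bar>v t\<bar> powr enn2real p))"

definition Lp01_norm :: "ennreal \<Rightarrow> (real \<Rightarrow> real) \<Rightarrow> real" where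
  "Lp01_norm p v =
     (if p = \<infinity> then enn2real (esssup (lebesgue_on {0<..<1}) (\<lambda>t. ennreal \<bar>v t\<bar>))
      else (\<integral>t. \<bar>v t\<bar> powr enn2real p \<partial>lebesgue_on {0<..<1}) powr enn2real (1 / p))"

definition interp_fun ::
  "'a::complex_banach set \<Rightarrow> ('a \<Rightarrow> 'a) \<Rightarrow> real \<Rightarrow> ennreal \<Rightarrow> 'a \<Rightarrow> real \<Rightarrow> real" where
  "interp_fun D A \<alpha> p x t =
     norm (t powr (1 - \<alpha> - enn2real (1 / p)) *\<^sub>R A (semigroup_of D A t x))"

definition interp_space ::
  "'a::complex_banach set \<Rightarrow> ('a \<Rightarrow> 'a) \<Rightarrow> real \<Rightarrow> ennreal \<Rightarrow> 'a set" where
  "interp_space D A \<alpha> p = {x. in_Lp01 p (interp_fun D A \<alpha> p x)}"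

definition interp_norm ::
  "'a::complex_banach set \<Rightarrow> ('a \<Rightarrow> 'a) \<Rightarrow> real \<Rightarrow> ennreal \<Rightarrow> 'a \<Rightarrow> real" where
  "interp_norm D A \<alpha> p x = norm x + Lp01_norm p (interp_fun D A \<alpha> p x)"

text \<open>A Banach space carried by a subspace \<open>V\<close> of \<open>'a\<close>, with a norm \<open>N\<close> of its own, of which only the
  values on \<open>V\<close> are used.\<close>

definition banach_subspace :: "'a::complex_banach set \<Rightarrow> ('a \<Rightarrow> real) \<Rightarrow> bool" where
  "banach_subspace V N \<longleftrightarrow> csubspace V \<and>
     (\<forall>x\<in>V. 0 \<le> N x \<and> (N x = 0 \<longleftrightarrow> x = 0)) \<and>
     (\<forall>x\<in>V. \<forall>y\<in>V. N (x + y) \<le> N x + N y) \<and>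
     (\<forall>a. \<forall>x\<in>V. N (a *\<^sub>C x) = cmod a * N x) \<and>
     (\<forall>f :: nat \<Rightarrow> 'a. range f \<subseteq> V \<and> (\<forall>e>0. \<exists>n0. \<forall>m\<ge>n0. \<forall>n\<ge>n0. N (f m - f n) < e) \<longrightarrow>
        (\<exists>l\<in>V. (\<lambda>n. N (f n - l)) \<longlonglongrightarrow> 0))"

definition continuous_embedding :: "'a set \<Rightarrow> ('a \<Rightarrow> real) \<Rightarrow> 'a set \<Rightarrow> ('a \<Rightarrow> real) \<Rightarrow> bool" where
  "continuous_embedding V N W N' \<longleftrightarrow> V \<subseteq> W \<and> (\<exists>C. \<forall>x\<in>V. N' x \<le> C * N x)"

definition intermediate_space ::
  "'a::complex_banach set \<Rightarrow> ('a \<Rightarrow> 'a) \<Rightarrow> real \<Rightarrow> 'a set \<Rightarrow> ('a \<Rightarrow> real) \<Rightarrow> bool" where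
  "intermediate_space D A \<alpha> V N \<longleftrightarrow>
     (if \<alpha> = 0 then V = UNIV \<and> N = norm
      else banach_subspace V N \<and>
        continuous_embedding (interp_space D A \<alpha> 1) (interp_norm D A \<alpha> 1) V N \<and>
        continuous_embedding V N (interp_space D A \<alpha> \<infinity>) (interp_norm D A \<alpha> \<infinity>))"

section \<open>Exponential Runge--Kutta methods\<close>

definition phi :: "nat \<Rightarrow> complex \<Rightarrow> complex" where
  "phi k z = (if k = 0 then exp z
     else integral {0..1} (\<lambda>\<xi>. exp (of_real (1 - \<xi>) * z) * of_real (\<xi> ^ (k - 1) / fact (k - 1))))"

text \<open>\<open>phi_op D A k t\<close> is $\varphi_k(tA)$.\<close>

definition phi_op ::
  "'a::complex_banach set \<Rightarrow> ('a \<Rightarrow> 'a) \<Rightarrow> nat \<Rightarrow> real \<Rightarrow> 'a \<Rightarrow> 'a" where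
  "phi_op D A k t x = (if k = 0 then semigroup_of D A t x
     else integral {0..1} (\<lambda>\<xi>. (\<xi> ^ (k - 1) / fact (k - 1)) *\<^sub>R semigroup_of D A ((1 - \<xi>) * t) x))"

text \<open>A weight $b(z) = \sum_{k\le K} \beta_k \varphi_k(z)$ is given by its coefficients; these also
  determine the operator $b(tA) = \sum_{k\le K} \beta_k \varphi_k(tA)$.\<close>

definition weight :: "nat \<Rightarrow> (nat \<Rightarrow> complex) \<Rightarrow> complex \<Rightarrow> complex" where
  "weight K \<beta> z = (\<Sum>k\<le>K. \<beta> k * phi k z)"

definition weight_op ::
  "'a::complex_banach set \<Rightarrow> ('a \<Rightarrow> 'a) \<Rightarrow> nat \<Rightarrow> (nat \<Rightarrow> complex) \<Rightarrow> real \<Rightarrow> 'a \<Rightarrow> 'a" where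
  "weight_op D A K \<beta> t x = (\<Sum>k\<le>K. \<beta> k *\<^sub>C phi_op D A k t x)"

primrec exp_rk ::
  "'a::complex_banach set \<Rightarrow> ('a \<Rightarrow> 'a) \<Rightarrow> nat \<Rightarrow> (nat \<Rightarrow> real) \<Rightarrow> nat \<Rightarrow> (nat \<Rightarrow> nat \<Rightarrow> complex) \<Rightarrow>
     (real \<Rightarrow> 'a) \<Rightarrow> 'a \<Rightarrow> real \<Rightarrow> nat \<Rightarrow> 'a" where
  "exp_rk D A s c K \<beta> g u0 \<tau> 0 = u0"
| "exp_rk D A s c K \<beta> g u0 \<tau> (Suc n) = semigroup_of D A \<tau> (exp_rk D A s c K \<beta> g u0 \<tau> n)
     + \<tau> *\<^sub>R (\<Sum>i=1..s. weight_op D A K (\<beta> i) \<tau> (g (real n * \<tau> + c i * \<tau>)))"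

definition mild_solution ::
  "'a::complex_banach set \<Rightarrow> ('a \<Rightarrow> 'a) \<Rightarrow> (real \<Rightarrow> 'a) \<Rightarrow> 'a \<Rightarrow> real \<Rightarrow> 'a" where
  "mild_solution D A g u0 t =
     semigroup_of D A t u0 + integral {0..t} (\<lambda>\<xi>. semigroup_of D A (t - \<xi>) (g \<xi>))"

end

theory Submission
  imports Defs
begin

text \<open>The error is \<open>\<Sum>j<n. e\<^bsup>(n-1-j)\<tau>A\<^esup> \<delta>\<^sub>j\<close> with the defects \<open>\<delta>\<^sub>j\<close> of the single steps. The functions
  \<open>\<phi>\<^sub>k\<close> are linearly independent, so that the assumption on the weights carries over to the operators
  \<open>b\<^sub>i(\<tau>A)\<close>, and \<open>g(t\<^sub>j)\<close> can be subtracted from all values of \<open>g\<close> in \<open>\<delta>\<^sub>j\<close>; as \<open>g\<close> is Lipschitz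
  continuous with constant \<open>B\<^sub>1/t\<^sub>j\<close> on \<open>[t\<^sub>j, T]\<close>, this gives \<open>\<parallel>\<delta>\<^sub>j\<parallel> \<le> C\<tau>/(j+1)\<close>. In the norm of
  \<open>X\<^sub>\<alpha>\<close> one loses \<open>\<tau>\<^bsup>-\<alpha>\<^esup>\<close> from the smoothing estimate \<open>\<parallel>e\<^bsup>tA\<^esup>\<parallel> \<le> Ct\<^bsup>-\<alpha>\<^esup>\<close> from \<open>X\<close> to \<open>X\<^sub>\<alpha>\<close>, except that in the
  last term \<open>j = n-1\<close> it is the averaging in \<open>\<delta>\<^sub>j\<close> that smooths. The logarithm is the harmonic sum.

  The properties of \<open>e\<^bsup>tA\<^esup>\<close> are obtained from the Dunford integral, shifted to \<open>\<omega> = 0\<close>. The bounds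
  \<open>\<parallel>e\<^bsup>tA\<^esup>\<parallel> \<le> C\<close> and \<open>\<parallel>Ae\<^bsup>tA\<^esup>\<parallel> \<le> C/t\<close> result from the choice of the radius \<open>1/t\<close> for the arc. The semigroup law
  follows from a uniqueness argument for \<open>u' = Au\<close> instead of a double contour integral, so that no
  vector-valued Fubini theorem is needed.\<close>

section \<open>Integrals with values in a Banach space\<close>

text \<open>As \<open>D\<close> need not be dense, the semigroup may be discontinuous at 0, and
  \<open>g\<close> is not known to be continuous there either, its derivative bound
  \<open>B\<^sub>1 / t\<close> not being integrable. Hence the time integrals are those of bounded
  functions that are continuous on the open interval only, and differences of \<open>g\<close> are
  controlled on intervals \<open>[a, T]\<close> with \<open>a > 0\<close>.

  Since X_\<alpha> is accessible only through embeddings, an estimate in its norm amounts to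
  integrating \<open>s powr (- \<alpha>)\<close> times the norm of \<open>A e^(sA) x\<close> over
  \<open>0 < s < 1\<close>. Both the operator \<open>e^(tA)\<close> and an average of
  \<open>e^(\<sigma>A)\<close> over \<open>0 \<le> \<sigma> \<le> t\<close> improve the bound
  \<open>C / s\<close> for \<open>A e^(sA)\<close> to a multiple of
  \<open>ln (1 + t / s) / t\<close>, which is only logarithmic at \<open>s = 0\<close> and of order
  \<open>1 / s\<close> for \<open>s > t\<close>. Integrated against
  \<open>s powr (- \<alpha>)\<close> it gives a multiple of \<open>t powr (- \<alpha>)\<close>. So
  the last defect, to which only the identity is applied, obeys the same estimate as the others.
  Since \<open>s < 1\<close> is added to times up to \<open>T\<close>, the bounds on the semigroup
  are needed up to \<open>T + 1\<close>.\<close>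

lemma bounded_bilinear_scaleC:
  "bounded_bilinear (scaleC :: complex \<Rightarrow> 'a::complex_banach \<Rightarrow> 'a)"
proof
  fix r :: real and a :: complex and x :: 'a
  show "(r *\<^sub>R a) *\<^sub>C x = r *\<^sub>R (a *\<^sub>C x)"
    by (simp add: scaleR_conv_of_real flip: scaleC_of_real scaleC_scaleC)
  show "a *\<^sub>C (r *\<^sub>R x) = r *\<^sub>R (a *\<^sub>C x)"
    by (simp add: mult.commute scaleC_scaleC flip: scaleC_of_real)
  show "\<exists>K. \<forall>a b. norm (a *\<^sub>C (b::'a)) \<le> norm a * norm b * K"
    by (rule exI[of _ 1]) (simp add: norm_scaleC)
qed (simp_all add: scaleC_add_left scaleC_add_right)

interpretation scaleC: bounded_bilinear "scaleC :: complex \<Rightarrow> 'a::complex_banach \<Rightarrow> 'a"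
  by (rule bounded_bilinear_scaleC)

lemmas scaleC_continuous_intros [continuous_intros] = scaleC.continuous_on

lemma scaleC_one [simp]: "1 *\<^sub>C (x::'a::complex_banach) = x"
  using scaleC_of_real[of 1 x] by simp

lemma scaleC_left_commute: "a *\<^sub>C b *\<^sub>C x = b *\<^sub>C a *\<^sub>C (x::'a::complex_banach)"
  by (simp add: scaleC_scaleC mult.commute)

text \<open>The indefinite integral is Lipschitz on \<open>{a..<b}\<close> and therefore extends
  continuously to \<open>b\<close>; the fundamental theorem of calculus for functions differentiable
  in the interior then gives the integral up to \<open>b\<close>, whatever value \<open>f\<close>
  has there.\<close>

lemma integrable_bounded_continuous_right:
  fixes f :: "real \<Rightarrow> 'a::banach"
  assumes c: "continuous_on {a..<b} f" and K: "\<And>x. x \<in> {a..<b} \<Longrightarrow> norm (f x) \<le> K"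
  shows "f integrable_on {a..b}"
proof (cases "a < b")
  case False
  then show ?thesis using integrable_on_refl[of f b] by (cases "a = b") auto
next
  case True
  define F where "F = (\<lambda>x. integral {a..x} f)"
  have cx: "continuous_on {a..x} f" if "x < b" for x
    by (rule continuous_on_subset[OF c]) (use that in auto)
  have lip: "norm (F y - F x) \<le> K * (y - x)" if "a \<le> x" "x \<le> y" "y < b" for x y
  proof -
    have "F x + integral {x..y} f = F y"
      unfolding F_def
      by (rule Henstock_Kurzweil_Integration.integral_combine)
         (use that cx[of y] integrable_continuous_real in auto)
    moreover have "norm (integral {x..y} f) \<le> K * (y - x)"
      by (rule integral_bound) (use that K in \<open>auto intro: continuous_on_subset[OF cx[of y]]\<close>)
    ultimately show ?thesis by (metis add_diff_cancel_left')
  qed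
  have Kpos: "K \<ge> 0" using K[of a] True by (meson atLeastLessThan_iff norm_ge_zero order_trans order_refl)
  have "K-lipschitz_on {a..<b} F"
  proof (rule lipschitz_onI[OF _ Kpos])
    fix x y assume "x \<in> {a..<b}" "y \<in> {a..<b}"
    then show "dist (F x) (F y) \<le> K * dist x y"
      using lip[of x y] lip[of y x] by (cases "x \<le> y") (auto simp: dist_norm norm_minus_commute)
  qed
  then have "uniformly_continuous_on {a..<b} F"
    by (rule lipschitz_on_uniformly_continuous)
  then obtain g where g: "uniformly_continuous_on (closure {a..<b}) g" "\<And>x. x \<in> {a..<b} \<Longrightarrow> F x = g x"
    using uniformly_continuous_on_extension_on_closure[of "{a..<b}" F] by metis
  have "continuous_on {a..b} g"
    using uniformly_continuous_imp_continuous[OF g(1)] True by simp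
  moreover have "(g has_vector_derivative f x) (at x)" if "x \<in> {a<..<b}" for x
  proof -
    from that obtain y where y: "x < y" "y < b" using dense by auto
    have "((\<lambda>u. integral {a..u} f) has_vector_derivative f x) (at x within {a..y})"
      by (rule integral_has_vector_derivative) (use that y cx in auto)
    then have "(F has_vector_derivative f x) (at x within {a<..<y})"
      unfolding F_def by (rule has_vector_derivative_within_subset) auto
    then have "(F has_vector_derivative f x) (at x)"
      using that y by (subst (asm) at_within_open) auto
    then show ?thesis
      by (rule has_vector_derivative_transform_within_open[where S="{a<..<b}"]) (use that g in auto)
  qed
  ultimately have "(f has_integral (g b - g a)) {a..b}"
    by (intro fundamental_theorem_of_calculus_interior) (use True in auto)
  then show ?thesis by blast
qed

lemma integrable_bounded_continuous_interior:
  fixes f :: "real \<Rightarrow> 'a::banach"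
  assumes c: "continuous_on {a<..<b} f" and K: "\<And>x. x \<in> {a<..<b} \<Longrightarrow> norm (f x) \<le> K"
  shows "f integrable_on {a..b}"
proof (cases "a < b")
  case False
  then show ?thesis using integrable_on_refl[of f b] by (cases "a = b") auto
next
  case True
  then obtain m where m: "a < m" "m < b" using dense by blast
  have "f integrable_on {m..b}"
    by (rule integrable_bounded_continuous_right[where K=K])
       (use m K in \<open>auto intro: continuous_on_subset[OF c]\<close>)
  moreover have "(\<lambda>x. f (-x)) integrable_on {-m..-a}"
    by (rule integrable_bounded_continuous_right[where K=K])
       (use m K in \<open>auto intro!: continuous_on_compose2[OF c] continuous_intros\<close>)
  then have "f integrable_on {a..m}" by (simp add: integrable_reflect_real)
  ultimately show ?thesis using m Henstock_Kurzweil_Integration.integrable_combine[of a m b f] by auto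
qed

text \<open>The tail beyond \<open>x\<close> is at most
  \<open>K * exp (- \<epsilon> * x) / \<epsilon>\<close>, so the integrals over
  \<open>{r..N}\<close> converge, and their limit is the integral over the unbounded set. The third
  claim is this tail bound at \<open>x = r\<close>.\<close>

lemma
  fixes f :: "real \<Rightarrow> 'a::banach"
  assumes c: "continuous_on {r..} f" and e: "\<epsilon> > 0"
    and K: "\<And>x. x \<ge> r \<Longrightarrow> norm (f x) \<le> K * exp (- \<epsilon> * x)"
  shows integrable_exp_decay: "f integrable_on {r..}"
    and integral_exp_decay_tendsto: "((\<lambda>N. integral {r..N} f) \<longlongrightarrow> integral {r..} f) at_top"
    and norm_integral_exp_decay: "norm (integral {r..} f) \<le> K * exp (- \<epsilon> * r) / \<epsilon>"
proof -
  define J where "J N = integral {r..N} f" for N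
  have cx: "continuous_on {x..y} f" if "r \<le> x" for x y
    by (rule continuous_on_subset[OF c]) (use that in auto)
  have "0 \<le> K * exp (- \<epsilon> * r)" using K[of r] norm_ge_zero order_trans by blast
  then have Kpos: "K \<ge> 0" by (simp add: zero_le_mult_iff)
  have J1: "norm (J y - J x) \<le> K * exp (- \<epsilon> * x) / \<epsilon>" if "r \<le> x" "x \<le> y" for x y
  proof -
    have 1: "J x + integral {x..y} f = J y"
      unfolding J_def
      by (rule Henstock_Kurzweil_Integration.integral_combine)
         (use that cx[of r y] integrable_continuous_real in auto)
    have "((\<lambda>x. exp (-\<epsilon>*x)) has_integral (-exp (-\<epsilon>*y)/\<epsilon> - (-exp (-\<epsilon>*x)/\<epsilon>))) {x..y}"
      by (rule fundamental_theorem_of_calculus)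
         (use that e in \<open>auto intro!: derivative_eq_intros simp: has_real_derivative_iff_has_vector_derivative[symmetric]\<close>)
    then have 2: "((\<lambda>x. K * exp (-\<epsilon>*x)) has_integral K * (-exp (-\<epsilon>*y)/\<epsilon> - (-exp (-\<epsilon>*x)/\<epsilon>))) {x..y}"
      by (rule has_integral_mult_right)
    have "norm (integral {x..y} f) \<le> integral {x..y} (\<lambda>x. K * exp (-\<epsilon>*x))"
      by (rule Henstock_Kurzweil_Integration.integral_norm_bound_integral)
         (use that K 2 in \<open>auto intro!: integrable_continuous_real cx continuous_intros\<close>)
    also have "\<dots> = K * (exp (-\<epsilon>*x) - exp (-\<epsilon>*y))/\<epsilon>"
      using integral_unique[OF 2] e by (simp add: field_simps)
    also have "\<dots> \<le> K * exp (-\<epsilon>*x)/\<epsilon>"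
      using e Kpos by (intro divide_right_mono mult_left_mono) auto
    finally show ?thesis using 1 by (metis add_diff_cancel_left')
  qed
  have lim0: "((\<lambda>x. K * exp (- \<epsilon> * x) / \<epsilon>) \<longlongrightarrow> 0) at_top"
    using e by real_asymp
  have small: "\<forall>\<^sub>F x in at_top. K * exp (- \<epsilon> * x) / \<epsilon> < d" if "d > 0" for d
    using order_tendstoD(2)[OF lim0 that] .
  have "Cauchy (\<lambda>n. J (r + real n))"
  proof (rule CauchyI)
    fix d :: real assume d: "0 < d"
    have "filterlim (\<lambda>n. r + real n) at_top sequentially" by real_asymp
    from eventually_compose_filterlim[OF small[of "d/2"] this] d
    obtain n0 where n0: "K * exp (- \<epsilon> * (r + real n)) / \<epsilon> < d/2" if "n \<ge> n0" for n
      unfolding eventually_sequentially by auto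
    show "\<exists>M. \<forall>m\<ge>M. \<forall>n\<ge>M. norm (J (r + real m) - J (r + real n)) < d"
    proof (intro exI[of _ n0] allI impI)
      fix m n assume mn: "n0 \<le> m" "n0 \<le> n"
      have "norm (J (r + real m) - J (r + real n0)) < d/2" "norm (J (r + real n) - J (r + real n0)) < d/2"
        using order.strict_trans1[OF J1[of "r+n0" "r+m"] n0[of n0]]
          order.strict_trans1[OF J1[of "r+n0" "r+n"] n0[of n0]] mn by auto
      then show "norm (J (r + real m) - J (r + real n)) < d"
        by (smt (verit) norm_minus_commute norm_diff_triangle_less field_sum_of_halves)
    qed
  qed
  then obtain L where L: "(\<lambda>n. J (r + real n)) \<longlonglongrightarrow> L" by (auto simp: Cauchy_convergent_iff convergent_def)
  have J2: "norm (L - J x) \<le> K * exp (- \<epsilon> * x) / \<epsilon>" if "r \<le> x" for x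
  proof (rule tendsto_upperbound)
    show "(\<lambda>n. norm (J (r + real n) - J x)) \<longlonglongrightarrow> norm (L - J x)"
      by (intro tendsto_intros L)
    have "\<forall>\<^sub>F n in sequentially. r + real n \<ge> x" by real_asymp
    then show "\<forall>\<^sub>F n in sequentially. norm (J (r + real n) - J x) \<le> K * exp (- \<epsilon> * x) / \<epsilon>"
      by eventually_elim (use J1 that in auto)
  qed simp
  have hi: "(f has_integral L) {r..}"
    unfolding has_integral_alt'
  proof (intro conjI allI impI)
    fix a b :: real
    have eq: "cbox a b \<inter> {r..} = {max a r..b}" by auto
    show "(\<lambda>x. if x \<in> {r..} then f x else 0) integrable_on cbox a b"
      by (subst integrable_restrict_Int) (auto simp: Int_commute[of _ "cbox a b"] eq intro!: integrable_continuous_real cx)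
  next
    fix d :: real assume "d > 0"
    from small[OF this] obtain N where N: "\<And>x. x \<ge> N \<Longrightarrow> K * exp (- \<epsilon> * x) / \<epsilon> < d"
      unfolding eventually_at_top_linorder by auto
    \<comment> \<open>Every window around this ball contains both \<open>r\<close> and
      \<open>N\<close>: it meets \<open>{r..}\<close> in \<open>{r..b}\<close>, and the tail beyond
      \<open>b\<close> is smaller than \<open>d\<close>.\<close>
    define B where "B = \<bar>N\<bar> + \<bar>r\<bar> + 1"
    show "\<exists>B>0. \<forall>a b. ball 0 B \<subseteq> cbox a b \<longrightarrow>
           norm (integral (cbox a b) (\<lambda>x. if x \<in> {r..} then f x else 0) - L) < d"
    proof (intro exI[of _ B] conjI allI impI)
      show "B > 0" by (simp add: B_def)
      fix a b :: real assume ab: "ball 0 B \<subseteq> cbox a b"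
      have "- (\<bar>N\<bar> + \<bar>r\<bar>) \<in> ball 0 B" "\<bar>N\<bar> + \<bar>r\<bar> \<in> ball 0 B" by (auto simp: B_def)
      then have "- (\<bar>N\<bar> + \<bar>r\<bar>) \<in> {a..b}" "\<bar>N\<bar> + \<bar>r\<bar> \<in> {a..b}" using ab by (metis cbox_interval subsetD)+
      then have ab': "a \<le> - (\<bar>N\<bar> + \<bar>r\<bar>)" "\<bar>N\<bar> + \<bar>r\<bar> \<le> b" unfolding atLeastAtMost_iff by blast+
      then have eq: "max r a = r" by auto
      have "r \<le> b" "N \<le> b" using ab' by linarith+
      then have "norm (L - J b) < d" using J2[of b] N[of b] by linarith
      then show "norm (integral (cbox a b) (\<lambda>x. if x \<in> {r..} then f x else 0) - L) < d"
        by (subst integral_restrict_Int) (auto simp: eq J_def norm_minus_commute)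
    qed
  qed
  then show "f integrable_on {r..}" by blast
  from hi have L: "integral {r..} f = L" by blast
  show "((\<lambda>N. integral {r..N} f) \<longlongrightarrow> integral {r..} f) at_top"
    unfolding L
  proof (rule Lim_null_comparison[THEN LIM_zero_cancel, rotated, OF lim0])
    show "\<forall>\<^sub>F x in at_top. norm (integral {r..x} f - L) \<le> K * exp (- \<epsilon> * x) / \<epsilon>"
      using eventually_ge_at_top[of r] by eventually_elim (use J2 in \<open>auto simp: J_def norm_minus_commute\<close>)
  qed
  show "norm (integral {r..} f) \<le> K * exp (- \<epsilon> * r) / \<epsilon>"
    using J2[of r] by (simp add: L J_def)
qed

section \<open>Integrals over the Dunford contour\<close>

lemma has_vector_derivative_arc:
  "((\<lambda>s. of_real r * cis s) has_vector_derivative \<i> * of_real r * cis s) (at s within S)"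
  unfolding has_vector_derivative_def
  by (auto intro!: derivative_eq_intros simp: scaleR_conv_of_real algebra_simps)

lemma exp_decay_tendsto: "0 < a \<Longrightarrow> ((\<lambda>x::real. exp (- a * x)) \<longlongrightarrow> 0) at_top"
  by real_asymp

lemma has_vector_derivative_ray:
  "((\<lambda>\<rho>. of_real \<rho> * cis \<sigma>) has_vector_derivative cis \<sigma>) (at \<rho> within S)"
  unfolding has_vector_derivative_def
  by (auto intro!: derivative_eq_intros simp: scaleR_conv_of_real)

locale sector_contour =
  fixes \<eta> :: real
  assumes eta: "pi / 2 < \<eta>" "\<eta> < pi"
begin

text \<open>The union of all arcs and rays of contours of arbitrary radius. It is not open, so
  complex derivatives are taken within it, see \<open>cderiv\<close>.\<close>

definition Sec :: "complex set" where
  "Sec = {of_real \<rho> * cis s |\<rho> s. 0 < \<rho> \<and> \<bar>s\<bar> \<le> \<eta>}"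

text \<open>The decay exponent on the rays, where \<open>exp (t * z)\<close> has modulus
  \<open>exp (- (rate * t) * \<rho>)\<close>; it is positive because \<eta> exceeds a right
  angle.\<close>

definition rate :: real where "rate = - cos \<eta>"

text \<open>The integral over the curve of \<open>dunford_integral\<close>, without the shift by \<open>\<omega>\<close> and the factor
  \<open>1 / (2\<pi>\<i>)\<close>.\<close>

definition gint :: "real \<Rightarrow> (complex \<Rightarrow> 'a::complex_banach) \<Rightarrow> 'a" where
  "gint r F =
     integral {-\<eta>..\<eta>} (\<lambda>s. (\<i> * of_real r * cis s) *\<^sub>C F (of_real r * cis s))
     + integral {r..} (\<lambda>\<rho>. cis \<eta> *\<^sub>C F (of_real \<rho> * cis \<eta>))
     - integral {r..} (\<lambda>\<rho>. cis (-\<eta>) *\<^sub>C F (of_real \<rho> * cis (-\<eta>)))"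

text \<open>Cut off at modulus \<open>N\<close> the contour has end points, so that a primitive
  evaluates the integral; \<open>gint\<close> is the limit for large \<open>N\<close>.\<close>

definition trunc_gint :: "real \<Rightarrow> real \<Rightarrow> (complex \<Rightarrow> 'a::complex_banach) \<Rightarrow> 'a" where
  "trunc_gint r N F =
     integral {-\<eta>..\<eta>} (\<lambda>s. (\<i> * of_real r * cis s) *\<^sub>C F (of_real r * cis s))
     + integral {r..N} (\<lambda>\<rho>. cis \<eta> *\<^sub>C F (of_real \<rho> * cis \<eta>))
     - integral {r..N} (\<lambda>\<rho>. cis (-\<eta>) *\<^sub>C F (of_real \<rho> * cis (-\<eta>)))"

text \<open>The constants may depend on \<open>r\<close>, because the integrands in question may
  blow up at 0.\<close>

definition decays :: "(complex \<Rightarrow> 'a::complex_banach) \<Rightarrow> bool" where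
  "decays F \<longleftrightarrow> continuous_on Sec F \<and>
     (\<forall>r>0. \<exists>K \<epsilon>. 0 < \<epsilon> \<and> (\<forall>\<rho>\<ge>r. \<forall>\<sigma>\<in>{\<eta>, -\<eta>}. norm (F (of_real \<rho> * cis \<sigma>)) \<le> K * exp (- \<epsilon> * \<rho>)))"

definition cderiv :: "(complex \<Rightarrow> 'a::complex_banach) \<Rightarrow> (complex \<Rightarrow> 'a) \<Rightarrow> bool" where
  "cderiv F F' \<longleftrightarrow> (\<forall>z\<in>Sec. (F has_derivative (\<lambda>h. h *\<^sub>C F' z)) (at z within Sec))"

lemma rate_pos: "0 < rate"
  using cos_lt_zero_pi[of \<eta>] eta by (simp add: rate_def)

lemma SecI: "0 < \<rho> \<Longrightarrow> \<bar>s\<bar> \<le> \<eta> \<Longrightarrow> of_real \<rho> * cis s \<in> Sec"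
  unfolding Sec_def by blast

lemma SecE:
  assumes "z \<in> Sec"
  obtains \<rho> s where "0 < \<rho>" "\<bar>s\<bar> \<le> \<eta>" "z = of_real \<rho> * cis s" "cmod z = \<rho>"
  using assms unfolding Sec_def by (force simp: norm_mult)

lemma Sec_nonzero: "z \<in> Sec \<Longrightarrow> z \<noteq> 0"
  by (auto elim!: SecE)

lemma eta_pos: "0 < \<eta>"
  using eta pi_gt_zero by linarith

lemma ray_in_Sec: "0 < \<rho> \<Longrightarrow> \<sigma> \<in> {\<eta>, -\<eta>} \<Longrightarrow> of_real \<rho> * cis \<sigma> \<in> Sec"
  using eta_pos by (intro SecI) auto

lemma cderiv_chain:
  assumes "cderiv F F'" "(\<gamma> has_vector_derivative \<gamma>') (at s within S)" "\<gamma> ` S \<subseteq> Sec" "s \<in> S"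
  shows "((\<lambda>s. F (\<gamma> s)) has_vector_derivative \<gamma>' *\<^sub>C F' (\<gamma> s)) (at s within S)"
proof -
  have "\<gamma> s \<in> Sec" using assms(3,4) by blast
  then have "(F has_derivative (\<lambda>h. h *\<^sub>C F' (\<gamma> s))) (at (\<gamma> s) within \<gamma> ` S)"
    using assms(1) has_derivative_subset[OF _ assms(3)] unfolding cderiv_def by blast
  from vector_derivative_diff_chain_within[OF assms(2) this] show ?thesis by (simp add: o_def)
qed

lemma cderiv_continuous: "cderiv F F' \<Longrightarrow> continuous_on Sec F"
  using has_derivative_continuous_on[where f'="\<lambda>z h. h *\<^sub>C F' z"] unfolding cderiv_def by blast

lemma decaysD_cont: "decays F \<Longrightarrow> continuous_on Sec F"
  by (simp add: decays_def)

lemma continuous_on_arc_fun: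
  assumes "continuous_on Sec F" "0 < r" "{a..b} \<subseteq> {-\<eta>..\<eta>}"
  shows "continuous_on {a..b} (\<lambda>s. (\<i> * of_real r * cis s) *\<^sub>C F (of_real r * cis s))"
proof -
  have "(\<lambda>s. of_real r * cis s) ` {a..b} \<subseteq> Sec"
    using assms by (force intro!: SecI)
  then show ?thesis
    by (intro continuous_intros continuous_on_compose2[OF assms(1)]) auto
qed

lemma continuous_on_ray_fun:
  assumes "continuous_on Sec F" "S \<subseteq> {0<..}" "\<sigma> \<in> {\<eta>, -\<eta>}"
  shows "continuous_on S (\<lambda>\<rho>. cis \<sigma> *\<^sub>C F (of_real \<rho> * cis \<sigma>))"
proof -
  have "(\<lambda>\<rho>. of_real \<rho> * cis \<sigma>) ` S \<subseteq> Sec"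
    using assms ray_in_Sec by (auto simp: subset_iff)
  then show ?thesis
    by (intro continuous_intros continuous_on_compose2[OF assms(1)]) auto
qed

lemma decays_integrable_arc:
  "decays F \<Longrightarrow> 0 < r \<Longrightarrow> (\<lambda>s. (\<i> * of_real r * cis s) *\<^sub>C F (of_real r * cis s)) integrable_on {-\<eta>..\<eta>}"
  by (intro integrable_continuous_real continuous_on_arc_fun) (auto dest: decaysD_cont)

lemma decays_ray:
  assumes "decays F" "0 < r" "\<sigma> \<in> {\<eta>, -\<eta>}"
  shows "(\<lambda>\<rho>. cis \<sigma> *\<^sub>C F (of_real \<rho> * cis \<sigma>)) integrable_on {r..}"
    and "((\<lambda>N. integral {r..N} (\<lambda>\<rho>. cis \<sigma> *\<^sub>C F (of_real \<rho> * cis \<sigma>))) \<longlongrightarrow>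
          integral {r..} (\<lambda>\<rho>. cis \<sigma> *\<^sub>C F (of_real \<rho> * cis \<sigma>))) at_top"
proof -
  obtain K \<epsilon> where K: "0 < \<epsilon>" "\<And>\<rho>. \<rho> \<ge> r \<Longrightarrow> norm (F (of_real \<rho> * cis \<sigma>)) \<le> K * exp (- \<epsilon> * \<rho>)"
    using assms unfolding decays_def by metis
  have c: "continuous_on {r..} (\<lambda>\<rho>. cis \<sigma> *\<^sub>C F (of_real \<rho> * cis \<sigma>))"
    by (rule continuous_on_ray_fun) (use assms decaysD_cont in auto)
  have b: "norm (cis \<sigma> *\<^sub>C F (of_real \<rho> * cis \<sigma>)) \<le> K * exp (- \<epsilon> * \<rho>)" if "\<rho> \<ge> r" for \<rho>
    using K(2)[OF that] by (simp add: norm_scaleC)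
  show "(\<lambda>\<rho>. cis \<sigma> *\<^sub>C F (of_real \<rho> * cis \<sigma>)) integrable_on {r..}"
    by (rule integrable_exp_decay[OF c K(1) b])
  show "((\<lambda>N. integral {r..N} (\<lambda>\<rho>. cis \<sigma> *\<^sub>C F (of_real \<rho> * cis \<sigma>))) \<longlongrightarrow>
          integral {r..} (\<lambda>\<rho>. cis \<sigma> *\<^sub>C F (of_real \<rho> * cis \<sigma>))) at_top"
    by (rule integral_exp_decay_tendsto[OF c K(1) b])
qed

lemma decays_linear:
  assumes "decays F" "bounded_linear L"
  shows "decays (\<lambda>z. L (F z))"
proof -
  interpret L: bounded_linear L by fact
  obtain B where B: "\<And>x. norm (L x) \<le> norm x * B" "B > 0" using L.pos_bounded by blast
  show ?thesis
    unfolding decays_def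
  proof (intro conjI allI impI)
    show "continuous_on Sec (\<lambda>z. L (F z))"
      by (intro L.continuous_on decaysD_cont assms)
    fix r :: real assume "r > 0"
    with assms(1) obtain K \<epsilon> where K: "0 < \<epsilon>"
      "\<And>\<rho> \<sigma>. \<rho>\<ge>r \<Longrightarrow> \<sigma>\<in>{\<eta>, -\<eta>} \<Longrightarrow> norm (F (of_real \<rho> * cis \<sigma>)) \<le> K * exp (- \<epsilon> * \<rho>)"
      unfolding decays_def by meson
    show "\<exists>K \<epsilon>. 0 < \<epsilon> \<and> (\<forall>\<rho>\<ge>r. \<forall>\<sigma>\<in>{\<eta>, -\<eta>}. norm (L (F (of_real \<rho> * cis \<sigma>))) \<le> K * exp (- \<epsilon> * \<rho>))"
    proof (rule exI[of _ "K * B"], rule exI[of _ \<epsilon>], intro conjI allI impI ballI K(1))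
      fix \<rho> \<sigma> assume "r \<le> \<rho>" "\<sigma> \<in> {\<eta>, -\<eta>}"
      then have "norm (F (of_real \<rho> * cis \<sigma>)) * B \<le> K * exp (- \<epsilon> * \<rho>) * B"
        using K(2) B(2) by (intro mult_right_mono) auto
      then show "norm (L (F (of_real \<rho> * cis \<sigma>))) \<le> K * B * exp (- \<epsilon> * \<rho>)"
        using B(1)[of "F (of_real \<rho> * cis \<sigma>)"] by (simp add: mult_ac)
    qed
  qed
qed

lemma decays_add:
  assumes "decays F" "decays G"
  shows "decays (\<lambda>z. F z + G z)"
  unfolding decays_def
proof (intro conjI allI impI)
  show "continuous_on Sec (\<lambda>z. F z + G z)"
    by (intro continuous_intros decaysD_cont assms)
  fix r :: real assume r: "r > 0"
  obtain K \<epsilon> where K: "0 < \<epsilon>"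
      "\<And>\<rho> \<sigma>. \<rho>\<ge>r \<Longrightarrow> \<sigma>\<in>{\<eta>, -\<eta>} \<Longrightarrow> norm (F (of_real \<rho> * cis \<sigma>)) \<le> K * exp (- \<epsilon> * \<rho>)"
    using assms(1) r unfolding decays_def by meson
  obtain K' \<epsilon>' where K': "0 < \<epsilon>'"
      "\<And>\<rho> \<sigma>. \<rho>\<ge>r \<Longrightarrow> \<sigma>\<in>{\<eta>, -\<eta>} \<Longrightarrow> norm (G (of_real \<rho> * cis \<sigma>)) \<le> K' * exp (- \<epsilon>' * \<rho>)"
    using assms(2) r unfolding decays_def by meson
  have "0 \<le> K * exp (- \<epsilon> * r)" "0 \<le> K' * exp (- \<epsilon>' * r)"
    using K(2)[of r \<eta>] K'(2)[of r \<eta>] norm_ge_zero order_trans by blast+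
  then have pos: "0 \<le> K" "0 \<le> K'" by (simp_all add: zero_le_mult_iff)
  show "\<exists>K \<epsilon>. 0 < \<epsilon> \<and> (\<forall>\<rho>\<ge>r. \<forall>\<sigma>\<in>{\<eta>, -\<eta>}. norm (F (of_real \<rho> * cis \<sigma>) + G (of_real \<rho> * cis \<sigma>)) \<le> K * exp (- \<epsilon> * \<rho>))"
  proof (rule exI[of _ "K + K'"], rule exI[of _ "min \<epsilon> \<epsilon>'"], intro conjI allI impI ballI)
    fix \<rho> \<sigma> assume *: "r \<le> \<rho>" "\<sigma> \<in> {\<eta>, -\<eta>}"
    have "norm (F (of_real \<rho> * cis \<sigma>)) \<le> K * exp (- min \<epsilon> \<epsilon>' * \<rho>)"
      by (rule order_trans[OF K(2)[OF *]]) (use * r pos in \<open>auto intro!: mult_left_mono\<close>)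
    moreover have "norm (G (of_real \<rho> * cis \<sigma>)) \<le> K' * exp (- min \<epsilon> \<epsilon>' * \<rho>)"
      by (rule order_trans[OF K'(2)[OF *]]) (use * r pos in \<open>auto intro!: mult_left_mono\<close>)
    ultimately show "norm (F (of_real \<rho> * cis \<sigma>) + G (of_real \<rho> * cis \<sigma>)) \<le> (K + K') * exp (- min \<epsilon> \<epsilon>' * \<rho>)"
      by (intro order_trans[OF norm_triangle_ineq]) (simp add: distrib_right)
  qed (use K K' in auto)
qed

lemma decays_uminus: "decays F \<Longrightarrow> decays (\<lambda>z. - F z)"
  by (rule decays_linear[where L=uminus]) (auto intro: bounded_linear_minus bounded_linear_ident)

lemma decays_diff: "decays F \<Longrightarrow> decays G \<Longrightarrow> decays (\<lambda>z. F z - G z)"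
  using decays_add[OF _ decays_uminus, of F G] by simp

lemma decays_scaleC: "decays F \<Longrightarrow> decays (\<lambda>z. a *\<^sub>C F z)"
  by (rule decays_linear[where L="scaleC a"]) (auto intro: scaleC.bounded_linear_right)

lemma gint_linear:
  assumes "decays F" "bounded_linear L" "\<And>a x. L (a *\<^sub>C x) = a *\<^sub>C L x" "0 < r"
  shows "gint r (\<lambda>z. L (F z)) = L (gint r F)"
proof -
  interpret L: bounded_linear L by fact
  have "integral S (\<lambda>s. L (f s)) = L (integral S f)" if "f integrable_on S" for f :: "real \<Rightarrow> _" and S
    using integral_linear[OF that assms(2)] by (simp add: o_def)
  note this[OF decays_integrable_arc[OF assms(1,4)]] this[OF decays_ray(1)[OF assms(1,4)]]
  then show ?thesis
    unfolding gint_def by (simp add: L.add L.diff flip: assms(3))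
qed

lemma gint_scaleC: "decays F \<Longrightarrow> 0 < r \<Longrightarrow> gint r (\<lambda>z. a *\<^sub>C F z) = a *\<^sub>C gint r F"
  by (rule gint_linear[where L="scaleC a"])
     (auto simp: scaleC_scaleC mult.commute intro: scaleC.bounded_linear_right)

lemma gint_add:
  assumes "decays F" "decays G" "0 < r"
  shows "gint r (\<lambda>z. F z + G z) = gint r F + gint r G"
proof -
  note arc = decays_integrable_arc[OF _ assms(3)] and ray = decays_ray(1)[OF _ assms(3)]
  note add = Henstock_Kurzweil_Integration.integral_add
  show ?thesis
    unfolding gint_def scaleC_add_right add[OF arc[OF assms(1)] arc[OF assms(2)]]
      add[OF ray[OF assms(1) insertI1] ray[OF assms(2) insertI1]]
      add[OF ray[OF assms(1) insertI2[OF singletonI]] ray[OF assms(2) insertI2[OF singletonI]]]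
    by (simp only: algebra_simps)
qed

lemma gint_diff:
  assumes "decays F" "decays G" "0 < r"
  shows "gint r (\<lambda>z. F z - G z) = gint r F - gint r G"
  using gint_add[OF assms(1) decays_scaleC[OF assms(2), of "-1"] assms(3)] gint_scaleC[OF assms(2,3), of "-1"]
  by (simp add: scaleC.minus_left)

text \<open>The arc has length \<open>2 * \<eta> * r\<close>, and each of the two rays contributes
  at most \<open>Q / \<epsilon>\<close>.\<close>

lemma norm_gint:
  assumes "decays F" "0 < r" "0 < \<epsilon>" "0 \<le> Q"
    and arc: "\<And>s. \<bar>s\<bar> \<le> \<eta> \<Longrightarrow> norm (F (of_real r * cis s)) \<le> Q"
    and ray: "\<And>\<rho> \<sigma>. r \<le> \<rho> \<Longrightarrow> \<sigma> \<in> {\<eta>, -\<eta>} \<Longrightarrow> norm (F (of_real \<rho> * cis \<sigma>)) \<le> Q * exp (- \<epsilon> * \<rho>)"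
  shows "norm (gint r F) \<le> Q * (2 * \<eta> * r + 2 / \<epsilon>)"
proof -
  have 1: "norm (integral {-\<eta>..\<eta>} (\<lambda>s. (\<i> * of_real r * cis s) *\<^sub>C F (of_real r * cis s))) \<le> (r * Q) * (\<eta> - (-\<eta>))"
    by (rule integral_bound)
       (use eta_pos arc assms(2) decaysD_cont[OF assms(1)] in
         \<open>auto intro!: continuous_on_arc_fun simp: norm_scaleC norm_mult\<close>)
  have 2: "norm (integral {r..} (\<lambda>\<rho>. cis \<sigma> *\<^sub>C F (of_real \<rho> * cis \<sigma>))) \<le> Q / \<epsilon>" if "\<sigma> \<in> {\<eta>, -\<eta>}" for \<sigma>
  proof -
    have "norm (integral {r..} (\<lambda>\<rho>. cis \<sigma> *\<^sub>C F (of_real \<rho> * cis \<sigma>))) \<le> Q * exp (- \<epsilon> * r) / \<epsilon>"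
    proof (rule norm_integral_exp_decay[OF _ assms(3)])
      show "continuous_on {r..} (\<lambda>\<rho>. cis \<sigma> *\<^sub>C F (of_real \<rho> * cis \<sigma>))"
        by (rule continuous_on_ray_fun) (use assms(1,2) that decaysD_cont in auto)
    qed (use ray that in \<open>auto simp: norm_scaleC\<close>)
    also have "\<dots> \<le> Q / \<epsilon>"
      using assms(2-4) by (intro divide_right_mono mult_left_le) auto
    finally show ?thesis .
  qed
  have "norm (gint r F) \<le> (r * Q) * (\<eta> - (-\<eta>)) + Q / \<epsilon> + Q / \<epsilon>"
    unfolding gint_def
    by (intro order_trans[OF norm_triangle_ineq4] order_trans[OF norm_triangle_ineq] add_mono 1 2) auto
  then show ?thesis by (simp add: algebra_simps)
qed

lemma trunc_gint_tendsto: "decays F \<Longrightarrow> 0 < r \<Longrightarrow> ((\<lambda>N. trunc_gint r N F) \<longlongrightarrow> gint r F) at_top"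
  unfolding gint_def trunc_gint_def by (intro tendsto_intros decays_ray(2)) auto

text \<open>The lower ray carries a minus sign, so the values of \<open>P\<close> at the two joints
  of arc and rays cancel.\<close>

lemma trunc_gint_primitive:
  assumes P: "cderiv P F" and "0 < r" "r \<le> N"
  shows "trunc_gint r N F = P (of_real N * cis \<eta>) - P (of_real N * cis (-\<eta>))"
proof -
  have 1: "((\<lambda>s. (\<i> * of_real r * cis s) *\<^sub>C F (of_real r * cis s)) has_integral
      (P (of_real r * cis \<eta>) - P (of_real r * cis (-\<eta>)))) {-\<eta>..\<eta>}"
    by (rule fundamental_theorem_of_calculus, use eta_pos in simp, rule cderiv_chain[OF P has_vector_derivative_arc])
       (use assms(2) in \<open>auto intro!: SecI\<close>)
  have 2: "((\<lambda>\<rho>. cis \<sigma> *\<^sub>C F (of_real \<rho> * cis \<sigma>)) has_integral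
      (P (of_real N * cis \<sigma>) - P (of_real r * cis \<sigma>))) {r..N}" if "\<sigma> \<in> {\<eta>, -\<eta>}" for \<sigma>
    by (rule fundamental_theorem_of_calculus, use assms in simp, rule cderiv_chain[OF P has_vector_derivative_ray])
       (use assms(2) that ray_in_Sec in auto)
  show ?thesis
    unfolding trunc_gint_def integral_unique[OF 1] integral_unique[OF 2[OF insertI1]]
      integral_unique[OF 2[OF insertI2[OF singletonI]]] by simp
qed

text \<open>Cauchy's theorem: the derivative of the arc integral with respect to the radius is computed under the
  integral sign and compensates the change of the two ray integrals.\<close>

lemma gint_radius_aux:
  assumes d: "decays F" and F: "cderiv F F'" and F': "continuous_on Sec F'" and r: "0 < r" "r \<le> r'"
  shows "gint r F = gint r' F"
proof -
  define arc where "arc = (\<lambda>\<rho>. integral {-\<eta>..\<eta>} (\<lambda>s. (\<i> * of_real \<rho> * cis s) *\<^sub>C F (of_real \<rho> * cis s)))"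
  define D where "D \<rho> s = (\<i> * cis s) *\<^sub>C F (of_real \<rho> * cis s)
      + (\<i> * of_real \<rho> * cis s * cis s) *\<^sub>C F' (of_real \<rho> * cis s)" for \<rho> s
  define ray where "ray \<sigma> \<rho> = cis \<sigma> *\<^sub>C F (of_real \<rho> * cis \<sigma>)" for \<sigma> \<rho>
  have cF: "continuous_on Sec F" using d decaysD_cont by blast
  have darc: "(arc has_vector_derivative (ray \<eta> \<rho> - ray (-\<eta>) \<rho>)) (at \<rho> within {r..r'})"
    if \<rho>: "\<rho> \<in> {r..r'}" for \<rho>
  proof -
    have "(arc has_vector_derivative integral (cbox (-\<eta>) \<eta>) (D \<rho>)) (at \<rho> within {r..r'})"
      unfolding arc_def box_real(2)[symmetric, of "-\<eta>" \<eta>]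
    proof (rule leibniz_rule_vector_derivative)
      fix x s assume x: "x \<in> {r..r'}" and s: "s \<in> cbox (-\<eta>) \<eta>"
      have 1: "((\<lambda>x. \<i> * of_real x * cis s) has_vector_derivative (\<i> * cis s)) (at x within {r..r'})"
        unfolding has_vector_derivative_def
        by (auto intro!: derivative_eq_intros simp: scaleR_conv_of_real)
      have 2: "((\<lambda>x. F (of_real x * cis s)) has_vector_derivative cis s *\<^sub>C F' (of_real x * cis s)) (at x within {r..r'})"
        by (rule cderiv_chain[OF F has_vector_derivative_ray]) (use x s r in \<open>auto intro!: SecI\<close>)
      show "((\<lambda>x. (\<i> * of_real x * cis s) *\<^sub>C F (of_real x * cis s)) has_vector_derivative D x s) (at x within {r..r'})"
        using scaleC.has_vector_derivative[OF 1 2] by (simp add: D_def scaleC_scaleC add.commute)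
    next
      fix x assume "x \<in> {r..r'}"
      then show "(\<lambda>s. (\<i> * of_real x * cis s) *\<^sub>C F (of_real x * cis s)) integrable_on cbox (-\<eta>) \<eta>"
        using decays_integrable_arc[OF d, of x] r by simp
    next
      have "continuous_on ({r..r'} \<times> {-\<eta>..\<eta>}) (\<lambda>p. G (of_real (fst p) * cis (snd p)))"
        if "continuous_on Sec G" for G :: "complex \<Rightarrow> 'a"
        by (rule continuous_on_compose2[OF that]) (use r in \<open>auto intro!: SecI continuous_intros\<close>)
      then show "continuous_on ({r..r'} \<times> cbox (-\<eta>) \<eta>) (\<lambda>(x, s). D x s)"
        unfolding D_def split_beta using cF F' by (auto intro!: continuous_intros)
    qed (use \<rho> in auto)
    \<comment> \<open>The radial derivative \<open>D \<rho>\<close> of the arc integrand is at the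
      same time the derivative of \<open>cis s *\<^sub>C F (\<rho> * cis s)\<close> in the angle
      \<open>s\<close>; this identity is what makes the contour integral independent of the
      radius.\<close>
    moreover have "(D \<rho> has_integral (ray \<eta> \<rho> - ray (-\<eta>) \<rho>)) {-\<eta>..\<eta>}"
      unfolding ray_def
    proof (rule fundamental_theorem_of_calculus)
      fix s assume s: "s \<in> {-\<eta>..\<eta>}"
      have 1: "(cis has_vector_derivative (\<i> * cis s)) (at s within {-\<eta>..\<eta>})"
        using has_vector_derivative_arc[of 1 s "{-\<eta>..\<eta>}"] by simp
      have 2: "((\<lambda>s. F (of_real \<rho> * cis s)) has_vector_derivative (\<i> * of_real \<rho> * cis s) *\<^sub>C F' (of_real \<rho> * cis s)) (at s within {-\<eta>..\<eta>})"
        by (rule cderiv_chain[OF F has_vector_derivative_arc]) (use s \<rho> r in \<open>auto intro!: SecI\<close>)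
      show "((\<lambda>s. cis s *\<^sub>C F (of_real \<rho> * cis s)) has_vector_derivative D \<rho> s) (at s within {-\<eta>..\<eta>})"
        using scaleC.has_vector_derivative[OF 1 2] by (simp add: D_def scaleC_scaleC mult_ac add.commute)
    qed (use eta_pos in auto)
    ultimately show ?thesis by (simp add: integral_unique)
  qed
  have *: "((\<lambda>\<rho>. ray \<eta> \<rho> - ray (-\<eta>) \<rho>) has_integral (arc r' - arc r)) {r..r'}"
    by (rule fundamental_theorem_of_calculus[OF r(2) darc])
  have ir: "ray \<sigma> integrable_on {r..r'}" if "\<sigma> \<in> {\<eta>, -\<eta>}" for \<sigma>
    unfolding ray_def
    by (intro integrable_continuous_real continuous_on_ray_fun[OF cF]) (use r that in auto)
  have split: "integral {r..} (ray \<sigma>) = integral {r..r'} (ray \<sigma>) + integral {r'..} (ray \<sigma>)" if \<sigma>: "\<sigma> \<in> {\<eta>, -\<eta>}" for \<sigma>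
  proof -
    have i: "ray \<sigma> integrable_on {r'..}"
      unfolding ray_def by (rule decays_ray(1)[OF d _ \<sigma>]) (use r in auto)
    have "(ray \<sigma> has_integral (integral {r..r'} (ray \<sigma>) + integral {r'..} (ray \<sigma>))) ({r..r'} \<union> {r'..})"
      by (rule has_integral_Un) (use ir[OF \<sigma>] i r in \<open>auto simp: has_integral_integral[symmetric] intro: negligible_subset[of "{r'}"]\<close>)
    moreover have "{r..r'} \<union> {r'..} = {r..}" using r by auto
    ultimately show ?thesis by (simp add: integral_unique)
  qed
  have "integral {r..r'} (ray \<eta>) - integral {r..r'} (ray (-\<eta>)) = arc r' - arc r"
    using * ir by (subst Henstock_Kurzweil_Integration.integral_diff[symmetric]) (auto simp: integral_unique)
  moreover have g: "gint \<rho> F = arc \<rho> + integral {\<rho>..} (ray \<eta>) - integral {\<rho>..} (ray (-\<eta>))" for \<rho>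
    unfolding gint_def arc_def ray_def ..
  ultimately show ?thesis
    unfolding g split[OF insertI1] split[OF insertI2[OF singletonI]] by (simp add: algebra_simps)
qed

lemma gint_radius:
  assumes "decays F" "cderiv F F'" "continuous_on Sec F'" "0 < r" "0 < r'"
  shows "gint r F = gint r' F"
  using gint_radius_aux[OF assms(1-3)] assms(4,5) by (metis linear)

section \<open>Integrands with the factor \<open>exp (t * z)\<close>\<close>

lemma norm_exp_ray:
  "\<sigma> \<in> {\<eta>, -\<eta>} \<Longrightarrow> cmod (exp (of_real t * (of_real \<rho> * cis \<sigma>))) = exp (- (rate * t) * \<rho>)"
  by (auto simp: norm_exp_eq_Re rate_def)

lemma decays_exp:
  assumes t: "0 < t" and c: "continuous_on Sec F"
    and b: "\<And>r. 0 < r \<Longrightarrow> \<exists>K. \<forall>z\<in>Sec. r \<le> cmod z \<longrightarrow> norm (F z) \<le> K"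
  shows "decays (\<lambda>z. exp (of_real t * z) *\<^sub>C F z)"
  unfolding decays_def
proof (intro conjI allI impI)
  show "continuous_on Sec (\<lambda>z. exp (of_real t * z) *\<^sub>C F z)"
    by (intro continuous_intros c)
  fix r :: real assume r: "0 < r"
  with b obtain K where K: "\<And>z. z \<in> Sec \<Longrightarrow> r \<le> cmod z \<Longrightarrow> norm (F z) \<le> K" by meson
  show "\<exists>K \<epsilon>. 0 < \<epsilon> \<and> (\<forall>\<rho>\<ge>r. \<forall>\<sigma>\<in>{\<eta>, -\<eta>}.
      norm (exp (of_real t * (of_real \<rho> * cis \<sigma>)) *\<^sub>C F (of_real \<rho> * cis \<sigma>)) \<le> K * exp (- \<epsilon> * \<rho>))"
  proof (rule exI[of _ K], rule exI[of _ "rate * t"], intro conjI allI impI ballI)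
    fix \<rho> \<sigma> assume *: "r \<le> \<rho>" "\<sigma> \<in> {\<eta>, -\<eta>}"
    have "norm (F (of_real \<rho> * cis \<sigma>)) \<le> K"
      by (rule K) (use * r ray_in_Sec in \<open>auto simp: norm_mult\<close>)
    then show "norm (exp (of_real t * (of_real \<rho> * cis \<sigma>)) *\<^sub>C F (of_real \<rho> * cis \<sigma>)) \<le> K * exp (- (rate * t) * \<rho>)"
      unfolding norm_scaleC norm_exp_ray[OF *(2)] by (simp add: mult.commute[of K])
  qed (use t rate_pos in auto)
qed

lemma cderiv_exp:
  assumes "cderiv F F'"
  shows "cderiv (\<lambda>z. exp (of_real t * z) *\<^sub>C F z)
    (\<lambda>z. exp (of_real t * z) *\<^sub>C (of_real t *\<^sub>C F z + F' z))"
  unfolding cderiv_def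
proof
  fix z assume z: "z \<in> Sec"
  have 1: "((\<lambda>z. exp (of_real t * z)) has_derivative (\<lambda>h. of_real t * h * exp (of_real t * z))) (at z within Sec)"
    by (auto intro!: derivative_eq_intros)
  have 2: "(F has_derivative (\<lambda>h. h *\<^sub>C F' z)) (at z within Sec)"
    using assms z by (simp add: cderiv_def)
  show "((\<lambda>z. exp (of_real t * z) *\<^sub>C F z) has_derivative
    (\<lambda>h. h *\<^sub>C exp (of_real t * z) *\<^sub>C (of_real t *\<^sub>C F z + F' z))) (at z within Sec)"
    using scaleC.FDERIV[OF 1 2]
    by (simp add: scaleC_add_right scaleC_scaleC mult_ac add.commute)
qed

text \<open>On the arc of radius \<open>1 / t\<close> the exponential is at most
  \<open>exp 1\<close> in modulus, and the arc length \<open>2 * \<eta> / t\<close> scales like the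
  contribution \<open>2 / (rate * t)\<close> of the rays.\<close>

lemma norm_gint_exp:
  assumes t: "0 < t" and d: "decays (\<lambda>z. exp (of_real t * z) *\<^sub>C F z)" and Q: "0 \<le> Q"
    and b: "\<And>z. z \<in> Sec \<Longrightarrow> 1 / t \<le> cmod z \<Longrightarrow> norm (F z) \<le> Q"
  shows "norm (gint (1 / t) (\<lambda>z. exp (of_real t * z) *\<^sub>C F z)) \<le> exp 1 * (2 * \<eta> + 2 / rate) * Q / t"
proof -
  have "norm (gint (1 / t) (\<lambda>z. exp (of_real t * z) *\<^sub>C F z)) \<le> (exp 1 * Q) * (2 * \<eta> * (1 / t) + 2 / (rate * t))"
  proof (rule norm_gint[OF d])
    fix s assume "\<bar>s\<bar> \<le> \<eta>"
    then have "norm (F (of_real (1/t) * cis s)) \<le> Q"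
      using t by (intro b SecI) (auto simp: norm_mult norm_divide)
    moreover have "cmod (exp (of_real t * (of_real (1/t) * cis s))) \<le> exp 1"
      using t by (simp add: norm_exp_eq_Re)
    ultimately show "norm (exp (of_real t * (of_real (1/t) * cis s)) *\<^sub>C F (of_real (1/t) * cis s)) \<le> exp 1 * Q"
      unfolding norm_scaleC by (intro mult_mono) auto
  next
    fix \<rho> \<sigma> assume *: "1 / t \<le> \<rho>" "\<sigma> \<in> {\<eta>, -\<eta>}"
    then have "0 < \<rho>" using t by (meson divide_pos_pos less_le_trans zero_less_one)
    then have "norm (F (of_real \<rho> * cis \<sigma>)) \<le> 1 * Q"
      using * ray_in_Sec b by (auto simp: norm_mult)
    also have "\<dots> \<le> exp 1 * Q" using Q by (intro mult_right_mono) auto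
    finally show "norm (exp (of_real t * (of_real \<rho> * cis \<sigma>)) *\<^sub>C F (of_real \<rho> * cis \<sigma>)) \<le> exp 1 * Q * exp (- (rate * t) * \<rho>)"
      unfolding norm_scaleC norm_exp_ray[OF *(2)] by (simp add: mult.commute)
  qed (use t Q rate_pos in auto)
  also have "\<dots> = exp 1 * (2 * \<eta> + 2 / rate) * Q / t"
    using t rate_pos by (simp add: field_simps)
  finally show ?thesis .
qed

text \<open>The primitive \<open>exp (t * z) / t\<close> tends to 0 at both far ends of the contour.
  Through this lemma the resolvent-free terms that the resolvent identity produces drop out of the
  Dunford integrals.\<close>

lemma gint_exp_const:
  fixes y :: "'a::complex_banach"
  assumes t: "0 < t" and r: "0 < r"
  shows "gint r (\<lambda>z. exp (of_real t * z) *\<^sub>C y) = 0"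
proof -
  define P where "P z = (exp (of_real t * z) / of_real t) *\<^sub>C y" for z
  have d: "decays (\<lambda>z. exp (of_real t * z) *\<^sub>C y)"
    by (rule decays_exp[OF t]) auto
  have P: "cderiv P (\<lambda>z. exp (of_real t * z) *\<^sub>C y)"
    unfolding cderiv_def
  proof
    fix z assume "z \<in> Sec"
    have "((\<lambda>z. exp (of_real t * z) / of_real t) has_derivative (\<lambda>h. h * exp (of_real t * z))) (at z within Sec)"
      using t by (auto intro!: derivative_eq_intros)
    from bounded_linear.has_derivative[OF scaleC.bounded_linear_left this]
    show "(P has_derivative (\<lambda>h. h *\<^sub>C exp (of_real t * z) *\<^sub>C y)) (at z within Sec)"
      unfolding P_def by (simp add: scaleC_scaleC)
  qed
  have lim: "((\<lambda>N. P (of_real N * cis \<sigma>)) \<longlongrightarrow> 0) at_top" if "\<sigma> \<in> {\<eta>, -\<eta>}" for \<sigma>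
  proof (rule tendsto_norm_zero_cancel)
    have "norm (P (of_real N * cis \<sigma>)) = exp (- (rate * t) * N) / t * norm y" for N
      unfolding P_def norm_scaleC norm_divide norm_exp_ray[OF that] using t by simp
    moreover have "((\<lambda>N. exp (- (rate * t) * N) / t * norm y) \<longlongrightarrow> 0) at_top"
      by (intro tendsto_mult_left_zero tendsto_divide_zero exp_decay_tendsto mult_pos_pos[OF rate_pos t])
    ultimately show "((\<lambda>N. norm (P (of_real N * cis \<sigma>))) \<longlongrightarrow> 0) at_top" by simp
  qed
  have "((\<lambda>N. trunc_gint r N (\<lambda>z. exp (of_real t * z) *\<^sub>C y)) \<longlongrightarrow> 0 - 0) at_top"
  proof (rule Lim_transform_eventually)
    show "((\<lambda>N. P (of_real N * cis \<eta>) - P (of_real N * cis (-\<eta>))) \<longlongrightarrow> 0 - 0) at_top"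
      by (intro tendsto_intros lim) auto
    show "\<forall>\<^sub>F N in at_top. P (of_real N * cis \<eta>) - P (of_real N * cis (-\<eta>)) = trunc_gint r N (\<lambda>z. exp (of_real t * z) *\<^sub>C y)"
      using eventually_ge_at_top[of r] by eventually_elim (use trunc_gint_primitive[OF P r] in simp)
  qed
  with trunc_gint_tendsto[OF d r] show ?thesis
    using tendsto_unique trivial_limit_at_top_linorder by fastforce
qed

end

section \<open>The Dunford integral of \<open>inverse z\<close>\<close>

context sector_contour
begin

lemma Sec_not_nonpos_Real: "z \<in> Sec \<Longrightarrow> z \<notin> \<real>\<^sub>\<le>\<^sub>0"
proof
  assume "z \<in> Sec" and z: "z \<in> \<real>\<^sub>\<le>\<^sub>0"
  then obtain \<rho> s where \<rho>: "0 < \<rho>" "\<bar>s\<bar> \<le> \<eta>" "z = of_real \<rho> * cis s" by (auto elim: SecE)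
  with z have *: "\<rho> * cos s \<le> 0" "sin s = 0" by (auto simp: complex_nonpos_Reals_iff)
  have "s = 0"
    using *(2) \<rho>(2) eta sin_gt_zero[of s] sin_gt_zero[of "-s"] by (cases s "0::real" rule: linorder_cases) auto
  with * \<rho> show False by simp
qed

lemma Ln_polar: "0 < \<rho> \<Longrightarrow> \<bar>s\<bar> \<le> \<eta> \<Longrightarrow> Ln (of_real \<rho> * cis s) = of_real (ln \<rho>) + \<i> * of_real s"
  using Ln_exp[of "of_real (ln \<rho>) + \<i> * of_real s"] eta
  by (simp add: exp_add cis_conv_exp exp_of_real)

lemma cos_le_cos_eta: "s \<in> {\<eta>..2 * pi - \<eta>} \<Longrightarrow> cos s \<le> cos \<eta>"
  using cos_monotone_0_pi_le[of \<eta> s] cos_monotone_0_pi_le[of \<eta> "2 * pi - s"] eta eta_pos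
  by (cases "s \<le> pi") (auto simp: cos_diff)

lemma decays_exp_inverse:
  assumes "0 < t"
  shows "decays (\<lambda>z. exp (of_real t * z) *\<^sub>C inverse z)"
proof (rule decays_exp[OF assms])
  show "continuous_on Sec inverse" using Sec_nonzero by (intro continuous_intros) auto
  fix r :: real assume "0 < r"
  then show "\<exists>K. \<forall>z\<in>Sec. r \<le> cmod z \<longrightarrow> cmod (inverse z) \<le> K"
    by (intro exI[of _ "inverse r"]) (auto simp: norm_inverse intro: le_imp_inverse_le)
qed

text \<open>On the contour the integrand has the primitive \<open>E + Ln\<close> with an entire function \<open>E\<close>. The increment
  of \<open>E\<close> between the ends of the truncated contour is computed along an arc in the left half-plane,
  on which \<open>exp\<close> is small.\<close>

lemma gint_exp_inverse:
  assumes t: "0 < t" and r: "0 < r"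
  shows "gint r (\<lambda>z. exp (of_real t * z) *\<^sub>C inverse z) = 2 * of_real pi * \<i>"
proof -
  \<comment> \<open>The integrand is \<open>f z + inverse z\<close>, where the singularity of
    \<open>f\<close> at 0 is removable; so \<open>f\<close> has a primitive \<open>E\<close> on the
    whole plane, and only \<open>inverse z\<close> needs the logarithm.\<close>
  define f :: "complex \<Rightarrow> complex" where "f z = (if z = 0 then of_real t else (exp (of_real t * z) - 1) / z)" for z
  have "((\<lambda>h. (exp (of_real t * (0 + h)) - exp (of_real t * 0)) / h) \<longlongrightarrow> complex_of_real t) (at 0)"
  proof -
    have "((\<lambda>z. exp (of_real t * z)) has_field_derivative of_real t) (at (0::complex))"
      by (auto intro!: derivative_eq_intros)
    then show ?thesis by (simp add: DERIV_def)
  qed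
  then have "(f \<longlongrightarrow> of_real t) (at 0)"
    by (rule Lim_transform_eventually) (auto simp: eventually_at_filter f_def)
  then have "isCont f 0" by (simp add: isCont_def f_def)
  moreover have dif: "f field_differentiable at z" if "z \<noteq> 0" for z
  proof -
    have "\<exists>f'. ((\<lambda>z. (exp (of_real t * z) - 1) / z) has_field_derivative f') (at z)"
      by (rule exI) (use that in \<open>auto intro!: derivative_eq_intros\<close>)
    then have "(\<lambda>z. (exp (of_real t * z) - 1) / z) field_differentiable (at z)"
      by (simp add: field_differentiable_def)
    then show ?thesis
      by (rule field_differentiable_transform_within[rotated 3, of _ _ UNIV "cmod z"])
         (use that in \<open>auto simp: f_def dist_norm\<close>)
  qed
  ultimately have "continuous_on UNIV f"
    unfolding continuous_on_eq_continuous_within by (metis field_differentiable_imp_continuous_at)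
  then obtain E where E: "\<And>z. (E has_field_derivative f z) (at z)"
    using holomorphic_convex_primitive[of UNIV "{0}" f] dif by auto
  note d = decays_exp_inverse[OF t]
  define P where "P z = E z + Ln z" for z
  have P: "cderiv P (\<lambda>z. exp (of_real t * z) *\<^sub>C inverse z)"
    unfolding cderiv_def
  proof
    fix z assume z: "z \<in> Sec"
    have "(P has_field_derivative (f z + inverse z)) (at z)"
      unfolding P_def using E Sec_not_nonpos_Real[OF z] by (auto intro!: derivative_eq_intros)
    moreover have "f z + inverse z = exp (of_real t * z) *\<^sub>C inverse z"
      using Sec_nonzero[OF z] by (simp add: f_def scaleC_complex_def field_simps)
    ultimately have "(P has_derivative (*) (exp (of_real t * z) *\<^sub>C inverse z)) (at z)"
      by (simp add: has_field_derivative_def)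
    moreover have "(*) (exp (of_real t * z) *\<^sub>C inverse z) = (\<lambda>h. h *\<^sub>C exp (of_real t * z) *\<^sub>C inverse z)"
      by (auto simp: scaleC_complex_def)
    ultimately show "(P has_derivative (\<lambda>h. h *\<^sub>C exp (of_real t * z) *\<^sub>C inverse z)) (at z within Sec)"
      by (metis has_derivative_at_withinI)
  qed
  define J where "J N = integral {\<eta>..2*pi-\<eta>} (\<lambda>s. \<i> * exp (of_real t * (of_real N * cis s)))" for N
  \<comment> \<open>The logarithm contributes the angle \<open>2 * \<eta>\<close> of the sector and
    \<open>E\<close> the complementary angle \<open>2 * pi - 2 * \<eta>\<close>, up to the error
    \<open>J N\<close>; the sum is a full turn.\<close>
  have trunc: "trunc_gint r N (\<lambda>z. exp (of_real t * z) *\<^sub>C inverse z) = 2 * of_real pi * \<i> - J N" if N: "r \<le> N" for N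
  proof -
    have N0: "0 < N" using N r by simp
    have "((\<lambda>s. \<i> * exp (of_real t * (of_real N * cis s)) - \<i>) has_integral
       (E (of_real N * cis (2*pi-\<eta>)) - E (of_real N * cis \<eta>))) {\<eta>..2*pi-\<eta>}"
    proof (rule fundamental_theorem_of_calculus)
      fix s assume "s \<in> {\<eta>..2*pi-\<eta>}"
      have "((\<lambda>s. E (of_real N * cis s)) has_vector_derivative (\<i> * of_real N * cis s) * f (of_real N * cis s)) (at s)"
        using field_vector_diff_chain_at[OF has_vector_derivative_arc E] by (simp add: o_def)
      moreover have "(\<i> * of_real N * cis s) * f (of_real N * cis s) = \<i> * exp (of_real t * (of_real N * cis s)) - \<i>"
        using N0 by (simp add: f_def field_simps)
      ultimately show "((\<lambda>s. E (of_real N * cis s)) has_vector_derivative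
          \<i> * exp (of_real t * (of_real N * cis s)) - \<i>) (at s within {\<eta>..2*pi-\<eta>})"
        by (metis has_vector_derivative_at_within)
    qed (use eta in auto)
    moreover have "((\<lambda>s. \<i> * exp (of_real t * (of_real N * cis s)) - \<i>) has_integral
       (J N - of_real (2 * pi - 2 * \<eta>) * \<i>)) {\<eta>..2*pi-\<eta>}"
    proof (rule has_integral_diff)
      show "((\<lambda>s. \<i> * exp (of_real t * (of_real N * cis s))) has_integral J N) {\<eta>..2*pi-\<eta>}"
        unfolding J_def by (intro integrable_integral integrable_continuous_real continuous_intros)
      show "((\<lambda>s. \<i>) has_integral of_real (2 * pi - 2 * \<eta>) * \<i>) {\<eta>..2*pi-\<eta>}"
        using has_integral_const_real[of "\<i>" \<eta> "2*pi-\<eta>"] eta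
        by (simp add: scaleR_conv_of_real)
    qed
    ultimately have "E (of_real N * cis (2*pi-\<eta>)) - E (of_real N * cis \<eta>) = J N - of_real (2 * pi - 2 * \<eta>) * \<i>"
      by (rule has_integral_unique)
    moreover have "cis (2*pi-\<eta>) = cis (-\<eta>)" by (simp add: complex_eq_iff cos_diff sin_diff)
    ultimately have 1: "E (of_real N * cis \<eta>) - E (of_real N * cis (-\<eta>)) = of_real (2 * pi - 2 * \<eta>) * \<i> - J N"
      by (metis minus_diff_eq)
    have 2: "Ln (of_real N * cis \<eta>) - Ln (of_real N * cis (-\<eta>)) = 2 * \<i> * of_real \<eta>"
      using Ln_polar[OF N0, of \<eta>] Ln_polar[OF N0, of "-\<eta>"] eta_pos by simp
    have 3: "P (of_real N * cis \<eta>) - P (of_real N * cis (-\<eta>)) =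
       (E (of_real N * cis \<eta>) - E (of_real N * cis (-\<eta>))) + (Ln (of_real N * cis \<eta>) - Ln (of_real N * cis (-\<eta>)))"
      by (simp add: P_def)
    show ?thesis
      unfolding trunc_gint_primitive[OF P r N] 3 1 2 by (simp add: algebra_simps)
  qed
  have J: "cmod (J N) \<le> exp (- (rate * t) * N) * (2 * pi - 2 * \<eta>)" if N: "0 \<le> N" for N
  proof -
    have "cmod (J N) \<le> exp (- (rate * t) * N) * ((2 * pi - \<eta>) - \<eta>)"
      unfolding J_def
    proof (rule integral_bound)
      fix s assume s: "s \<in> {\<eta>..2 * pi - \<eta>}"
      have "t * (N * cos s) \<le> t * (N * cos \<eta>)"
        using cos_le_cos_eta[OF s] t N by (intro mult_left_mono) auto
      then show "cmod (\<i> * exp (of_real t * (of_real N * cis s))) \<le> exp (- (rate * t) * N)"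
        by (simp add: norm_mult norm_exp_eq_Re rate_def mult_ac)
    qed (use eta in \<open>auto intro!: continuous_intros\<close>)
    then show ?thesis by simp
  qed
  have "((\<lambda>N. J N) \<longlongrightarrow> 0) at_top"
  proof (rule Lim_null_comparison)
    show "\<forall>\<^sub>F N in at_top. cmod (J N) \<le> exp (- (rate * t) * N) * (2 * pi - 2 * \<eta>)"
      using eventually_ge_at_top[of 0] by eventually_elim (use J in auto)
    show "((\<lambda>N. exp (- (rate * t) * N) * (2 * pi - 2 * \<eta>)) \<longlongrightarrow> 0) at_top"
      by (intro tendsto_mult_left_zero exp_decay_tendsto mult_pos_pos[OF rate_pos t])
  qed
  then have "((\<lambda>N. 2 * of_real pi * \<i> - J N) \<longlongrightarrow> 2 * of_real pi * \<i> - 0) at_top"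
    by (intro tendsto_intros)
  then have "((\<lambda>N. trunc_gint r N (\<lambda>z. exp (of_real t * z) *\<^sub>C inverse z)) \<longlongrightarrow> 2 * of_real pi * \<i> - 0) at_top"
    by (rule Lim_transform_eventually)
       (use eventually_ge_at_top[of r] in \<open>eventually_elim, use trunc in simp\<close>)
  with trunc_gint_tendsto[OF d r] show ?thesis
    using tendsto_unique trivial_limit_at_top_linorder by fastforce
qed

lemma gint_cong:
  assumes "\<And>z. z \<in> Sec \<Longrightarrow> F z = G z" "0 < r"
  shows "gint r F = gint r G"
proof -
  have 1: "integral {-\<eta>..\<eta>} (\<lambda>s. (\<i> * of_real r * cis s) *\<^sub>C F (of_real r * cis s)) =
        integral {-\<eta>..\<eta>} (\<lambda>s. (\<i> * of_real r * cis s) *\<^sub>C G (of_real r * cis s))"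
    by (rule Henstock_Kurzweil_Integration.integral_cong) (use assms SecI in auto)
  have 2: "integral {r..} (\<lambda>\<rho>. cis \<sigma> *\<^sub>C F (of_real \<rho> * cis \<sigma>)) =
        integral {r..} (\<lambda>\<rho>. cis \<sigma> *\<^sub>C G (of_real \<rho> * cis \<sigma>))" if "\<sigma> \<in> {\<eta>, -\<eta>}" for \<sigma>
    by (rule Henstock_Kurzweil_Integration.integral_cong) (use assms ray_in_Sec that in auto)
  show ?thesis unfolding gint_def 1 2[OF insertI1] 2[OF insertI2[OF singletonI]] ..
qed

end

section \<open>The semigroup generated by a sectorial resolvent\<close>

text \<open>\<open>R z\<close> stands for the resolvent at \<open>\<omega> + z\<close>. The
  generator does not appear; what follows is derived from these properties of its resolvent.\<close>

locale sectorial_resolvent = sector_contour +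
  fixes R :: "complex \<Rightarrow> 'a::complex_banach \<Rightarrow> 'a" and M :: real
  assumes bounded_linear_R: "z \<in> Sec \<Longrightarrow> bounded_linear (R z)"
    and R_scaleC: "z \<in> Sec \<Longrightarrow> R z (a *\<^sub>C x) = a *\<^sub>C R z x"
    and M_pos: "0 < M"
    and norm_R: "z \<in> Sec \<Longrightarrow> norm (R z x) \<le> M / cmod z * norm x"
    and resolvent_identity: "z \<in> Sec \<Longrightarrow> w \<in> Sec \<Longrightarrow> R z x - R w x = (w - z) *\<^sub>C R z (R w x)"
begin

lemmas R_linear = bounded_linear_R[THEN bounded_linear.linear]
lemmas R_add = linear_add[OF R_linear]
lemmas R_diff = linear_diff[OF R_linear]

text \<open>Two applications of the resolvent identity leave the remainder
  \<open>R z (R w (R w x))\<close> with the factor \<open>w - z\<close> squared, and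
  \<open>R z\<close> is bounded near \<open>w\<close> because the modulus of \<open>z\<close> is at
  least half of that of \<open>w\<close>.\<close>

lemma cderiv_R: "cderiv (\<lambda>z. R z x) (\<lambda>z. - R z (R z x))"
  unfolding cderiv_def
proof
  fix w assume w: "w \<in> Sec"
  define K where "K = 2 * M / cmod w * norm (R w (R w x))"
  have w0: "0 < cmod w" using Sec_nonzero[OF w] by simp
  have est: "norm (R z x - R w x - (z - w) *\<^sub>C - R w (R w x)) / norm (z - w) \<le> norm (z - w) * K"
    if z: "z \<in> Sec" "z \<noteq> w" "norm (z - w) < cmod w / 2" for z
  proof -
    have zw: "cmod w / 2 \<le> cmod z"
      using z(3) norm_triangle_sub[of w z] by (simp add: norm_minus_commute)
    have "R z x - R w x - (z - w) *\<^sub>C - R w (R w x) = (w - z) *\<^sub>C (R z (R w x) - R w (R w x))"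
      unfolding resolvent_identity[OF z(1) w, of x]
      by (simp add: scaleC.diff_right scaleC.diff_left scaleC.minus_right)
    also have "\<dots> = (w - z) *\<^sub>C (w - z) *\<^sub>C R z (R w (R w x))"
      by (simp add: resolvent_identity[OF z(1) w])
    finally have "norm (R z x - R w x - (z - w) *\<^sub>C - R w (R w x)) =
        norm (z - w) * (norm (z - w) * norm (R z (R w (R w x))))"
      by (simp add: norm_scaleC norm_minus_commute)
    moreover have "norm (R z (R w (R w x))) \<le> K"
    proof -
      have "norm (R z (R w (R w x))) \<le> M / cmod z * norm (R w (R w x))" by (rule norm_R[OF z(1)])
      also have "\<dots> \<le> M / (cmod w / 2) * norm (R w (R w x))"
        using zw w0 M_pos Sec_nonzero[OF z(1)] by (intro mult_right_mono divide_left_mono) (auto intro: mult_pos_pos)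
      finally show ?thesis by (simp add: K_def mult_ac)
    qed
    ultimately show ?thesis using z(2) by (simp add: mult_left_mono)
  qed
  show "((\<lambda>z. R z x) has_derivative (\<lambda>h. h *\<^sub>C - R w (R w x))) (at w within Sec)"
    unfolding has_derivative_iff_norm
  proof
    show "bounded_linear (\<lambda>h. h *\<^sub>C - R w (R w x))" by (rule scaleC.bounded_linear_left)
    show "((\<lambda>z. norm (R z x - R w x - (z - w) *\<^sub>C - R w (R w x)) / norm (z - w)) \<longlongrightarrow> 0) (at w within Sec)"
    proof (rule Lim_null_comparison)
      show "\<forall>\<^sub>F z in at w within Sec. norm (norm (R z x - R w x - (z - w) *\<^sub>C - R w (R w x)) / norm (z - w)) \<le> norm (z - w) * K"
        unfolding eventually_at
        by (rule exI[of _ "cmod w / 2"]) (use w0 est in \<open>auto simp: dist_norm\<close>)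
      have "((\<lambda>z. norm (z - w) * K) \<longlongrightarrow> norm (w - w) * K) (at w within Sec)"
        by (intro tendsto_intros)
      then show "((\<lambda>z. norm (z - w) * K) \<longlongrightarrow> 0) (at w within Sec)" by simp
    qed
  qed
qed

lemma continuous_on_R: "continuous_on Sec (\<lambda>z. R z x)"
  by (rule cderiv_continuous[OF cderiv_R])

text \<open>The argument of the outer \<open>R z\<close> moves with \<open>z\<close>; the bound on
  \<open>R z\<close> near \<open>w\<close> controls this. The result provides the continuous
  derivative that \<open>gint_radius\<close> asks for.\<close>

lemma continuous_on_RR: "continuous_on Sec (\<lambda>z. R z (R z x))"
  unfolding continuous_on_def
proof
  fix w assume w: "w \<in> Sec"
  have Sec: "\<forall>\<^sub>F z in at w within Sec. z \<in> Sec" by (auto simp: eventually_at_filter)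
  have tR: "((\<lambda>z. R z y) \<longlongrightarrow> R w y) (at w within Sec)" for y
    using continuous_on_R w by (auto simp: continuous_on_def)
  have "((\<lambda>z. R z (R z x - R w x)) \<longlongrightarrow> 0) (at w within Sec)"
  proof (rule Lim_null_comparison)
    show "\<forall>\<^sub>F z in at w within Sec. norm (R z (R z x - R w x)) \<le> M / cmod z * norm (R z x - R w x)"
      using Sec by eventually_elim (rule norm_R)
    have "((\<lambda>z. M / cmod z * norm (R z x - R w x)) \<longlongrightarrow> M / cmod w * norm (R w x - R w x)) (at w within Sec)"
      using Sec_nonzero[OF w] by (intro tendsto_intros tR) auto
    then show "((\<lambda>z. M / cmod z * norm (R z x - R w x)) \<longlongrightarrow> 0) (at w within Sec)" by simp
  qed
  then have "((\<lambda>z. R z (R w x) + R z (R z x - R w x)) \<longlongrightarrow> R w (R w x) + 0) (at w within Sec)"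
    by (intro tendsto_intros tR)
  then have "((\<lambda>z. R z (R z x)) \<longlongrightarrow> R w (R w x) + 0) (at w within Sec)"
    by (rule Lim_transform_eventually) (use Sec in \<open>eventually_elim, simp add: R_diff\<close>)
  then show "((\<lambda>z. R z (R z x)) \<longlongrightarrow> R w (R w x)) (at w within Sec)" by simp
qed

lemma bounded_R:
  assumes "0 < r"
  shows "\<exists>K. \<forall>z\<in>Sec. r \<le> cmod z \<longrightarrow> norm (R z x) \<le> K"
proof (intro exI ballI impI)
  fix z assume z: "z \<in> Sec" "r \<le> cmod z"
  have "norm (R z x) \<le> M / cmod z * norm x" by (rule norm_R[OF z(1)])
  also have "\<dots> \<le> M / r * norm x"
    using z assms M_pos Sec_nonzero[OF z(1)] by (intro mult_right_mono divide_left_mono) auto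
  finally show "norm (R z x) \<le> M / r * norm x" .
qed

lemma norm_zR:
  assumes "z \<in> Sec"
  shows "norm (z *\<^sub>C R z x) \<le> M * norm x"
  using mult_left_mono[OF norm_R[OF assms, of x], of "cmod z"] Sec_nonzero[OF assms]
  by (simp add: norm_scaleC)

lemma decays_R: "0 < t \<Longrightarrow> decays (\<lambda>z. exp (of_real t * z) *\<^sub>C R z x)"
  by (intro decays_exp continuous_on_R bounded_R)

lemma decays_zR: "0 < t \<Longrightarrow> decays (\<lambda>z. exp (of_real t * z) *\<^sub>C z *\<^sub>C R z x)"
  by (intro decays_exp continuous_intros continuous_on_R exI[of _ "M * norm x"]) (auto intro: norm_zR)

lemma decays_const: "0 < t \<Longrightarrow> decays (\<lambda>z. exp (of_real t * z) *\<^sub>C (x::'a))"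
  by (rule decays_exp) auto

lemma decays_inverse_R: "0 < t \<Longrightarrow> decays (\<lambda>z. exp (of_real t * z) *\<^sub>C inverse z *\<^sub>C R z x)"
proof (rule decays_exp)
  show "continuous_on Sec (\<lambda>z. inverse z *\<^sub>C R z x)"
    using Sec_nonzero by (intro continuous_intros continuous_on_R) auto
  fix r :: real assume r: "0 < r"
  then obtain K where K: "\<And>z. z\<in>Sec \<Longrightarrow> r \<le> cmod z \<Longrightarrow> norm (R z x) \<le> K" using bounded_R by meson
  show "\<exists>K. \<forall>z\<in>Sec. r \<le> cmod z \<longrightarrow> norm (inverse z *\<^sub>C R z x) \<le> K"
  proof (intro exI ballI impI)
    fix z assume z: "z \<in> Sec" "r \<le> cmod z"
    then show "norm (inverse z *\<^sub>C R z x) \<le> inverse r * K"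
      using r K[OF z] unfolding norm_scaleC norm_inverse by (intro mult_mono le_imp_inverse_le) auto
  qed
qed

section \<open>The shifted semigroup and its derivative\<close>

definition c0 :: complex where "c0 = 1 / (2 * of_real pi * \<i>)"

text \<open>The semigroup of the operator shifted to \<omega> = 0, that is, the semigroup of
  \<open>A\<close> divided by \<open>exp (\<omega> * t)\<close>.\<close>

definition G :: "real \<Rightarrow> 'a \<Rightarrow> 'a" where
  "G t x = c0 *\<^sub>C gint 1 (\<lambda>z. exp (of_real t * z) *\<^sub>C R z x)"

text \<open>The shifted generator maps \<open>R z x\<close> to \<open>z *\<^sub>C R z x - x\<close>,
  and the constant \<open>x\<close> integrates to 0; so \<open>H t\<close> represents the generator
  applied to \<open>G t\<close>.\<close>

definition H :: "real \<Rightarrow> 'a \<Rightarrow> 'a" where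
  "H t x = c0 *\<^sub>C gint 1 (\<lambda>z. exp (of_real t * z) *\<^sub>C z *\<^sub>C R z x)"

definition CG :: real where "CG = exp 1 * (2 * \<eta> + 2 / rate) * M"

lemma CG_pos: "0 < CG"
  unfolding CG_def using eta_pos rate_pos M_pos by (intro mult_pos_pos add_pos_pos) auto

lemma norm_c0: "cmod c0 \<le> 1"
  using pi_ge_two by (simp add: c0_def norm_divide norm_mult)

lemma gint_R_radius:
  assumes "0 < t" "0 < r"
  shows "gint r (\<lambda>z. exp (of_real t * z) *\<^sub>C R z x) = gint 1 (\<lambda>z. exp (of_real t * z) *\<^sub>C R z x)"
  by (rule gint_radius[OF decays_R cderiv_exp[OF cderiv_R]])
     (use assms in \<open>auto intro!: continuous_intros continuous_on_R continuous_on_RR\<close>)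

lemma cderiv_zR: "cderiv (\<lambda>z. z *\<^sub>C R z x) (\<lambda>z. R z x - z *\<^sub>C R z (R z x))"
  unfolding cderiv_def
proof
  fix w assume w: "w \<in> Sec"
  have 1: "((\<lambda>z. R z x) has_derivative (\<lambda>h. h *\<^sub>C - R w (R w x))) (at w within Sec)"
    using cderiv_R w by (simp add: cderiv_def)
  show "((\<lambda>z. z *\<^sub>C R z x) has_derivative (\<lambda>h. h *\<^sub>C (R w x - w *\<^sub>C R w (R w x)))) (at w within Sec)"
    using scaleC.FDERIV[OF has_derivative_ident 1]
    by (simp add: scaleC.diff_right scaleC.minus_right scaleC_scaleC mult.commute)
qed

lemma gint_zR_radius:
  assumes "0 < t" "0 < r"
  shows "gint r (\<lambda>z. exp (of_real t * z) *\<^sub>C z *\<^sub>C R z x) = gint 1 (\<lambda>z. exp (of_real t * z) *\<^sub>C z *\<^sub>C R z x)"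
  by (rule gint_radius[OF decays_zR cderiv_exp[OF cderiv_zR]])
     (use assms in \<open>auto intro!: continuous_intros continuous_on_R continuous_on_RR\<close>)

lemma norm_G:
  assumes t: "0 < t"
  shows "norm (G t x) \<le> CG * norm x"
proof -
  have "norm (gint (1/t) (\<lambda>z. exp (of_real t * z) *\<^sub>C R z x)) \<le> exp 1 * (2 * \<eta> + 2 / rate) * (M * t * norm x) / t"
  proof (rule norm_gint_exp[OF t decays_R[OF t]])
    fix z assume z: "z \<in> Sec" "1 / t \<le> cmod z"
    have "norm (R z x) \<le> M / cmod z * norm x" by (rule norm_R[OF z(1)])
    also have "\<dots> \<le> M / (1/t) * norm x"
      using z t M_pos by (intro mult_right_mono divide_left_mono) (auto simp: Sec_nonzero)
    finally show "norm (R z x) \<le> M * t * norm x" by simp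
  qed (use M_pos t in auto)
  then have "norm (gint 1 (\<lambda>z. exp (of_real t * z) *\<^sub>C R z x)) \<le> CG * norm x"
    unfolding gint_R_radius[OF t divide_pos_pos[OF zero_less_one t]] using t by (simp add: CG_def)
  then have "cmod c0 * norm (gint 1 (\<lambda>z. exp (of_real t * z) *\<^sub>C R z x)) \<le> 1 * (CG * norm x)"
    using norm_c0 by (intro mult_mono) auto
  then show ?thesis by (simp add: G_def norm_scaleC)
qed

lemma norm_H:
  assumes t: "0 < t"
  shows "norm (H t x) \<le> CG / t * norm x"
proof -
  have "norm (gint (1/t) (\<lambda>z. exp (of_real t * z) *\<^sub>C z *\<^sub>C R z x)) \<le> exp 1 * (2 * \<eta> + 2 / rate) * (M * norm x) / t"
    by (rule norm_gint_exp[OF t decays_zR[OF t]]) (use M_pos t norm_zR in auto)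
  then have "norm (gint 1 (\<lambda>z. exp (of_real t * z) *\<^sub>C z *\<^sub>C R z x)) \<le> CG / t * norm x"
    unfolding gint_zR_radius[OF t divide_pos_pos[OF zero_less_one t]] by (simp add: CG_def)
  then have "cmod c0 * norm (gint 1 (\<lambda>z. exp (of_real t * z) *\<^sub>C z *\<^sub>C R z x)) \<le> 1 * (CG / t * norm x)"
    using norm_c0 by (intro mult_mono) auto
  then show ?thesis by (simp add: H_def norm_scaleC)
qed

lemma G_add: assumes t: "0 < t" shows "G t (x + y) = G t x + G t y"
proof -
  have "gint 1 (\<lambda>z. exp (of_real t * z) *\<^sub>C R z (x + y)) =
        gint 1 (\<lambda>z. exp (of_real t * z) *\<^sub>C R z x + exp (of_real t * z) *\<^sub>C R z y)"
    by (rule gint_cong) (auto simp: R_add scaleC_add_right)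
  then show ?thesis by (simp add: G_def gint_add decays_R t scaleC_add_right)
qed

lemma G_scaleC: assumes t: "0 < t" shows "G t (a *\<^sub>C x) = a *\<^sub>C G t x"
proof -
  have "gint 1 (\<lambda>z. exp (of_real t * z) *\<^sub>C R z (a *\<^sub>C x)) =
        gint 1 (\<lambda>z. a *\<^sub>C exp (of_real t * z) *\<^sub>C R z x)"
    by (rule gint_cong) (auto simp: R_scaleC scaleC_scaleC mult.commute)
  also have "\<dots> = a *\<^sub>C gint 1 (\<lambda>z. exp (of_real t * z) *\<^sub>C R z x)"
    by (rule gint_scaleC[OF decays_R[OF t]]) simp
  finally show ?thesis unfolding G_def by (simp only: scaleC_left_commute)
qed

lemma H_add: assumes t: "0 < t" shows "H t (x + y) = H t x + H t y"
proof -
  have "gint 1 (\<lambda>z. exp (of_real t * z) *\<^sub>C z *\<^sub>C R z (x + y)) =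
        gint 1 (\<lambda>z. exp (of_real t * z) *\<^sub>C z *\<^sub>C R z x + exp (of_real t * z) *\<^sub>C z *\<^sub>C R z y)"
    by (rule gint_cong) (auto simp: R_add scaleC_add_right)
  then show ?thesis by (simp add: H_def gint_add decays_zR t scaleC_add_right)
qed

lemma H_scaleC: assumes t: "0 < t" shows "H t (a *\<^sub>C x) = a *\<^sub>C H t x"
proof -
  have "gint 1 (\<lambda>z. exp (of_real t * z) *\<^sub>C z *\<^sub>C R z (a *\<^sub>C x)) =
        gint 1 (\<lambda>z. a *\<^sub>C exp (of_real t * z) *\<^sub>C z *\<^sub>C R z x)"
    by (rule gint_cong) (auto simp: R_scaleC scaleC_scaleC mult_ac)
  also have "\<dots> = a *\<^sub>C gint 1 (\<lambda>z. exp (of_real t * z) *\<^sub>C z *\<^sub>C R z x)"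
    by (rule gint_scaleC[OF decays_zR[OF t]]) simp
  finally show ?thesis unfolding H_def by (simp only: scaleC_left_commute)
qed

lemma bounded_linear_G: "0 < t \<Longrightarrow> bounded_linear (G t)"
  by (rule bounded_linear_intro[where K=CG])
     (use norm_G in \<open>auto simp: G_add G_scaleC mult.commute simp flip: scaleC_of_real\<close>)

lemma bounded_linear_H: "0 < t \<Longrightarrow> bounded_linear (H t)"
  by (rule bounded_linear_intro[where K="CG/t"])
     (use norm_H in \<open>auto simp: H_add H_scaleC mult.commute simp flip: scaleC_of_real\<close>)

lemma R_G:
  assumes t: "0 < t" and w: "w \<in> Sec"
  shows "R w (G t x) = c0 *\<^sub>C gint 1 (\<lambda>z. exp (of_real t * z) *\<^sub>C R w (R z x))"
  unfolding G_def R_scaleC[OF w]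
  by (subst gint_linear[OF decays_R[OF t] bounded_linear_R[OF w] R_scaleC[OF w], symmetric])
     (simp_all add: R_scaleC[OF w])

text \<open>This expresses through the resolvent that \<open>H t\<close> is the generator applied to
  \<open>G t\<close>. The resolvent identity turns \<open>z *\<^sub>C R w (R z x)\<close> into
  \<open>w *\<^sub>C R w (R z x) + R w x - R z x\<close>, whose middle term is constant in
  \<open>z\<close> and integrates to 0.\<close>

lemma R_H:
  assumes t: "0 < t" and w: "w \<in> Sec"
  shows "R w (H t x) = w *\<^sub>C R w (G t x) - G t x"
proof -
  let ?e = "\<lambda>z. exp (of_real t * z)"
  have dRR: "decays (\<lambda>z. ?e z *\<^sub>C R w (R z x))"
    using decays_linear[OF decays_R[OF t] bounded_linear_R[OF w], of x] by (simp add: R_scaleC[OF w])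
  have "R w (H t x) = c0 *\<^sub>C gint 1 (\<lambda>z. ?e z *\<^sub>C R w (z *\<^sub>C R z x))"
    unfolding H_def R_scaleC[OF w]
    by (subst gint_linear[OF decays_zR[OF t] bounded_linear_R[OF w] R_scaleC[OF w], symmetric])
       (simp_all add: R_scaleC[OF w])
  also have "gint 1 (\<lambda>z. ?e z *\<^sub>C R w (z *\<^sub>C R z x)) =
      gint 1 (\<lambda>z. w *\<^sub>C ?e z *\<^sub>C R w (R z x) + (?e z *\<^sub>C R w x - ?e z *\<^sub>C R z x))"
  proof (rule gint_cong)
    fix z assume z: "z \<in> Sec"
    have "R w (z *\<^sub>C R z x) = w *\<^sub>C R w (R z x) + (R w x - R z x)"
      by (simp add: R_scaleC[OF w] resolvent_identity[OF w z] scaleC.diff_left)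
    then show "?e z *\<^sub>C R w (z *\<^sub>C R z x) =
      w *\<^sub>C ?e z *\<^sub>C R w (R z x) + (?e z *\<^sub>C R w x - ?e z *\<^sub>C R z x)"
      by (simp only: scaleC_add_right scaleC.diff_right scaleC_scaleC mult.commute)
  qed simp
  also have "\<dots> = w *\<^sub>C gint 1 (\<lambda>z. ?e z *\<^sub>C R w (R z x)) + (0 - gint 1 (\<lambda>z. ?e z *\<^sub>C R z x))"
    by (simp add: gint_add gint_diff gint_scaleC decays_diff decays_scaleC dRR decays_R decays_const gint_exp_const t)
  also have "c0 *\<^sub>C \<dots> = w *\<^sub>C R w (G t x) - G t x"
    unfolding R_G[OF t w] by (simp add: G_def scaleC.diff_right scaleC_left_commute)
  finally show ?thesis .
qed

text \<open>By \<open>R_H\<close>, each \<open>R z (H s x)\<close> under the integral becomes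
  \<open>z *\<^sub>C R z (G s x)\<close> up to a constant that integrates to 0.\<close>

lemma G_H:
  assumes t: "0 < t" and s: "0 < s"
  shows "G t (H s x) = H t (G s x)"
proof -
  let ?e = "\<lambda>z. exp (of_real t * z)"
  have "gint 1 (\<lambda>z. ?e z *\<^sub>C R z (H s x)) = gint 1 (\<lambda>z. ?e z *\<^sub>C z *\<^sub>C R z (G s x) - ?e z *\<^sub>C G s x)"
    by (rule gint_cong) (auto simp: R_H[OF s] scaleC.diff_right)
  also have "\<dots> = gint 1 (\<lambda>z. ?e z *\<^sub>C z *\<^sub>C R z (G s x))"
    by (simp add: gint_diff decays_zR decays_const t gint_exp_const)
  finally show ?thesis by (simp add: G_def[of t] H_def[of t])
qed

lemma one_in_Sec: "1 \<in> Sec"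
  using SecI[of 1 0] eta_pos by simp

text \<open>This places \<open>G t x\<close> in the domain of the generator, and among the vectors
  for which \<open>G_initial\<close> gives continuity at 0.\<close>

lemma G_range: "0 < t \<Longrightarrow> G t x = R 1 (G t x - H t x)"
  using R_H[OF _ one_in_Sec, of t x] by (simp add: R_diff[OF one_in_Sec])


end

lemma norm_exp_second_order: "cmod (exp z - 1 - z) \<le> exp (cmod z) * (cmod z)\<^sup>2"
  using Taylor_exp_field[of z 1] by (simp add: power2_eq_square algebra_simps)

section \<open>Differentiability and the semigroup law\<close>

context sectorial_resolvent
begin

lemma rate_le_1: "rate \<le> 1"
  by (simp add: rate_def)

text \<open>The remainder is quadratic in \<open>h\<close>, uniformly for \<open>x\<close> in the
  unit ball, which makes \<open>G\<close> differentiable in the operator norm with derivative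
  \<open>H\<close>. The restriction on \<open>h\<close> keeps the growth of
  \<open>exp (h * z)\<close> below the decay of \<open>exp (t * z)\<close> on the rays.\<close>

lemma G_difference:
  assumes t: "0 < t" and h: "\<bar>h\<bar> \<le> rate * t / 4"
  shows "norm (G (t + h) x - G t x - h *\<^sub>R H t x)
    \<le> M * (exp (2 * t) + 4 / (rate * t)) * (2 * \<eta> + 4 / (rate * t)) * norm x * h\<^sup>2"
proof -
  have ht: "\<bar>h\<bar> \<le> t / 4"
    using h mult_right_mono[OF rate_le_1, of t] t by linarith
  then have th: "0 < t + h" using t by (simp add: abs_le_iff)
  have rt: "0 < rate * t" using rate_pos t by simp
  define F where "F z = exp (of_real t * z) *\<^sub>C (exp (of_real h * z) - 1 - of_real h * z) *\<^sub>C R z x" for z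
  have F_eq: "F = (\<lambda>z. exp (of_real (t + h) * z) *\<^sub>C R z x - exp (of_real t * z) *\<^sub>C R z x
      - of_real h *\<^sub>C exp (of_real t * z) *\<^sub>C z *\<^sub>C R z x)"
  proof
    fix z :: complex
    have e: "exp (of_real (t + h) * z) = exp (of_real t * z) * exp (of_real h * z)"
      by (simp add: distrib_right exp_add)
    have eq: "exp (of_real t * z) * (exp (of_real h * z) - 1 - of_real h * z) =
        exp (of_real (t + h) * z) - exp (of_real t * z) - of_real h * (exp (of_real t * z) * z)"
      unfolding e by (simp add: algebra_simps)
    show "F z = exp (of_real (t + h) * z) *\<^sub>C R z x - exp (of_real t * z) *\<^sub>C R z x
      - of_real h *\<^sub>C exp (of_real t * z) *\<^sub>C z *\<^sub>C R z x"
      by (simp only: F_def scaleC_scaleC eq) (simp only: scaleC.diff_left)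
  qed
  have dF: "decays F"
    unfolding F_eq by (intro decays_diff decays_scaleC decays_R decays_zR t th)
  have "gint 1 F = gint 1 (\<lambda>z. exp (of_real (t + h) * z) *\<^sub>C R z x) - gint 1 (\<lambda>z. exp (of_real t * z) *\<^sub>C R z x)
      - of_real h *\<^sub>C gint 1 (\<lambda>z. exp (of_real t * z) *\<^sub>C z *\<^sub>C R z x)"
    unfolding F_eq
    by (simp only: gint_diff gint_scaleC decays_diff decays_scaleC decays_R decays_zR t th zero_less_one)
  then have "G (t + h) x - G t x - h *\<^sub>R H t x = c0 *\<^sub>C gint 1 F"
    by (simp add: G_def H_def scaleC.diff_right scaleC_left_commute flip: scaleC_of_real)
  then have *: "norm (G (t + h) x - G t x - h *\<^sub>R H t x) \<le> norm (gint 1 F)"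
    using norm_c0 by (simp add: norm_scaleC mult_left_le_one_le)
  \<comment> \<open>A common majorant: \<open>exp (2 * t)\<close> serves the arc,
    \<open>4 / (rate * t)\<close> the rays.\<close>
  define Q where "Q = h\<^sup>2 * (M * norm x) * (exp (2 * t) + 4 / (rate * t))"
  have nF: "norm (F z) \<le> cmod (exp (of_real t * z)) * (exp (\<bar>h\<bar> * cmod z) * (h\<^sup>2 * cmod z)) * (M * norm x)"
    if z: "z \<in> Sec" for z
  proof -
    have z0: "0 < cmod z" using Sec_nonzero[OF z] by simp
    have "cmod (exp (of_real h * z) - 1 - of_real h * z) \<le> exp (\<bar>h\<bar> * cmod z) * (\<bar>h\<bar> * cmod z)\<^sup>2"
      using norm_exp_second_order[of "of_real h * z"] by (simp add: norm_mult)
    then have "norm (F z) \<le> cmod (exp (of_real t * z)) * ((exp (\<bar>h\<bar> * cmod z) * (\<bar>h\<bar> * cmod z)\<^sup>2) * (M / cmod z * norm x))"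
      unfolding F_def norm_scaleC using M_pos z0
      by (intro mult_left_mono mult_mono norm_R z) auto
    also have "\<dots> = cmod (exp (of_real t * z)) * (exp (\<bar>h\<bar> * cmod z) * (h\<^sup>2 * cmod z)) * (M * norm x)"
      using z0 by (simp add: power_mult_distrib power2_eq_square field_simps)
    finally show ?thesis .
  qed
  have "norm (gint 1 F) \<le> Q * (2 * \<eta> * 1 + 2 / (rate * t / 2))"
  proof (rule norm_gint[OF dF])
    show "0 \<le> Q" using M_pos rt by (simp add: Q_def)
    fix s :: real assume s: "\<bar>s\<bar> \<le> \<eta>"
    have "norm (F (of_real 1 * cis s)) \<le> (exp (t * cos s) * exp \<bar>h\<bar>) * (h\<^sup>2 * (M * norm x))"
      using nF[OF SecI[OF zero_less_one s]] by (simp add: norm_exp_eq_Re mult_ac)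
    also have "exp (t * cos s) * exp \<bar>h\<bar> \<le> exp t * exp t"
      using ht t by (intro mult_mono) (auto simp: mult_left_le)
    also have "exp t * exp t \<le> exp (2 * t) + 4 / (rate * t)"
      using rt t by (simp add: mult_exp_exp)
    finally show "norm (F (of_real 1 * cis s)) \<le> Q"
      using M_pos by (simp add: Q_def mult_right_mono mult_ac)
  next
    fix \<rho> \<sigma> :: real assume \<rho>: "1 \<le> \<rho>" and \<sigma>: "\<sigma> \<in> {\<eta>, - \<eta>}"
    \<comment> \<open>A quarter of the available decay exponent: one quarter absorbs the growth
      caused by \<open>h\<close>, another the factor \<rho>, and half of the decay remains.\<close>
    define e where "e = rate * t * \<rho> / 4"
    have e: "0 < e" using rt \<rho> by (simp add: e_def)
    have "\<bar>h\<bar> * \<rho> \<le> rate * t / 4 * \<rho>" by (rule mult_right_mono) (use h \<rho> in auto)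
    then have he: "exp (\<bar>h\<bar> * \<rho>) \<le> exp e" by (simp add: e_def)
    have "e \<le> exp e" using exp_ge_add_one_self[of e] by linarith
    then have re: "\<rho> \<le> 4 / (rate * t) * exp e" using rt by (simp add: e_def field_simps)
    have "norm (F (of_real \<rho> * cis \<sigma>)) \<le> exp (- (rate * t) * \<rho>) * (exp (\<bar>h\<bar> * \<rho>) * (h\<^sup>2 * \<rho>)) * (M * norm x)"
      using nF[OF ray_in_Sec[OF _ \<sigma>], of \<rho>] \<rho> unfolding norm_exp_ray[OF \<sigma>] by (simp add: norm_mult)
    also have "\<dots> \<le> exp (- (rate * t) * \<rho>) * (exp e * (h\<^sup>2 * (4 / (rate * t) * exp e))) * (M * norm x)"
      using he re M_pos \<rho> by (intro mult_right_mono mult_left_mono mult_mono) auto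
    also have "\<dots> = h\<^sup>2 * (M * norm x) * (4 / (rate * t)) * (exp (- (rate * t) * \<rho>) * exp e * exp e)"
      by (simp only: mult_ac)
    also have "exp (- (rate * t) * \<rho>) * exp e * exp e = exp (- (rate * t / 2) * \<rho>)"
      by (simp add: e_def mult_exp_exp field_simps)
    also have "h\<^sup>2 * (M * norm x) * (4 / (rate * t)) * exp (- (rate * t / 2) * \<rho>) \<le> Q * exp (- (rate * t / 2) * \<rho>)"
      unfolding Q_def using M_pos by (intro mult_right_mono mult_left_mono) auto
    finally show "norm (F (of_real \<rho> * cis \<sigma>)) \<le> Q * exp (- (rate * t / 2) * \<rho>)" .
  qed (use rt in auto)
  also have "\<dots> = M * (exp (2 * t) + 4 / (rate * t)) * (2 * \<eta> + 4 / (rate * t)) * norm x * h\<^sup>2"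
    by (simp add: Q_def)
  finally show ?thesis using * by linarith
qed

text \<open>As bounded operators, so that derivatives are taken in the operator norm and the product
  rule covers a composition of two time-dependent factors.\<close>

definition Gb :: "real \<Rightarrow> 'a \<Rightarrow>\<^sub>L 'a" where "Gb t = Blinfun (G t)"
definition Hb :: "real \<Rightarrow> 'a \<Rightarrow>\<^sub>L 'a" where "Hb t = Blinfun (H t)"

lemma Gb_apply: "0 < t \<Longrightarrow> blinfun_apply (Gb t) x = G t x"
  by (simp add: Gb_def bounded_linear_Blinfun_apply bounded_linear_G)

lemma Hb_apply: "0 < t \<Longrightarrow> blinfun_apply (Hb t) x = H t x"
  by (simp add: Hb_def bounded_linear_Blinfun_apply bounded_linear_H)

lemma Gb_deriv:
  assumes t: "0 < t"
  shows "(Gb has_vector_derivative Hb t) (at t)"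
  unfolding has_vector_derivative_def has_derivative_iff_norm
proof
  show "bounded_linear (\<lambda>x. x *\<^sub>R Hb t)" by (rule bounded_linear_scaleR_left)
  define K where "K = M * (exp (2 * t) + 4 / (rate * t)) * (2 * \<eta> + 4 / (rate * t))"
  have rt: "0 < rate * t" using rate_pos t by simp
  have K: "0 \<le> K" unfolding K_def using M_pos rt eta_pos by (intro mult_nonneg_nonneg add_nonneg_nonneg) auto
  have est: "norm (Gb s - Gb t - (s - t) *\<^sub>R Hb t) \<le> K * (s - t)\<^sup>2" if s: "\<bar>s - t\<bar> \<le> rate * t / 4" for s
  proof (rule norm_blinfun_bound)
    have "rate * t \<le> t" using mult_right_mono[OF rate_le_1, of t] t by simp
    then have s0: "0 < s" using s t by linarith
    fix x
    show "norm (blinfun_apply (Gb s - Gb t - (s - t) *\<^sub>R Hb t) x) \<le> K * (s - t)\<^sup>2 * norm x"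
      using G_difference[OF t s, of x]
      by (simp add: K_def blinfun.diff_left blinfun.scaleR_left Gb_apply Hb_apply s0 t mult_ac)
  qed (use K in auto)
  show "((\<lambda>s. norm (Gb s - Gb t - (s - t) *\<^sub>R Hb t) / norm (s - t)) \<longlongrightarrow> 0) (at t)"
  proof (rule Lim_null_comparison)
    show "\<forall>\<^sub>F s in at t. norm (norm (Gb s - Gb t - (s - t) *\<^sub>R Hb t) / norm (s - t)) \<le> K * \<bar>s - t\<bar>"
      unfolding eventually_at
    proof (rule exI[of _ "rate * t / 4"], intro conjI ballI impI)
      show "0 < rate * t / 4" using rt by simp
      fix s assume s: "s \<noteq> t \<and> dist s t < rate * t / 4"
      then have "norm (Gb s - Gb t - (s - t) *\<^sub>R Hb t) \<le> K * \<bar>s - t\<bar> * \<bar>s - t\<bar>"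
        using est[of s] by (simp add: dist_real_def power2_eq_square mult_ac)
      then show "norm (norm (Gb s - Gb t - (s - t) *\<^sub>R Hb t) / norm (s - t)) \<le> K * \<bar>s - t\<bar>"
        using s by (simp add: divide_le_eq)
    qed
    have "((\<lambda>s. K * \<bar>s - t\<bar>) \<longlongrightarrow> K * \<bar>t - t\<bar>) (at t)" by (intro tendsto_intros)
    then show "((\<lambda>s. K * \<bar>s - t\<bar>) \<longlongrightarrow> 0) (at t)" by simp
  qed
qed

text \<open>For \<open>y = R w v\<close> the vector \<open>v' = w *\<^sub>C y - v\<close> is the
  shifted generator applied to \<open>y\<close>, and \<open>R z y\<close> equals
  \<open>inverse z *\<^sub>C (y + R z v')\<close>. The first term reproduces \<open>y\<close> by
  \<open>gint_exp_inverse\<close>; the second decays like the inverse square of the modulus of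
  \<open>z\<close>, which on the contour of radius \<open>1 / t\<close> yields the order
  \<open>t\<close>.\<close>

lemma G_initial:
  assumes w: "w \<in> Sec" and t: "0 < t"
  shows "norm (G t (R w v) - R w v) \<le> CG * t * norm (w *\<^sub>C R w v - v)"
proof -
  let ?e = "\<lambda>z. exp (of_real t * z)"
  define y where "y = R w v"
  define v' where "v' = w *\<^sub>C y - v"
  have t': "0 < 1 / t" using t by simp
  have zR: "z *\<^sub>C R z y = y + R z v'" if z: "z \<in> Sec" for z
  proof -
    have "R z v - y = (w - z) *\<^sub>C R z y" using resolvent_identity[OF z w, of v] by (simp add: y_def)
    then show ?thesis by (simp add: v'_def R_diff[OF z] R_scaleC[OF z] scaleC.diff_left algebra_simps)
  qed
  have Rz: "R z y = inverse z *\<^sub>C y + inverse z *\<^sub>C R z v'" if z: "z \<in> Sec" for z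
  proof -
    have "R z y = inverse z *\<^sub>C z *\<^sub>C R z y" using Sec_nonzero[OF z] by (simp add: scaleC_scaleC)
    then show ?thesis unfolding zR[OF z] by (simp add: scaleC_add_right)
  qed
  have bl: "bounded_linear (\<lambda>c. c *\<^sub>C y)" by (rule scaleC.bounded_linear_left)
  note d1 = decays_exp_inverse[OF t]
  have "gint 1 (\<lambda>z. ?e z *\<^sub>C R z y) = gint (1/t) (\<lambda>z. ?e z *\<^sub>C R z y)"
    by (rule gint_R_radius[OF t t', symmetric])
  also have "\<dots> = gint (1/t) (\<lambda>z. (?e z *\<^sub>C inverse z) *\<^sub>C y + ?e z *\<^sub>C inverse z *\<^sub>C R z v')"
    by (rule gint_cong[OF _ t']) (simp add: Rz scaleC_add_right scaleC_scaleC scaleC_complex_def)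
  also have "\<dots> = gint (1/t) (\<lambda>z. (?e z *\<^sub>C inverse z) *\<^sub>C y) + gint (1/t) (\<lambda>z. ?e z *\<^sub>C inverse z *\<^sub>C R z v')"
    by (rule gint_add[OF decays_linear[OF d1 bl] decays_inverse_R[OF t] t'])
  also have "gint (1/t) (\<lambda>z. (?e z *\<^sub>C inverse z) *\<^sub>C y) = (2 * of_real pi * \<i>) *\<^sub>C y"
    using gint_linear[OF d1 bl _ t'] gint_exp_inverse[OF t t'] by (simp add: scaleC_complex_def scaleC_scaleC)
  finally have "G t y - y = c0 *\<^sub>C gint (1/t) (\<lambda>z. ?e z *\<^sub>C inverse z *\<^sub>C R z v')"
    by (simp add: G_def scaleC_add_right scaleC_scaleC c0_def)
  then have "norm (G t y - y) \<le> norm (gint (1/t) (\<lambda>z. ?e z *\<^sub>C inverse z *\<^sub>C R z v'))"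
    using norm_c0 by (simp add: norm_scaleC mult_left_le_one_le)
  also have "\<dots> \<le> exp 1 * (2 * \<eta> + 2 / rate) * (t * (M * t * norm v')) / t"
  proof (rule norm_gint_exp[OF t decays_inverse_R[OF t]])
    show "0 \<le> t * (M * t * norm v')" using t M_pos by simp
    fix z assume z: "z \<in> Sec" "1 / t \<le> cmod z"
    have z0: "0 < cmod z" using Sec_nonzero[OF z(1)] by simp
    then have "inverse (cmod z) \<le> t" using z(2) t by (simp add: field_simps)
    moreover have "norm (R z v') \<le> M * t * norm v'"
    proof -
      have "norm (R z v') \<le> M / cmod z * norm v'" by (rule norm_R[OF z(1)])
      also have "\<dots> \<le> M / (1/t) * norm v'"
        using z z0 t M_pos by (intro mult_right_mono divide_left_mono) auto
      finally show ?thesis by simp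
    qed
    ultimately show "norm (inverse z *\<^sub>C R z v') \<le> t * (M * t * norm v')"
      unfolding norm_scaleC norm_inverse using t by (intro mult_mono) auto
  qed
  also have "\<dots> = CG * t * norm v'" using t by (simp add: CG_def mult_ac)
  finally show ?thesis by (simp add: y_def v'_def)
qed

text \<open>By \<open>G_H\<close> the function \<open>\<sigma> \<mapsto> G (t + s - \<sigma>) (G \<sigma> x)\<close> is constant. Since \<open>G (t + s) x\<close> lies in the range of the
  resolvent, on which \<open>G\<close> is continuous at \<open>0\<close>, its limit at \<open>t + s\<close> is \<open>G (t + s) x\<close>.\<close>

lemma G_G:
  assumes t: "0 < t" and s: "0 < s"
  shows "G t (G s x) = G (t + s) x"
proof -
  define T where "T = t + s"
  have T: "0 < T" using t s by (simp add: T_def)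
  define \<phi> where "\<phi> \<sigma> = blinfun_apply (Gb (T - \<sigma>)) (blinfun_apply (Gb \<sigma>) x)" for \<sigma>
  have d: "(\<phi> has_vector_derivative 0) (at \<sigma>)" if \<sigma>: "\<sigma> \<in> {0<..<T}" for \<sigma>
  proof -
    have "((\<lambda>\<sigma>. T - \<sigma>) has_vector_derivative -1) (at \<sigma>)"
      by (auto intro!: derivative_eq_intros)
    from vector_diff_chain_at[OF this Gb_deriv, of] \<sigma>
    have 1: "((\<lambda>\<sigma>. Gb (T - \<sigma>)) has_vector_derivative - Hb (T - \<sigma>)) (at \<sigma>)"
      by (simp add: o_def)
    have "((\<lambda>\<sigma>. blinfun_apply (Gb \<sigma>) x) has_vector_derivative blinfun_apply (Hb \<sigma>) x) (at \<sigma>)"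
      using bounded_linear.has_vector_derivative[OF blinfun.bounded_linear_left Gb_deriv, of \<sigma>] \<sigma> by simp
    from blinfun.has_vector_derivative[OF 1 this]
    show ?thesis
      using \<sigma> by (simp add: \<phi>_def[abs_def] blinfun.minus_left Gb_apply Hb_apply G_H)
  qed
  have "\<exists>c. \<forall>\<sigma>\<in>{0<..<T}. \<phi> \<sigma> = c"
    by (rule has_derivative_zero_constant)
       (use d in \<open>auto simp: has_vector_derivative_def intro: has_derivative_at_withinI\<close>)
  then obtain c where c: "\<And>\<sigma>. \<sigma> \<in> {0<..<T} \<Longrightarrow> \<phi> \<sigma> = c" by blast
  obtain v where v: "G T x = R 1 v" using G_range[OF T] by blast
  define K where "K = CG * norm (1 *\<^sub>C R 1 v - v)"
  have ev: "\<forall>\<^sub>F \<epsilon> in at_right 0. \<epsilon> \<in> {0<..<T}"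
    using T by (auto simp: eventually_at_right intro: exI[of _ T])
  have lim: "((\<lambda>\<epsilon>. G (T - \<epsilon>) x) \<longlongrightarrow> G T x) (at_right 0)"
  proof -
    have "isCont Gb T" using Gb_deriv[OF T] has_vector_derivative_continuous by blast
    moreover have "((\<lambda>\<epsilon>. T - \<epsilon>) \<longlongrightarrow> T) (at_right 0)" by (auto intro!: tendsto_eq_intros)
    ultimately have "((\<lambda>\<epsilon>. Gb (T - \<epsilon>)) \<longlongrightarrow> Gb T) (at_right 0)" by (rule isCont_tendsto_compose)
    then have "((\<lambda>\<epsilon>. blinfun_apply (Gb (T - \<epsilon>)) x) \<longlongrightarrow> blinfun_apply (Gb T) x) (at_right 0)"
      by (intro tendsto_intros)
    then have "((\<lambda>\<epsilon>. blinfun_apply (Gb (T - \<epsilon>)) x) \<longlongrightarrow> G T x) (at_right 0)" by (simp add: Gb_apply T)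
    then show ?thesis
      by (rule Lim_transform_eventually) (use ev in \<open>eventually_elim, simp add: Gb_apply\<close>)
  qed
  have "norm (G T x - c) \<le> 0"
  proof (rule tendsto_lowerbound)
    show "\<forall>\<^sub>F \<epsilon> in at_right 0. norm (G T x - c) \<le> CG * norm (G (T - \<epsilon>) x - G T x) + K * \<epsilon>"
      using ev
    proof eventually_elim
      case (elim \<epsilon>)
      then have \<epsilon>: "0 < \<epsilon>" "T - \<epsilon> \<in> {0<..<T}" by auto
      \<comment> \<open>This is the value of \<phi> at \<open>T - \<epsilon>\<close>. The inner
        vector is compared with the fixed vector \<open>G T x = R 1 v\<close>, for which
        \<open>G_initial\<close> is available.\<close>
      have "c = G \<epsilon> (G (T - \<epsilon>) x)"
        using c[OF \<epsilon>(2)] \<epsilon> by (simp add: \<phi>_def Gb_apply)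
      also have "\<dots> = G \<epsilon> (G (T - \<epsilon>) x - G T x) + G \<epsilon> (G T x)"
        using G_add[OF \<epsilon>(1), of "G (T - \<epsilon>) x - G T x" "G T x"] by simp
      finally have "c - G T x = G \<epsilon> (G (T - \<epsilon>) x - G T x) + (G \<epsilon> (G T x) - G T x)" by simp
      then have "norm (c - G T x) \<le> norm (G \<epsilon> (G (T - \<epsilon>) x - G T x)) + norm (G \<epsilon> (G T x) - G T x)"
        by (metis norm_triangle_ineq)
      also have "\<dots> \<le> CG * norm (G (T - \<epsilon>) x - G T x) + K * \<epsilon>"
        using add_mono[OF norm_G[OF \<epsilon>(1), of "G (T - \<epsilon>) x - G T x"] G_initial[OF one_in_Sec \<epsilon>(1), of v]]
        by (simp add: v K_def mult_ac)
      finally show ?case by (simp add: norm_minus_commute)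
    qed
    have "((\<lambda>\<epsilon>. CG * norm (G (T - \<epsilon>) x - G T x) + K * \<epsilon>) \<longlongrightarrow> CG * norm (G T x - G T x) + K * 0) (at_right 0)"
      by (intro tendsto_intros lim)
    then show "((\<lambda>\<epsilon>. CG * norm (G (T - \<epsilon>) x - G T x) + K * \<epsilon>) \<longlongrightarrow> 0) (at_right 0)" by simp
  qed simp
  then have "G T x = c" by simp
  moreover have "\<phi> s = G t (G s x)" using t s by (simp add: \<phi>_def Gb_apply T_def)
  ultimately show ?thesis using c[of s] t s by (simp add: T_def)
qed

end

section \<open>Sectorial operators generate analytic semigroups\<close>

context
  fixes D :: "'a::complex_banach set" and A :: "'a \<Rightarrow> 'a" and \<mu> :: complex
  assumes mu: "\<mu> \<in> resolvent_set D A"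
begin

lemma resolvent_bij: "bij_betw (\<lambda>x. \<mu> *\<^sub>C x - A x) D UNIV"
  using mu by (simp add: resolvent_set_def)

lemma resolvent_in: "resolvent D A \<mu> y \<in> D"
  using bij_betwE[OF bij_betw_the_inv_into[OF resolvent_bij]] by (simp add: resolvent_def)

lemma resolvent_right: "\<mu> *\<^sub>C resolvent D A \<mu> y - A (resolvent D A \<mu> y) = y"
  using f_the_inv_into_f_bij_betw[OF resolvent_bij, of y] by (simp add: resolvent_def)

lemma resolvent_left: "x \<in> D \<Longrightarrow> resolvent D A \<mu> (\<mu> *\<^sub>C x - A x) = x"
  using the_inv_into_f_f[OF bij_betw_imp_inj_on[OF resolvent_bij], of x] by (simp add: resolvent_def)

lemma resolvent_bounded_linear: "bounded_linear (resolvent D A \<mu>)"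
  using mu by (simp add: resolvent_set_def)

lemma resolvent_scaleC:
  assumes "linear_operator D A"
  shows "resolvent D A \<mu> (a *\<^sub>C y) = a *\<^sub>C resolvent D A \<mu> y"
proof -
  define x where "x = resolvent D A \<mu> y"
  have x: "x \<in> D" "\<mu> *\<^sub>C x - A x = y" by (simp_all add: x_def resolvent_in resolvent_right)
  have "a *\<^sub>C x \<in> D" "A (a *\<^sub>C x) = a *\<^sub>C A x"
    using assms x(1) by (auto simp: linear_operator_def csubspace_def)
  moreover from this have "\<mu> *\<^sub>C (a *\<^sub>C x) - A (a *\<^sub>C x) = a *\<^sub>C y"
    by (simp add: scaleC_left_commute[of \<mu>] flip: x(2) scaleC.diff_right)
  ultimately show ?thesis using resolvent_left[of "a *\<^sub>C x"] by (simp add: x_def)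
qed

end

lemma resolvent_eq:
  assumes mu: "\<mu> \<in> resolvent_set D A" and nu: "\<nu> \<in> resolvent_set D A" and A: "linear_operator D A"
  shows "resolvent D A \<mu> x - resolvent D A \<nu> x = (\<nu> - \<mu>) *\<^sub>C resolvent D A \<mu> (resolvent D A \<nu> x)"
proof -
  interpret bounded_linear "resolvent D A \<mu>" by (rule resolvent_bounded_linear[OF mu])
  define y where "y = resolvent D A \<nu> x"
  have "\<mu> *\<^sub>C y - A y = x + (\<mu> - \<nu>) *\<^sub>C y"
    using resolvent_right[OF nu, of x] by (simp add: y_def scaleC.diff_left algebra_simps)
  then have "y = resolvent D A \<mu> (x + (\<mu> - \<nu>) *\<^sub>C y)"
    using resolvent_left[OF mu resolvent_in[OF nu, of x]] by (simp add: y_def)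
  also have "\<dots> = resolvent D A \<mu> x + (\<mu> - \<nu>) *\<^sub>C resolvent D A \<mu> y"
    by (simp add: add resolvent_scaleC[OF mu A])
  finally show ?thesis
    unfolding y_def[symmetric] by (simp add: scaleC.diff_left algebra_simps)
qed

text \<open>\<open>S\<close> may be discontinuous at 0, so continuity is demanded for positive
  times. The bounds refer to a finite horizon \<open>T\<close> because the semigroup may grow
  exponentially.\<close>

locale analytic_semigroup =
  fixes D :: "'a::complex_banach set" and A :: "'a \<Rightarrow> 'a"
    and S AS :: "real \<Rightarrow> 'a \<Rightarrow>\<^sub>L 'a" and T C :: real
  assumes S_apply: "0 \<le> t \<Longrightarrow> blinfun_apply (S t) x = semigroup_of D A t x"
    and AS_apply: "0 < t \<Longrightarrow> blinfun_apply (AS t) x = A (semigroup_of D A t x)"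
    and S_S: "0 \<le> s \<Longrightarrow> 0 \<le> t \<Longrightarrow> blinfun_apply (S s) (blinfun_apply (S t) x) = blinfun_apply (S (s + t)) x"
    and AS_scaleC: "0 < t \<Longrightarrow> blinfun_apply (AS t) (a *\<^sub>C x) = a *\<^sub>C blinfun_apply (AS t) x"
    and norm_S: "0 \<le> t \<Longrightarrow> t \<le> T \<Longrightarrow> norm (S t) \<le> C"
    and norm_AS: "0 < t \<Longrightarrow> t \<le> T \<Longrightarrow> norm (AS t) \<le> C / t"
    and continuous_S: "continuous_on {0<..} S"
    and C_pos: "0 < C"

text \<open>The argument uses the contour picked by the choice operator in
  \<open>semigroup_of\<close>: its \<omega> is the shift, its angle defines the sector, and its
  radius is changed to 1 by \<open>gint_R_radius\<close>.\<close>

lemma sectorial_imp_analytic_semigroup: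
  assumes "sectorial D A"
  shows "\<exists>S AS C. analytic_semigroup D A S AS T C"
proof -
  have "\<exists>\<gamma>. dunford_contour D A \<gamma>"
  proof -
    obtain \<omega> \<theta> M where s: "sectorial_with \<omega> \<theta> M D A" using assms unfolding sectorial_def by blast
    then have "pi/2 < \<theta>" by (simp add: sectorial_with_def)
    then obtain \<eta> where "pi/2 < \<eta>" "\<eta> < \<theta>" using dense by blast
    then have "dunford_contour D A (\<omega>, 1, \<eta>)" using s by (auto simp: dunford_contour_def)
    then show ?thesis ..
  qed
  then have "dunford_contour D A (SOME \<gamma>. dunford_contour D A \<gamma>)" by (rule someI_ex)
  moreover obtain \<omega> r \<eta> where \<gamma>: "(SOME \<gamma>. dunford_contour D A \<gamma>) = (\<omega>, r, \<eta>)"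
    using prod_cases3 by blast
  ultimately obtain \<theta> M where r: "0 < r" and sec: "sectorial_with \<omega> \<theta> M D A" and \<eta>: "pi / 2 < \<eta>" "\<eta> < \<theta>"
    by (auto simp: dunford_contour_def)
  have \<theta>: "\<theta> < pi" and M: "0 < M" and A: "linear_operator D A" using sec by (auto simp: sectorial_with_def)
  have sc: "sector_contour \<eta>" by unfold_locales (use \<eta> \<theta> in auto)
  interpret sector_contour \<eta> by (rule sc)
  define R where "R z = resolvent D A (of_real \<omega> + z)" for z
  have mem: "of_real \<omega> + z \<in> resolvent_set D A \<and> onorm (resolvent D A (of_real \<omega> + z)) \<le> M / cmod z" if z: "z \<in> Sec" for z
  proof -
    obtain \<rho> s where \<rho>: "0 < \<rho>" "\<bar>s\<bar> \<le> \<eta>" "z = of_real \<rho> * cis s" using z by (auto elim: SecE)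
    have "s \<in> {- pi<..pi}" using \<rho>(2) \<eta> \<theta> by (auto simp: abs_le_iff)
    then have "Arg z = s" using \<rho> by (simp add: Arg_times_of_real Arg_cis)
    then have "\<bar>Arg z\<bar> < \<theta>" using \<rho>(2) \<eta> by linarith
    then show ?thesis
      using sec Sec_nonzero[OF z] unfolding sectorial_with_def by (metis add_diff_cancel_left' add_cancel_left_right)
  qed
  note mem1 = mem[THEN conjunct1]
  interpret sectorial_resolvent \<eta> R M
  proof (rule sectorial_resolvent.intro[OF sc], rule sectorial_resolvent_axioms.intro)
    fix z w a :: complex and x :: 'a assume z: "z \<in> Sec"
    show "bounded_linear (R z)" unfolding R_def by (rule resolvent_bounded_linear[OF mem1[OF z]])
    show "R z (a *\<^sub>C x) = a *\<^sub>C R z x" unfolding R_def by (rule resolvent_scaleC[OF mem1[OF z] A])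
    show "norm (R z x) \<le> M / cmod z * norm x"
      using onorm[OF resolvent_bounded_linear[OF mem1[OF z]], of x] mem[OF z]
      unfolding R_def by (meson mult_right_mono norm_ge_zero order_trans)
    assume w: "w \<in> Sec"
    show "R z x - R w x = (w - z) *\<^sub>C R z (R w x)"
      unfolding R_def using resolvent_eq[OF mem1[OF z] mem1[OF w] A, of x] by simp
  qed (rule M)
  define S where "S t = (if t = 0 then id_blinfun else exp (\<omega> * t) *\<^sub>R Gb t)" for t
  define AS where "AS t = exp (\<omega> * t) *\<^sub>R (Hb t + \<omega> *\<^sub>R Gb t)" for t
  have G_D: "G t x \<in> D" "A (G t x) = \<omega> *\<^sub>R G t x + H t x" if t: "0 < t" for t x
  proof -
    have G: "G t x = resolvent D A (of_real \<omega> + 1) (G t x - H t x)"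
      using G_range[OF t, of x] by (simp add: R_def)
    show "G t x \<in> D" by (subst G) (rule resolvent_in[OF mem1[OF one_in_Sec]])
    have "(of_real \<omega> + 1) *\<^sub>C G t x - A (G t x) = G t x - H t x"
      using resolvent_right[OF mem1[OF one_in_Sec], of "G t x - H t x"] unfolding G[symmetric] .
    then show "A (G t x) = \<omega> *\<^sub>R G t x + H t x" by (simp add: scaleC_add_left scaleC_of_real algebra_simps)
  qed
  have S_apply: "blinfun_apply (S t) x = semigroup_of D A t x" if "0 \<le> t" for t x
  proof (cases "t = 0")
    case False
    then have t: "0 < t" using that by simp
    have "semigroup_of D A t x = c0 *\<^sub>C gint r (\<lambda>z. exp (of_real t * (of_real \<omega> + z)) *\<^sub>C R z x)"
      using False by (simp add: semigroup_of_def \<gamma> dunford_integral_def dunford_integrand_def gint_def c0_def R_def)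
    also have "gint r (\<lambda>z. exp (of_real t * (of_real \<omega> + z)) *\<^sub>C R z x) =
        gint r (\<lambda>z. of_real (exp (\<omega> * t)) *\<^sub>C exp (of_real t * z) *\<^sub>C R z x)"
      by (rule gint_cong[OF _ r]) (simp add: distrib_left exp_add scaleC_scaleC mult.commute flip: exp_of_real)
    also have "\<dots> = of_real (exp (\<omega> * t)) *\<^sub>C gint 1 (\<lambda>z. exp (of_real t * z) *\<^sub>C R z x)"
      unfolding gint_scaleC[OF decays_R[OF t] r] gint_R_radius[OF t r] ..
    finally have "semigroup_of D A t x = exp (\<omega> * t) *\<^sub>R G t x"
      by (simp only: G_def scaleC_left_commute[of c0]) (simp add: scaleC_of_real)
    then show ?thesis using False t by (simp add: S_def Gb_apply blinfun.scaleR_left)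
  qed (simp add: S_def semigroup_of_def)
  have S_pos: "blinfun_apply (S t) x = exp (\<omega> * t) *\<^sub>R G t x" if "0 < t" for t x
    using that by (simp add: S_def Gb_apply blinfun.scaleR_left)
  have S_zero: "blinfun_apply (S 0) x = x" for x by (simp add: S_def)
  \<comment> \<open>The \<open>1\<close> covers the identity at time 0, the exponential undoes the
    shift, and the last factor comes from
    \<open>A (G t x) = \<omega> *\<^sub>R G t x + H t x\<close>, where \<open>H\<close> is bounded
    by \<open>CG / t\<close> and \<open>G\<close> by \<open>CG\<close>.\<close>
  define K where "K = max 1 (exp (\<bar>\<omega>\<bar> * T) * (CG * (1 + \<bar>\<omega>\<bar> * T)))"
  have e: "exp (\<omega> * t) \<le> exp (\<bar>\<omega>\<bar> * T)" if "0 \<le> t" "t \<le> T" for t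
    using that mult_mono[of \<omega> "\<bar>\<omega>\<bar>" t T] by simp
  have "analytic_semigroup D A S AS T K"
  proof
    show "blinfun_apply (S t) x = semigroup_of D A t x" if "0 \<le> t" for t x by (rule S_apply[OF that])
    show "blinfun_apply (AS t) x = A (semigroup_of D A t x)" if t: "0 < t" for t x
    proof -
      have "semigroup_of D A t x = of_real (exp (\<omega> * t)) *\<^sub>C G t x"
        using S_apply[of t x] S_pos[OF t] t by (simp add: scaleC_of_real)
      moreover have "A (of_real (exp (\<omega> * t)) *\<^sub>C G t x) = of_real (exp (\<omega> * t)) *\<^sub>C A (G t x)"
        using A G_D(1)[OF t, of x] unfolding linear_operator_def by blast
      ultimately show ?thesis
        unfolding AS_def
        by (simp add: scaleC_of_real G_D(2)[OF t] blinfun.scaleR_left blinfun.add_left Gb_apply Hb_apply t add.commute)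
    qed
    show "blinfun_apply (S s) (blinfun_apply (S t) x) = blinfun_apply (S (s + t)) x" if "0 \<le> s" "0 \<le> t" for s t x
    proof (cases "s = 0 \<or> t = 0")
      case False
      then have st: "0 < s" "0 < t" "0 < s + t" using that by auto
      show ?thesis
        unfolding S_pos[OF st(1)] S_pos[OF st(2)] S_pos[OF st(3)]
        by (simp add: linear_cmul[OF bounded_linear.linear[OF bounded_linear_G[OF st(1)]]] G_G st distrib_left exp_add mult.commute)
    qed (auto simp: S_zero)
    show "blinfun_apply (AS t) (a *\<^sub>C x) = a *\<^sub>C blinfun_apply (AS t) x" if "0 < t" for t a x
      unfolding AS_def
      by (simp add: blinfun.scaleR_left blinfun.add_left Gb_apply Hb_apply that G_scaleC H_scaleC
          scaleC.scaleR_right scaleC_add_right)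
    show "norm (S t) \<le> K" if t: "0 \<le> t" "t \<le> T" for t
    proof (cases "t = 0")
      case True
      have "norm (id_blinfun :: 'a \<Rightarrow>\<^sub>L 'a) \<le> 1" by (rule norm_blinfun_bound) auto
      then show ?thesis using True by (simp add: S_def K_def)
    next
      case False
      then have t0: "0 < t" using t by simp
      have "norm (Gb t) \<le> CG"
        by (rule norm_blinfun_bound) (use CG_pos norm_G[OF t0] in \<open>auto simp: Gb_apply t0\<close>)
      then have "norm (S t) \<le> exp (\<bar>\<omega>\<bar> * T) * (CG * 1)"
        using e[OF t] False by (simp add: S_def mult_mono)
      also have "\<dots> \<le> exp (\<bar>\<omega>\<bar> * T) * (CG * (1 + \<bar>\<omega>\<bar> * T))"
        using CG_pos t by (intro mult_left_mono) auto
      finally show ?thesis by (simp add: K_def)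
    qed
    show "norm (AS t) \<le> K / t" if t: "0 < t" "t \<le> T" for t
    proof -
      have "norm (Gb t) \<le> CG"
        by (rule norm_blinfun_bound) (use CG_pos norm_G[OF t(1)] in \<open>auto simp: Gb_apply t\<close>)
      moreover have "norm (Hb t) \<le> CG / t"
        by (rule norm_blinfun_bound) (use CG_pos t norm_H[OF t(1)] in \<open>auto simp: Hb_apply\<close>)
      ultimately have "norm (Hb t + \<omega> *\<^sub>R Gb t) \<le> CG / t + \<bar>\<omega>\<bar> * CG"
        by (intro order_trans[OF norm_triangle_ineq] add_mono) (auto intro: mult_left_mono)
      also have "\<dots> = CG * (1 + \<bar>\<omega>\<bar> * t) / t" using t by (simp add: field_simps)
      also have "\<dots> \<le> CG * (1 + \<bar>\<omega>\<bar> * T) / t"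
        using CG_pos t by (intro divide_right_mono mult_left_mono add_mono) auto
      finally have "norm (AS t) \<le> exp (\<bar>\<omega>\<bar> * T) * (CG * (1 + \<bar>\<omega>\<bar> * T) / t)"
        using e[of t] t unfolding AS_def norm_scaleR by (intro mult_mono) auto
      also have "\<dots> \<le> K / t"
        using t by (simp add: K_def divide_right_mono)
      finally show ?thesis .
    qed
    have "continuous_on {0<..} Gb"
      by (intro continuous_at_imp_continuous_on ballI has_vector_derivative_continuous[OF Gb_deriv]) auto
    then have "continuous_on {0<..} (\<lambda>t. exp (\<omega> * t) *\<^sub>R Gb t)" by (intro continuous_intros)
    then show "continuous_on {0<..} S"
      by (rule continuous_on_eq) (simp add: S_def)
  qed (simp add: K_def)
  then show ?thesis by blast
qed

context analytic_semigroup
begin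

lemma S_zero: "blinfun_apply (S 0) x = x"
  by (simp add: S_apply semigroup_of_def)

lemma AS_S:
  assumes "0 < s" "0 \<le> t"
  shows "blinfun_apply (AS s) (blinfun_apply (S t) x) = blinfun_apply (AS (s + t)) x"
  using S_S[of s t x] assms by (simp add: AS_apply flip: S_apply)

text \<open>Near \<open>s\<close>, half of the time is spent in the fixed operator
  \<open>AS (s/2)\<close>, and continuity is inherited from \<open>S\<close>. This provides the
  measurability of \<open>interp_fun\<close>.\<close>

lemma continuous_AS_apply: "continuous_on {0<..} (\<lambda>s. blinfun_apply (AS s) x)"
proof (intro continuous_at_imp_continuous_on ballI)
  fix s :: real assume "s \<in> {0<..}"
  then have s: "0 < s" by simp
  have "continuous_on {s/2<..} (\<lambda>t. blinfun_apply (AS (s/2)) (blinfun_apply (S (t - s/2)) x))"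
    by (intro continuous_intros continuous_on_compose2[OF continuous_S]) auto
  then have "continuous_on {s/2<..} (\<lambda>t. blinfun_apply (AS t) x)"
    by (rule continuous_on_eq) (use s in \<open>simp add: AS_S\<close>)
  then show "isCont (\<lambda>t. blinfun_apply (AS t) x) s"
    using s by (auto simp: continuous_on_eq_continuous_at)
qed

end

section \<open>Linear independence of the functions $\varphi_k$\<close>

text \<open>Integration by parts in the integral for \<open>phi (Suc k)\<close>. As
  \<open>phi 0\<close> is not defined by an integral, for \<open>k = 0\<close> it arises as the
  boundary value at \<xi> = 0, while the integral of \<open>\<psi>'\<close> is 0.\<close>

lemma phi_Suc: "phi k z = z * phi (Suc k) z + 1 / fact k"
proof -
  define \<psi> where "\<psi> \<xi> = exp (of_real (1 - \<xi>) * z) * of_real (\<xi> ^ k / fact k)" for \<xi> :: real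
  define \<psi>' where "\<psi>' \<xi> = (if k = 0 then 0 else exp (of_real (1 - \<xi>) * z) * of_real (\<xi> ^ (k - 1) / fact (k - 1)))" for \<xi> :: real
  have cont: "continuous_on {0..1} \<psi>" "continuous_on {0..1} \<psi>'"
    unfolding \<psi>_def \<psi>'_def by (cases "k = 0"; auto intro!: continuous_intros)+
  have "((\<lambda>\<xi>. \<psi>' \<xi> - z * \<psi> \<xi>) has_integral (\<psi> 1 - \<psi> 0)) {0..1}"
  proof (rule fundamental_theorem_of_calculus)
    fix \<xi> :: real
    define p where "p w = (if k = 0 then 0 else w ^ (k - 1) / fact (k - 1))" for w :: complex
    have "((\<lambda>w. w ^ k / fact k) has_field_derivative p w) (at w)" for w :: complex
    proof (cases k)
      case (Suc m)
      have "((\<lambda>w. w ^ k / fact k) has_field_derivative (of_nat (Suc m) * w ^ m / fact (Suc m))) (at w)"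
        unfolding Suc
        by (intro DERIV_cdivide DERIV_power[OF DERIV_ident, THEN DERIV_cong]) simp
      also have "of_nat (Suc m) * w ^ m / fact (Suc m) = p w"
        by (simp add: Suc p_def divide_simps del: of_nat_Suc)
      finally show ?thesis .
    qed (simp add: p_def)
    note p = this
    have "((\<lambda>w. exp ((1 - w) * z)) has_field_derivative - z * exp ((1 - of_real \<xi>) * z)) (at (of_real \<xi>))"
      by (auto intro!: derivative_eq_intros)
    from DERIV_mult[OF this p[of "of_real \<xi>"]]
    have "((\<lambda>w. exp ((1 - w) * z) * (w ^ k / fact k)) has_field_derivative
        exp ((1 - of_real \<xi>) * z) * p (of_real \<xi>) - z * (exp ((1 - of_real \<xi>) * z) * (of_real \<xi> ^ k / fact k))) (at (of_real \<xi>))"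
      by (simp add: algebra_simps)
    from has_vector_derivative_real_field[OF this]
    show "(\<psi> has_vector_derivative \<psi>' \<xi> - z * \<psi> \<xi>) (at \<xi> within {0..1})"
      by (cases "k = 0") (simp_all add: \<psi>_def[abs_def] \<psi>'_def p_def)
  qed simp
  moreover have "((\<lambda>\<xi>. \<psi>' \<xi> - z * \<psi> \<xi>) has_integral (integral {0..1} \<psi>' - z * integral {0..1} \<psi>)) {0..1}"
    by (intro has_integral_diff has_integral_mult_right integrable_integral integrable_continuous_real cont)
  ultimately have eq: "integral {0..1} \<psi>' - z * integral {0..1} \<psi> = \<psi> 1 - \<psi> 0"
    by (rule has_integral_unique[rotated])
  have 1: "phi (Suc k) z = integral {0..1} \<psi>" by (simp add: phi_def \<psi>_def[abs_def])
  have 2: "phi k z = integral {0..1} \<psi>' + (if k = 0 then exp z else 0)"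
    by (simp add: phi_def \<psi>'_def[abs_def])
  have 3: "\<psi> 1 - \<psi> 0 = 1 / fact k - (if k = 0 then exp z else 0)"
    by (simp add: \<psi>_def)
  have "integral {0..1} \<psi>' = (\<psi> 1 - \<psi> 0) + z * integral {0..1} \<psi>"
    using eq by (simp add: algebra_simps)
  then show ?thesis unfolding 1 2 3 by simp
qed

lemma power_mult_phi: "z ^ k * phi k z = exp z - (\<Sum>j<k. z ^ j / fact j)"
proof (induction k)
  case 0
  then show ?case by (simp add: phi_def)
next
  case (Suc k)
  have "z ^ Suc k * phi (Suc k) z = z ^ k * (phi k z - 1 / fact k)"
    using phi_Suc[of k z] by simp
  also have "\<dots> = exp z - (\<Sum>j<k. z ^ j / fact j) - z ^ k / fact k"
    unfolding right_diff_distrib Suc by simp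
  finally show ?case by simp
qed

text \<open>Multiplying the relation by \<open>z ^ K\<close> gives \<open>q z * exp z = r z\<close> with polynomials \<open>q\<close>, \<open>r\<close>; they
  agree at the infinitely many periods of \<open>exp\<close>.\<close>

lemma phi_linear_independent:
  assumes "\<And>z. (\<Sum>k\<le>K. a k * phi k z) = 0" and "k \<le> K"
  shows "a k = 0"
proof -
  define q where "q = (\<Sum>k\<le>K. monom (a k) (K - k))"
  define r where "r = (\<Sum>k\<le>K. monom (a k) (K - k) * (\<Sum>j<k. monom (1 / fact j) j))"
  have qr: "poly q z * exp z = poly r z" for z
  proof -
    have "0 = z ^ K * (\<Sum>k\<le>K. a k * phi k z)" using assms(1) by simp
    also have "\<dots> = (\<Sum>k\<le>K. a k * z ^ (K - k) * (z ^ k * phi k z))"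
      unfolding sum_distrib_left
    proof (rule sum.cong[OF refl])
      fix k assume "k \<in> {..K}"
      then have "z ^ K = z ^ (K - k) * z ^ k" by (simp flip: power_add)
      then show "z ^ K * (a k * phi k z) = a k * z ^ (K - k) * (z ^ k * phi k z)" by simp
    qed
    also have "\<dots> = poly q z * exp z - poly r z"
      unfolding power_mult_phi q_def r_def
      by (simp add: poly_sum poly_monom sum_subtractf sum_distrib_right right_diff_distrib)
    finally show ?thesis by simp
  qed
  have inf_zero: "p = 0" if "\<And>n::nat. poly p (f n) = 0" "inj f" for p :: "complex poly" and f :: "nat \<Rightarrow> complex"
  proof (rule ccontr)
    assume "p \<noteq> 0"
    then have "finite {z. poly p z = 0}" by (rule poly_roots_finite)
    moreover have "range f \<subseteq> {z. poly p z = 0}" using that(1) by auto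
    ultimately show False using that(2) by (meson finite_subset range_inj_infinite)
  qed
  have "q - r = 0"
  proof (rule inf_zero)
    fix n :: nat
    have "exp (2 * of_nat n * of_real pi * \<i>) = 1"
      by (auto simp: exp_eq_1 intro: exI[of _ "int n"])
    then show "poly (q - r) (2 * of_nat n * of_real pi * \<i>) = 0"
      using qr[of "2 * of_nat n * of_real pi * \<i>"] by simp
  qed (auto simp: inj_def)
  then have "q = r" by simp
  \<comment> \<open>At the positive integers \<open>exp\<close> differs from 1, so that
    \<open>q = r\<close> makes \<open>q\<close> vanish there.\<close>
  have "q = 0"
  proof (rule inf_zero)
    fix n :: nat
    have "poly q (of_nat (Suc n)) * (exp (of_nat (Suc n)) - 1) = 0"
      using qr[of "of_nat (Suc n)"] \<open>q = r\<close> by (simp add: right_diff_distrib)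
    moreover have "exp (of_nat (Suc n)) \<noteq> (1::complex)"
      by (subst exp_eq_1) (simp add: Re_exp)
    ultimately show "poly q (of_nat (Suc n)) = 0" by simp
  qed (auto simp: inj_def)
  \<comment> \<open>The exponents \<open>K - k\<close> are distinct for distinct
    \<open>k \<le> K\<close>, so each coefficient of \<open>q\<close> is a single
    \<open>a k\<close>.\<close>
  moreover have "coeff q (K - k) = (\<Sum>j\<le>K. if j = k then a j else 0)"
    unfolding q_def coeff_sum by (rule sum.cong) (use assms(2) in auto)
  ultimately show ?thesis using assms(2) by simp
qed

lemma weights_coefficients:
  assumes "\<And>z. (\<Sum>i=1..s. weight K (\<beta> i) z) = phi 1 z"
  shows "1 \<le> K" and "k \<le> K \<Longrightarrow> (\<Sum>i=1..s. \<beta> i k) = (if k = 1 then 1 else 0)"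
proof -
  \<comment> \<open>Padded with zeros and used up to \<open>Suc K\<close>, so that index 1 occurs
    even for \<open>K = 0\<close>; in that case \<open>a 1 = -1\<close>, which is contradictory and
    gives \<open>1 \<le> K\<close>.\<close>
  define a where "a k = (if k \<le> K then (\<Sum>i=1..s. \<beta> i k) else 0) - (if k = 1 then 1 else 0)" for k
  have "(\<Sum>k\<le>Suc K. a k * phi k z) = 0" for z
  proof -
    have "(\<Sum>k\<le>Suc K. a k * phi k z) =
      (\<Sum>k\<le>Suc K. (if k \<le> K then (\<Sum>i=1..s. \<beta> i k) else 0) * phi k z) - (\<Sum>k\<le>Suc K. (if k = 1 then 1 else 0) * phi k z)"
      by (simp only: a_def left_diff_distrib sum_subtractf)
    also have "(\<Sum>k\<le>Suc K. (if k \<le> K then (\<Sum>i=1..s. \<beta> i k) else 0) * phi k z) = (\<Sum>k\<le>K. (\<Sum>i=1..s. \<beta> i k) * phi k z)"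
      by simp
    also have "\<dots> = (\<Sum>i=1..s. weight K (\<beta> i) z)"
      unfolding weight_def sum_distrib_right by (rule sum.swap)
    also have "(\<Sum>k\<le>Suc K. (if k = 1 then 1 else 0) * phi k z) = (\<Sum>k\<le>Suc K. if k = 1 then phi k z else 0)"
      by (rule sum.cong) auto
    also have "\<dots> = phi 1 z" by simp
    finally show ?thesis using assms by simp
  qed
  then have a: "a k = 0" if "k \<le> Suc K" for k
    using phi_linear_independent[OF _ that, of a] by blast
  show "1 \<le> K" using a[of 1] by (cases K) (auto simp: a_def)
  show "(\<Sum>i=1..s. \<beta> i k) = (if k = 1 then 1 else 0)" if "k \<le> K"
    using a[of k] that by (simp add: a_def split: if_splits)
qed

section \<open>Estimates in the intermediate space\<close>

text \<open>The mean of \<open>1 / (s + \<sigma>)\<close> over \<open>0 \<le> \<sigma> \<le> t\<close>: up to a constant it bounds both \<open>A e\<^bsup>(s + t)A\<^esup>\<close> and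
  \<open>A e\<^bsup>sA\<^esup>\<close> applied to averages of \<open>e\<^bsup>\<sigma>A\<^esup>\<close>.\<close>

definition log_weight :: "real \<Rightarrow> real \<Rightarrow> real" where
  "log_weight s t = ln (1 + t / s) / t"

text \<open>The least value of \<open>1 / (s + \<sigma>)\<close> on
  \<open>0 \<le> \<sigma> \<le> t\<close> is below the mean. This puts the smoothing by the
  semigroup on the same scale as that by averages.\<close>

lemma inverse_add_le_log_weight:
  assumes "0 < s" "0 < t"
  shows "1 / (s + t) \<le> log_weight s t"
proof -
  have "ln (s / (s + t)) \<le> s / (s + t) - 1"
    by (rule ln_le_minus_one) (use assms in auto)
  then have "t / (s + t) \<le> ln (1 + t / s)"
    using assms by (simp add: ln_div field_simps)
  then show ?thesis using assms by (simp add: log_weight_def field_simps)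
qed

lemma log_weight_nonneg: "0 < s \<Longrightarrow> 0 < t \<Longrightarrow> 0 \<le> log_weight s t"
  by (simp add: log_weight_def)

lemma log_weight_le_inverse:
  assumes "0 < s" "0 < t"
  shows "log_weight s t \<le> 1 / s"
  using ln_add_one_self_le_self[of "t / s"] assms by (simp add: log_weight_def field_simps)

text \<open>For \<open>s \<le> t\<close> one has \<open>1 + t / s \<le> 2 * (t / s)\<close>, and
  \<open>ln y\<close> is at most \<open>y powr \<gamma> / \<gamma>\<close>: the logarithmic
  singularity is traded for a weak power.\<close>

lemma log_weight_le_powr:
  assumes "0 < s" "s \<le> t" "0 < \<gamma>"
  shows "log_weight s t \<le> 2 powr \<gamma> / \<gamma> * t powr (\<gamma> - 1) * s powr (- \<gamma>)"
proof -
  have t: "0 < t" using assms by simp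
  have "1 + t / s \<le> 2 * (t / s)" using assms by (simp add: field_simps)
  then have "ln (1 + t / s) \<le> ln (2 * (t / s))"
    using assms t by (subst ln_le_cancel_iff) (auto intro: add_pos_pos)
  also have "\<dots> = ln ((2 * (t / s)) powr \<gamma>) / \<gamma>" using assms t by (simp add: ln_powr)
  also have "\<dots> \<le> (2 * (t / s)) powr \<gamma> / \<gamma>"
    by (intro divide_right_mono ln_bound[THEN order_trans]) (use assms t in auto)
  also have "(2 * (t / s)) powr \<gamma> = 2 powr \<gamma> * t powr \<gamma> * s powr (- \<gamma>)"
    using assms t by (simp add: powr_mult powr_divide powr_minus field_simps)
  finally have "log_weight s t \<le> 2 powr \<gamma> * t powr \<gamma> * s powr (- \<gamma>) / \<gamma> / t"
    unfolding log_weight_def using t by (intro divide_right_mono) auto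
  also have "\<dots> = 2 powr \<gamma> / \<gamma> * t powr (\<gamma> - 1) * s powr (- \<gamma>)"
    using t by (simp add: powr_diff field_simps)
  finally show ?thesis .
qed

text \<open>The majorant \<open>h\<close> consists of a power integrable at 0 for
  \<open>s \<le> t\<close> and one integrable at infinity for \<open>s \<ge> t\<close>. By
  homogeneity both integrals are multiples of \<open>t powr (- \<alpha>)\<close>.\<close>

lemma log_weight_dominated:
  assumes \<alpha>: "0 < \<alpha>" "\<alpha> < 1"
  obtains c h where "0 \<le> c"
    "\<And>t s. 0 < t \<Longrightarrow> 0 \<le> h t s"
    "\<And>t s. 0 < t \<Longrightarrow> 0 < s \<Longrightarrow> s powr (- \<alpha>) * log_weight s t \<le> h t s"
    "\<And>t. 0 < t \<Longrightarrow> (h t has_integral c * t powr (- \<alpha>)) UNIV"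
proof -
  \<comment> \<open>Half of the room left below the critical exponent:
    \<open>\<alpha> + \<gamma> < 1\<close> keeps the inner power integrable at 0.\<close>
  define \<gamma> where "\<gamma> = (1 - \<alpha>) / 2"
  define \<kappa> where "\<kappa> = 2 powr \<gamma> / \<gamma>"
  have \<gamma>: "0 < \<gamma>" "- \<alpha> - \<gamma> > -1" "1 - \<alpha> - \<gamma> = \<gamma>" using \<alpha> by (auto simp: \<gamma>_def field_simps)
  have \<kappa>: "0 < \<kappa>" using \<gamma> by (simp add: \<kappa>_def)
  define h1 where "h1 t s = (if s \<in> {0..t} then \<kappa> * t powr (\<gamma> - 1) * s powr (- \<alpha> - \<gamma>) else 0)" for t s :: real
  define h2 where "h2 t s = (if s \<in> {t..} then s powr (- \<alpha> - 1) else 0)" for t s :: real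
  define h where "h t s = h1 t s + h2 t s" for t s
  define c where "c = \<kappa> / \<gamma> + 1 / \<alpha>"
  show ?thesis
  proof (rule that[of c h])
    show "0 \<le> c" using \<kappa> \<gamma> \<alpha> by (simp add: c_def)
    fix t :: real assume t: "0 < t"
    show "0 \<le> h t s" for s using \<kappa> by (simp add: h_def h1_def h2_def)
    show "s powr (- \<alpha>) * log_weight s t \<le> h t s" if s: "0 < s" for s
    proof (cases "s \<le> t")
      case True
      have "s powr (- \<alpha>) * log_weight s t \<le> s powr (- \<alpha>) * (\<kappa> * t powr (\<gamma> - 1) * s powr (- \<gamma>))"
        using log_weight_le_powr[OF s True \<gamma>(1)] by (intro mult_left_mono) (auto simp: \<kappa>_def)
      also have "\<dots> = h1 t s"
        using True s by (simp add: h1_def powr_diff powr_minus field_simps)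
      also have "\<dots> \<le> h t s" by (simp add: h_def h2_def)
      finally show ?thesis .
    next
      case False
      have "s powr (- \<alpha>) * log_weight s t \<le> s powr (- \<alpha>) * (1 / s)"
        using log_weight_le_inverse[OF s t] by (intro mult_left_mono) auto
      also have "\<dots> = h2 t s" using False s by (simp add: h2_def powr_diff)
      also have "\<dots> \<le> h t s" using \<kappa> by (simp add: h_def h1_def)
      finally show ?thesis .
    qed
    have "((\<lambda>s. \<kappa> * t powr (\<gamma> - 1) * s powr (- \<alpha> - \<gamma>)) has_integral
        (\<kappa> * t powr (\<gamma> - 1)) * (t powr (- \<alpha> - \<gamma> + 1) / (- \<alpha> - \<gamma> + 1))) {0..t}"
      by (intro has_integral_mult_right has_integral_powr_from_0) (use \<gamma> t in auto)
    also have "(\<kappa> * t powr (\<gamma> - 1)) * (t powr (- \<alpha> - \<gamma> + 1) / (- \<alpha> - \<gamma> + 1)) = \<kappa> / \<gamma> * t powr (- \<alpha>)"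
    proof -
      have e: "- \<alpha> - \<gamma> + 1 = \<gamma>" using \<gamma>(3) by simp
      have "t powr (\<gamma> - 1) * t powr \<gamma> = t powr (- \<alpha>)"
        by (simp add: \<gamma>_def flip: powr_add)
      then show ?thesis unfolding e by simp
    qed
    finally have 1: "(h1 t has_integral \<kappa> / \<gamma> * t powr (- \<alpha>)) UNIV"
      unfolding h1_def by (subst has_integral_restrict_UNIV)
    have "((\<lambda>s. s powr (- \<alpha> - 1)) has_integral - (t powr (- \<alpha> - 1 + 1)) / (- \<alpha> - 1 + 1)) {t..}"
      by (rule has_integral_powr_to_inf) (use \<alpha> t in auto)
    then have 2: "(h2 t has_integral 1 / \<alpha> * t powr (- \<alpha>)) UNIV"
      unfolding h2_def by (subst has_integral_restrict_UNIV) simp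
    show "(h t has_integral c * t powr (- \<alpha>)) UNIV"
      using has_integral_add[OF 1 2] by (simp add: h_def[abs_def] c_def distrib_right)
  qed
qed

text \<open>For \<open>p = 1\<close> the exponent in \<open>interp_fun\<close> is
  \<open>- \<alpha>\<close>, so the hypothesis on \<open>AS\<close> lets
  \<open>log_weight_dominated\<close> bound the norm of \<open>interp_space D A \<alpha> 1\<close>,
  and the embedding carries the bound over to \<open>V\<close>. The case \<alpha> = 0 is
  immediate.\<close>

lemma (in analytic_semigroup) intermediate_space_bound:
  assumes \<alpha>: "0 \<le> \<alpha>" "\<alpha> < 1" and V: "intermediate_space D A \<alpha> V N" and T0: "0 < T0"
  obtains c where "0 \<le> c"
    "\<And>t x Q. 0 < t \<Longrightarrow> t \<le> T0 \<Longrightarrow> norm x \<le> Q \<Longrightarrow>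
       (\<And>s. s \<in> {0<..<1} \<Longrightarrow> norm (blinfun_apply (AS s) x) \<le> Q * log_weight s t) \<Longrightarrow>
       x \<in> V \<and> N x \<le> c * Q * t powr (- \<alpha>)"
proof (cases "\<alpha> = 0")
  case True
  show ?thesis
    by (rule that[of 1]) (use V True in \<open>auto simp: intermediate_space_def\<close>)
next
  case False
  then have \<alpha>0: "0 < \<alpha>" using \<alpha> by simp
  from V False obtain c1 where sub: "interp_space D A \<alpha> 1 \<subseteq> V"
      and c1: "\<And>x. x \<in> interp_space D A \<alpha> 1 \<Longrightarrow> N x \<le> c1 * interp_norm D A \<alpha> 1 x"
    by (auto simp: intermediate_space_def continuous_embedding_def)
  obtain c h where c: "0 \<le> c" and h0: "\<And>t s. 0 < t \<Longrightarrow> 0 \<le> h t s"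
    and h: "\<And>t s. 0 < t \<Longrightarrow> 0 < s \<Longrightarrow> s powr (- \<alpha>) * log_weight s t \<le> h t s"
    and hi: "\<And>t. 0 < t \<Longrightarrow> (h t has_integral c * t powr (- \<alpha>)) UNIV"
    using log_weight_dominated[OF \<alpha>0 \<alpha>(2)] by metis
  let ?L = "lebesgue_on {0<..<1::real}"
  show ?thesis
  \<comment> \<open>\<open>T0 powr \<alpha>\<close> accounts for the summand \<open>norm x\<close>
    of the interpolation norm, as \<open>t \<le> T0\<close>; the absolute value is taken because the
    sign of the embedding constant is unknown.\<close>
  proof (rule that[of "\<bar>c1\<bar> * (T0 powr \<alpha> + c)"])
    show "0 \<le> \<bar>c1\<bar> * (T0 powr \<alpha> + c)" using c by simp
    fix t x Q assume t: "0 < t" "t \<le> T0" and xQ: "norm x \<le> Q"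
      and AQ: "\<And>s. s \<in> {0<..<1} \<Longrightarrow> norm (blinfun_apply (AS s) x) \<le> Q * log_weight s t"
    have Q: "0 \<le> Q" using xQ norm_ge_zero order_trans by blast
    define v where "v = interp_fun D A \<alpha> 1 x"
    have v: "v s = s powr (- \<alpha>) * norm (blinfun_apply (AS s) x)" if "0 < s" for s
      using that by (simp add: v_def interp_fun_def AS_apply)
    have "continuous_on {0<..<1} (\<lambda>s. s powr (- \<alpha>) * norm (blinfun_apply (AS s) x))"
      by (intro continuous_intros continuous_on_subset[OF continuous_AS_apply]) auto
    then have "continuous_on {0<..<1} v" by (rule continuous_on_eq) (simp add: v)
    then have meas: "v \<in> borel_measurable ?L"
      by (rule continuous_imp_measurable_on_sets_lebesgue) simp
    have "h t absolutely_integrable_on UNIV"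
      by (rule nonnegative_absolutely_integrable_1) (use hi t h0 in auto)
    then have "h t absolutely_integrable_on {0<..<1}"
      by (rule set_integrable_subset) auto
    then have h_int: "integrable ?L (h t)"
      by (simp add: integrable_restrict_space set_integrable_def)
    then have Qh_int: "integrable ?L (\<lambda>s. Q * h t s)" by simp
    have vle: "\<bar>v s\<bar> \<le> Q * h t s" "0 \<le> v s" if "s \<in> {0<..<1}" for s
    proof -
      have "s powr (- \<alpha>) * norm (blinfun_apply (AS s) x) \<le> s powr (- \<alpha>) * (Q * log_weight s t)"
        by (rule mult_left_mono[OF AQ[OF that]]) simp
      also have "\<dots> \<le> Q * h t s"
        using mult_left_mono[OF h[OF t(1)] Q, of s] that by (simp add: mult_ac)
      finally show "\<bar>v s\<bar> \<le> Q * h t s" "0 \<le> v s" using that by (auto simp: v)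
    qed
    have v_int: "integrable ?L v"
      by (rule Bochner_Integration.integrable_bound[OF Qh_int meas])
         (use vle in \<open>auto intro!: AE_I2 intro: order_trans[OF _ abs_ge_self] simp: space_restrict_space\<close>)
    then have in_space: "x \<in> interp_space D A \<alpha> 1"
      using meas by (simp add: interp_space_def in_Lp01_def v_def[symmetric] powr_one)
    have "(\<integral>s. \<bar>v s\<bar> \<partial>?L) \<le> (\<integral>s. Q * h t s \<partial>?L)"
      by (rule integral_mono) (use v_int Qh_int vle in \<open>auto simp: space_restrict_space\<close>)
    also have "\<dots> = Q * (\<integral>s. h t s \<partial>?L)" by simp
    also have "(\<integral>s. h t s \<partial>?L) = integral {0<..<1} (h t)"
      by (rule lebesgue_integral_eq_integral[OF h_int]) simp
    also have "integral {0<..<1} (h t) \<le> integral UNIV (h t)"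
      by (rule integral_subset_le)
         (use hi t h0 \<open>h t absolutely_integrable_on {0<..<1}\<close> in \<open>auto intro: set_lebesgue_integral_eq_integral(1)\<close>)
    also have "\<dots> = c * t powr (- \<alpha>)" using hi[OF t(1)] by (rule integral_unique)
    finally have int_le: "(\<integral>s. \<bar>v s\<bar> \<partial>?L) \<le> Q * (c * t powr (- \<alpha>))" using Q by (simp add: mult_left_mono)
    have "interp_norm D A \<alpha> 1 x = norm x + (\<integral>s. \<bar>v s\<bar> \<partial>?L)"
      by (simp add: interp_norm_def Lp01_norm_def v_def[symmetric] powr_one)
    also have "\<dots> \<le> Q * (T0 powr \<alpha> * t powr (- \<alpha>)) + Q * (c * t powr (- \<alpha>))"
    proof (rule add_mono[OF _ int_le])
      have "1 \<le> T0 powr \<alpha> * t powr (- \<alpha>)"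
        using powr_mono2[of \<alpha> t T0] t \<alpha>0 by (simp add: powr_minus field_simps)
      then show "norm x \<le> Q * (T0 powr \<alpha> * t powr (- \<alpha>))"
        using mult_left_mono[of 1 _ Q] Q xQ by fastforce
    qed
    also have "\<dots> = (T0 powr \<alpha> + c) * Q * t powr (- \<alpha>)" by (simp add: algebra_simps)
    finally have le: "interp_norm D A \<alpha> 1 x \<le> (T0 powr \<alpha> + c) * Q * t powr (- \<alpha>)" .
    have nn: "0 \<le> interp_norm D A \<alpha> 1 x"
      by (simp add: interp_norm_def Lp01_norm_def)
    have "N x \<le> c1 * interp_norm D A \<alpha> 1 x" by (rule c1[OF in_space])
    also have "\<dots> \<le> \<bar>c1\<bar> * ((T0 powr \<alpha> + c) * Q * t powr (- \<alpha>))"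
      using le nn by (intro mult_mono) auto
    finally show "x \<in> V \<and> N x \<le> \<bar>c1\<bar> * (T0 powr \<alpha> + c) * Q * t powr (- \<alpha>)"
      using in_space sub by (auto simp: mult_ac)
  qed
qed

section \<open>Convergence of the exponential Runge--Kutta method\<close>

context analytic_semigroup
begin

text \<open>The convolution over one step, rescaled to the unit interval. It covers both the
  operators \<open>phi_op\<close> with positive index, where \<open>f\<close> is a monomial times
  \<open>x\<close>, and the inhomogeneity in the mild solution.\<close>

definition conv :: "real \<Rightarrow> (real \<Rightarrow> 'a) \<Rightarrow> 'a" where
  "conv t f = integral {0..1} (\<lambda>\<xi>. blinfun_apply (S ((1 - \<xi>) * t)) (f \<xi>))"

text \<open>The end points are left out of the continuity because \<open>g\<close> may jump at time
  0, which is the left end of the first step.\<close>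

definition admissible :: "(real \<Rightarrow> 'a) \<Rightarrow> real \<Rightarrow> bool" where
  "admissible f B \<longleftrightarrow> continuous_on {0<..<1} f \<and> (\<forall>\<xi>\<in>{0..1}. norm (f \<xi>) \<le> B)"

lemma admissible_nonneg: "admissible f B \<Longrightarrow> 0 \<le> B"
  unfolding admissible_def by (meson atLeastAtMost_iff norm_ge_zero order_trans order_refl zero_le_one)

lemma norm_S_apply: "0 \<le> t \<Longrightarrow> t \<le> T \<Longrightarrow> norm (blinfun_apply (S t) x) \<le> C * norm x"
  by (rule order_trans[OF norm_blinfun mult_right_mono[OF norm_S]]) auto

lemma norm_AS_apply: "0 < t \<Longrightarrow> t \<le> T \<Longrightarrow> norm (blinfun_apply (AS t) x) \<le> C / t * norm x"
  by (rule order_trans[OF norm_blinfun mult_right_mono[OF norm_AS]]) auto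

lemma conv_arg: "\<xi> \<in> {0..1} \<Longrightarrow> 0 \<le> t \<Longrightarrow> t \<le> T \<Longrightarrow> 0 \<le> (1 - \<xi>) * t \<and> (1 - \<xi>) * t \<le> t \<and> (1 - \<xi>) * t \<le> T" for t :: real
  using mult_right_mono[of "1 - \<xi>" 1 t] by auto

lemma norm_conv_integrand:
  assumes "admissible f B" "0 < t" "t \<le> T" "\<xi> \<in> {0..1}"
  shows "norm (blinfun_apply (S ((1 - \<xi>) * t)) (f \<xi>)) \<le> C * B"
proof -
  have "norm (blinfun_apply (S ((1 - \<xi>) * t)) (f \<xi>)) \<le> C * norm (f \<xi>)"
    using conv_arg[OF assms(4), of t] assms by (intro norm_S_apply) auto
  also have "\<dots> \<le> C * B"
    using assms C_pos by (intro mult_left_mono) (auto simp: admissible_def)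
  finally show ?thesis .
qed

lemma conv_integrable:
  assumes "admissible f B" "0 < t" "t \<le> T"
  shows "(\<lambda>\<xi>. blinfun_apply (S ((1 - \<xi>) * t)) (f \<xi>)) integrable_on {0..1}"
proof (rule integrable_bounded_continuous_interior[where K="C * B"])
  show "continuous_on {0<..<1} (\<lambda>\<xi>. blinfun_apply (S ((1 - \<xi>) * t)) (f \<xi>))"
    using assms unfolding admissible_def
    by (intro continuous_intros continuous_on_compose2[OF continuous_S]) auto
qed (use norm_conv_integrand[OF assms] in auto)

lemma norm_conv:
  assumes "admissible f B" "0 < t" "t \<le> T"
  shows "norm (conv t f) \<le> C * B"
proof -
  have "norm (conv t f) \<le> integral {0..1::real} (\<lambda>\<xi>. C * B)"
    unfolding conv_def
    by (rule Henstock_Kurzweil_Integration.integral_norm_bound_integral[OF conv_integrable[OF assms]])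
       (use norm_conv_integrand[OF assms] in auto)
  then show ?thesis by simp
qed

text \<open>The bounded operator \<open>AS s\<close> goes under the integral and merges with the
  semigroup to \<open>AS (s + (1 - \<xi>) * t)\<close>; integrating the bound
  \<open>C / (s + (1 - \<xi>) * t)\<close> gives the logarithm. No regularity of \<open>f\<close>
  beyond boundedness enters the estimate.\<close>

lemma norm_AS_conv:
  assumes f: "admissible f B" and t: "0 < t" and s: "0 < s" and st: "s + t \<le> T"
  shows "norm (blinfun_apply (AS s) (conv t f)) \<le> C * B * log_weight s t"
proof -
  have tT: "t \<le> T" using s st by simp
  note int = conv_integrable[OF f t tT]
  have "blinfun_apply (AS s) (conv t f) = integral {0..1} (\<lambda>\<xi>. blinfun_apply (AS s) (blinfun_apply (S ((1 - \<xi>) * t)) (f \<xi>)))"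
    unfolding conv_def using integral_linear[OF int blinfun.bounded_linear_right[of "AS s"]] by (simp add: o_def)
  also have "norm \<dots> \<le> integral {0..1} (\<lambda>\<xi>. C * B * (1 / (s + (1 - \<xi>) * t)))"
  proof (rule Henstock_Kurzweil_Integration.integral_norm_bound_integral)
    show "(\<lambda>\<xi>. blinfun_apply (AS s) (blinfun_apply (S ((1 - \<xi>) * t)) (f \<xi>))) integrable_on {0..1}"
      using integrable_linear[OF int blinfun.bounded_linear_right[of "AS s"]] by (simp add: o_def)
    have "s + (1 - \<xi>) * t \<noteq> 0" if "\<xi> \<in> {0..1}" for \<xi>
      using conv_arg[OF that, of t] s t tT by auto
    then show "(\<lambda>\<xi>. C * B * (1 / (s + (1 - \<xi>) * t))) integrable_on {0..1}"
      by (intro integrable_continuous_real continuous_intros) auto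
    fix \<xi> :: real assume \<xi>: "\<xi> \<in> {0..1}"
    note a = conv_arg[OF \<xi> less_imp_le[OF t] tT]
    have p: "0 < s + (1 - \<xi>) * t" using a s by linarith
    have "norm (blinfun_apply (AS s) (blinfun_apply (S ((1 - \<xi>) * t)) (f \<xi>))) =
        norm (blinfun_apply (AS (s + (1 - \<xi>) * t)) (f \<xi>))"
      using AS_S[OF s, of "(1 - \<xi>) * t"] a by simp
    also have "\<dots> \<le> C / (s + (1 - \<xi>) * t) * norm (f \<xi>)"
      by (rule norm_AS_apply[OF p]) (use a st in linarith)
    also have "\<dots> \<le> C / (s + (1 - \<xi>) * t) * B"
      using f \<xi> p C_pos by (intro mult_left_mono) (auto simp: admissible_def)
    finally show "norm (blinfun_apply (AS s) (blinfun_apply (S ((1 - \<xi>) * t)) (f \<xi>))) \<le> C * B * (1 / (s + (1 - \<xi>) * t))"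
      by (simp add: mult_ac)
  qed
  also have "\<dots> = C * B * log_weight s t"
  proof -
    have "((\<lambda>\<xi>. 1 / (s + (1 - \<xi>) * t)) has_integral (- ln (s + (1 - 1) * t) / t - (- ln (s + (1 - 0) * t) / t))) {0..1}"
    proof (rule fundamental_theorem_of_calculus)
      fix \<xi> :: real assume \<xi>: "\<xi> \<in> {0..1}"
      have p: "0 < s + (1 - \<xi>) * t" using conv_arg[OF \<xi> less_imp_le[OF t] tT] s by linarith
      show "((\<lambda>\<xi>. - ln (s + (1 - \<xi>) * t) / t) has_vector_derivative 1 / (s + (1 - \<xi>) * t)) (at \<xi> within {0..1})"
        unfolding has_real_derivative_iff_has_vector_derivative[symmetric]
        using p t by (auto intro!: derivative_eq_intros simp: divide_simps)
    qed simp
    moreover have "- ln (s + (1 - 1) * t) / t - (- ln (s + (1 - 0) * t) / t) = log_weight s t"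
    proof -
      have "1 + t / s = (s + t) / s" using s by (simp add: field_simps)
      then show ?thesis using s t by (simp add: log_weight_def ln_div diff_divide_distrib)
    qed
    ultimately have "((\<lambda>\<xi>. 1 / (s + (1 - \<xi>) * t)) has_integral log_weight s t) {0..1}" by simp
    from has_integral_mult_right[OF this, of "C * B"] show ?thesis by (rule integral_unique)
  qed
  finally show ?thesis .
qed

lemma conv_diff:
  assumes "admissible f B" "admissible g B'" "0 < t" "t \<le> T"
  shows "conv t (\<lambda>\<xi>. f \<xi> - g \<xi>) = conv t f - conv t g"
  unfolding conv_def blinfun.diff_right
  by (rule Henstock_Kurzweil_Integration.integral_diff)
     (rule conv_integrable[OF assms(1,3,4)], rule conv_integrable[OF assms(2,3,4)])

lemma admissible_const: "admissible (\<lambda>_. x) (norm x)"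
  by (simp add: admissible_def)

lemma admissible_phi: "admissible (\<lambda>\<xi>. (\<xi> ^ k / fact k) *\<^sub>R x) (norm x)"
  unfolding admissible_def
proof (intro conjI ballI)
  show "continuous_on {0<..<1} (\<lambda>\<xi>::real. (\<xi> ^ k / fact k) *\<^sub>R x)"
    by (intro continuous_intros) auto
  fix \<xi> :: real assume \<xi>: "\<xi> \<in> {0..1}"
  have "\<xi> ^ k / fact k \<le> 1 / 1"
    using \<xi> by (intro frac_le power_le_one fact_ge_1) auto
  then have "\<xi> ^ k / fact k * norm x \<le> 1 * norm x" by (intro mult_right_mono) auto
  then show "norm ((\<xi> ^ k / fact k) *\<^sub>R x) \<le> norm x" using \<xi> by simp
qed

lemma phi_op_zero: "0 \<le> t \<Longrightarrow> phi_op D A 0 t x = blinfun_apply (S t) x"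
  by (simp add: phi_op_def S_apply)

lemma phi_op_Suc:
  assumes "0 \<le> t"
  shows "phi_op D A (Suc k) t x = conv t (\<lambda>\<xi>. (\<xi> ^ k / fact k) *\<^sub>R x)"
  unfolding phi_op_def conv_def using assms
  by (auto intro!: Henstock_Kurzweil_Integration.integral_cong simp: S_apply[symmetric] blinfun.scaleR_right)

lemma norm_phi_op:
  assumes "0 < t" "t \<le> T"
  shows "norm (phi_op D A k t x) \<le> C * norm x"
  using assms norm_conv[OF admissible_phi assms]
  by (cases k) (auto simp: phi_op_zero phi_op_Suc intro: norm_S_apply)

text \<open>\<open>phi_op\<close> with index 0 is the semigroup itself and smooths at once; those of
  higher index are averages.\<close>

lemma norm_AS_phi_op:
  assumes t: "0 < t" and s: "0 < s" and st: "s + t \<le> T"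
  shows "norm (blinfun_apply (AS s) (phi_op D A k t x)) \<le> C * norm x * log_weight s t"
proof (cases k)
  case 0
  have "norm (blinfun_apply (AS s) (phi_op D A k t x)) \<le> C / (s + t) * norm x"
    using 0 t s st norm_AS_apply[of "s + t" x] by (simp add: phi_op_zero AS_S)
  also have "\<dots> = C * norm x * (1 / (s + t))" by simp
  also have "\<dots> \<le> C * norm x * log_weight s t"
    using inverse_add_le_log_weight[OF s t] C_pos by (intro mult_left_mono) auto
  finally show ?thesis .
next
  case (Suc m)
  then show ?thesis using t norm_AS_conv[OF admissible_phi t s st] by (simp add: phi_op_Suc)
qed

lemma phi_op_diff:
  assumes "0 < t" "t \<le> T"
  shows "phi_op D A k t (x - y) = phi_op D A k t x - phi_op D A k t y"
proof (cases k)
  case (Suc m)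
  then show ?thesis
    using assms conv_diff[OF admissible_phi[of m x] admissible_phi[of m y] assms]
    by (simp add: phi_op_Suc scaleR_diff_right)
qed (use assms in \<open>simp add: phi_op_zero blinfun.diff_right\<close>)

lemma weight_op_diff:
  assumes "0 < t" "t \<le> T"
  shows "weight_op D A K b t (x - y) = weight_op D A K b t x - weight_op D A K b t y"
  unfolding weight_op_def by (simp add: phi_op_diff[OF assms] scaleC.diff_right sum_subtractf)

lemma norm_weight_op:
  assumes "0 < t" "t \<le> T" "norm x \<le> B"
  shows "norm (weight_op D A K b t x) \<le> (\<Sum>k\<le>K. cmod (b k)) * (C * B)"
  unfolding weight_op_def sum_distrib_right
proof (rule sum_norm_le)
  fix k
  show "norm (b k *\<^sub>C phi_op D A k t x) \<le> cmod (b k) * (C * B)"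
    unfolding norm_scaleC
    using order_trans[OF norm_phi_op[OF assms(1,2)] mult_left_mono[OF assms(3)]] C_pos
    by (intro mult_left_mono) auto
qed

lemma norm_AS_weight_op:
  assumes t: "0 < t" and s: "0 < s" and st: "s + t \<le> T" and x: "norm x \<le> B"
  shows "norm (blinfun_apply (AS s) (weight_op D A K b t x)) \<le> (\<Sum>k\<le>K. cmod (b k)) * (C * B * log_weight s t)"
  unfolding weight_op_def sum_distrib_right blinfun.sum_right AS_scaleC[OF s]
proof (rule sum_norm_le)
  fix k
  have "norm (blinfun_apply (AS s) (phi_op D A k t x)) \<le> C * norm x * log_weight s t"
    by (rule norm_AS_phi_op[OF t s st])
  also have "\<dots> \<le> C * B * log_weight s t"
    using x C_pos log_weight_nonneg[OF s t] by (intro mult_right_mono mult_left_mono) auto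
  finally show "norm (b k *\<^sub>C blinfun_apply (AS s) (phi_op D A k t x)) \<le> cmod (b k) * (C * B * log_weight s t)"
    unfolding norm_scaleC by (intro mult_left_mono) auto
qed

end

text \<open>The extra unit in \<open>T0 + 1 \<le> T\<close> leaves room for the parameter of the
  interpolation norm, which runs through \<open>(0, 1)\<close> and is added to times up to
  \<open>T0\<close>. The derivative of \<open>g\<close> is represented by its consequences
  \<open>g_cont\<close> and \<open>g_lipschitz\<close>.\<close>

locale exp_rk_problem = analytic_semigroup D A S AS T C
  for D :: "'a::complex_banach set" and A S AS T C +
  fixes g :: "real \<Rightarrow> 'a" and B T0 \<tau> :: real
    and s K :: nat and c :: "nat \<Rightarrow> real" and \<beta> :: "nat \<Rightarrow> nat \<Rightarrow> complex"
  assumes T0: "T0 + 1 \<le> T"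
    and tau: "0 < \<tau>"
    and nodes: "i \<in> {1..s} \<Longrightarrow> c i \<in> {0..1}"
    and K: "1 \<le> K"
    and coefficients: "k \<le> K \<Longrightarrow> (\<Sum>i=1..s. \<beta> i k) = (if k = 1 then 1 else 0)"
    and g_bound: "t \<in> {0..T0} \<Longrightarrow> norm (g t) \<le> B"
    and g_cont: "continuous_on {0<..T0} g"
    and g_lipschitz: "0 < a \<Longrightarrow> x \<in> {a..T0} \<Longrightarrow> y \<in> {a..T0} \<Longrightarrow> norm (g x - g y) \<le> B / a * \<bar>x - y\<bar>"
begin

definition total_weight :: real where
  "total_weight = (\<Sum>i=1..s. \<Sum>k\<le>K. cmod (\<beta> i k))"

text \<open>The quadrature error of one step, per unit of time. Node values and function are
  separate arguments, so that the same bounds apply to \<open>g\<close> and to \<open>g\<close>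
  minus a constant.\<close>

definition residual :: "(nat \<Rightarrow> 'a) \<Rightarrow> (real \<Rightarrow> 'a) \<Rightarrow> 'a" where
  "residual y f = (\<Sum>i=1..s. weight_op D A K (\<beta> i) \<tau> (y i)) - conv \<tau> f"

definition defect :: "nat \<Rightarrow> 'a" where
  "defect j = \<tau> *\<^sub>R residual (\<lambda>i. g (real j * \<tau> + c i * \<tau>)) (\<lambda>\<xi>. g (real j * \<tau> + \<xi> * \<tau>))"

section \<open>The defect of a single step\<close>

lemma total_weight_nonneg: "0 \<le> total_weight"
  unfolding total_weight_def by (intro sum_nonneg) auto

text \<open>By \<open>coefficients\<close> only \<open>phi_op\<close> with index 1 survives, and
  that is the average of the semigroup. So constants have residual 0.\<close>

lemma sum_weight_op:
  assumes "\<tau> \<le> T"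
  shows "(\<Sum>i=1..s. weight_op D A K (\<beta> i) \<tau> x) = conv \<tau> (\<lambda>_. x)"
proof -
  have "(\<Sum>i=1..s. weight_op D A K (\<beta> i) \<tau> x) = (\<Sum>k\<le>K. \<Sum>i=1..s. \<beta> i k *\<^sub>C phi_op D A k \<tau> x)"
    unfolding weight_op_def by (rule sum.swap)
  also have "\<dots> = (\<Sum>k\<le>K. (\<Sum>i=1..s. \<beta> i k) *\<^sub>C phi_op D A k \<tau> x)"
    by (simp only: scaleC.sum_left)
  also have "\<dots> = (\<Sum>k\<le>K. if k = 1 then phi_op D A k \<tau> x else 0)"
  proof (rule sum.cong[OF refl])
    fix k assume "k \<in> {..K}"
    then have "k \<le> K" by simp
    show "(\<Sum>i=1..s. \<beta> i k) *\<^sub>C phi_op D A k \<tau> x = (if k = 1 then phi_op D A k \<tau> x else 0)"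
      unfolding coefficients[OF \<open>k \<le> K\<close>] by (simp add: scaleC.zero_left)
  qed
  also have "\<dots> = phi_op D A (Suc 0) \<tau> x" using K by simp
  also have "\<dots> = conv \<tau> (\<lambda>_. x)" using tau by (simp add: phi_op_Suc)
  finally show ?thesis .
qed

lemma norm_residual:
  assumes "\<And>i. i \<in> {1..s} \<Longrightarrow> norm (y i) \<le> b" "admissible f b" "\<tau> \<le> T"
  shows "norm (residual y f) \<le> C * b * (total_weight + 1)"
proof -
  have "norm (\<Sum>i=1..s. weight_op D A K (\<beta> i) \<tau> (y i)) \<le> (\<Sum>i=1..s. (\<Sum>k\<le>K. cmod (\<beta> i k)) * (C * b))"
    by (rule sum_norm_le) (rule norm_weight_op[OF tau assms(3) assms(1)])
  also have "\<dots> = total_weight * (C * b)" by (simp only: total_weight_def sum_distrib_right)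
  finally show ?thesis
    unfolding residual_def using norm_conv[OF assms(2) tau assms(3)]
    by (intro order_trans[OF norm_triangle_ineq4]) (simp add: algebra_simps)
qed

lemma norm_AS_residual:
  assumes "\<And>i. i \<in> {1..s} \<Longrightarrow> norm (y i) \<le> b" "admissible f b" "0 < r" "r + \<tau> \<le> T"
  shows "norm (blinfun_apply (AS r) (residual y f)) \<le> C * b * (total_weight + 1) * log_weight r \<tau>"
proof -
  have "norm (\<Sum>i=1..s. blinfun_apply (AS r) (weight_op D A K (\<beta> i) \<tau> (y i)))
      \<le> (\<Sum>i=1..s. (\<Sum>k\<le>K. cmod (\<beta> i k)) * (C * b * log_weight r \<tau>))"
    by (rule sum_norm_le) (rule norm_AS_weight_op[OF tau assms(3,4) assms(1)])
  also have "\<dots> = total_weight * (C * b * log_weight r \<tau>)" by (simp only: total_weight_def sum_distrib_right)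
  finally show ?thesis
    unfolding residual_def blinfun.diff_right blinfun.sum_right
    using norm_AS_conv[OF assms(2) tau assms(3,4)]
    by (intro order_trans[OF norm_triangle_ineq4]) (simp add: algebra_simps)
qed

lemma step_range:
  assumes "real (Suc j) * \<tau> \<le> T0" "\<xi> \<in> {0..1}"
  shows "real j * \<tau> \<le> real j * \<tau> + \<xi> * \<tau>" "real j * \<tau> + \<xi> * \<tau> \<le> T0" "0 \<le> real j * \<tau>" "\<xi> * \<tau> \<le> \<tau>"
proof -
  have "0 \<le> \<xi> * \<tau>" "\<xi> * \<tau> \<le> \<tau>" using assms(2) tau mult_right_mono[of \<xi> 1 \<tau>] by auto
  moreover have "real (Suc j) * \<tau> = real j * \<tau> + \<tau>" by (simp add: algebra_simps)
  ultimately show "real j * \<tau> \<le> real j * \<tau> + \<xi> * \<tau>" "real j * \<tau> + \<xi> * \<tau> \<le> T0" "\<xi> * \<tau> \<le> \<tau>"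
    using assms(1) tau by linarith+
  show "0 \<le> real j * \<tau>" using tau by simp
qed

lemma tau_le:
  assumes "real (Suc j) * \<tau> \<le> T0"
  shows "\<tau> \<le> T0"
  using step_range(2)[OF assms, of 1] step_range(3)[OF assms, of 1] by simp

lemma admissible_g:
  assumes "real (Suc j) * \<tau> \<le> T0"
  shows "admissible (\<lambda>\<xi>. g (real j * \<tau> + \<xi> * \<tau>)) B"
  unfolding admissible_def
proof (intro conjI ballI)
  have "real j * \<tau> + \<xi> * \<tau> \<in> {0<..T0}" if "\<xi> \<in> {0<..<1}" for \<xi>
  proof -
    have "0 < \<xi> * \<tau>" using that tau by simp
    moreover have "\<xi> \<in> {0..1}" using that by simp
    ultimately show ?thesis using step_range(2,3)[OF assms, of \<xi>] unfolding greaterThanAtMost_iff by linarith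
  qed
  then show "continuous_on {0<..<1} (\<lambda>\<xi>. g (real j * \<tau> + \<xi> * \<tau>))"
    by (intro continuous_on_compose2[OF g_cont] continuous_intros) auto
  show "norm (g (real j * \<tau> + \<xi> * \<tau>)) \<le> B" if "\<xi> \<in> {0..1}" for \<xi>
    using step_range[OF assms that] by (intro g_bound) auto
qed

definition E :: real where "E = C * B * (total_weight + 1)"

text \<open>Here \<open>g\<close> is merely bounded by \<open>B\<close>, so there is no gain from
  large \<open>j\<close>; the estimate serves the last step only, where the order \<tau>
  suffices.\<close>

lemma norm_AS_defect:
  assumes j: "real (Suc j) * \<tau> \<le> T0" and r: "0 < r" "r \<le> 1"
  shows "norm (blinfun_apply (AS r) (defect j)) \<le> \<tau> * E * log_weight r \<tau>"
proof -
  have "r + \<tau> \<le> T" using tau_le[OF j] r T0 by linarith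
  then have "norm (blinfun_apply (AS r) (residual (\<lambda>i. g (real j * \<tau> + c i * \<tau>)) (\<lambda>\<xi>. g (real j * \<tau> + \<xi> * \<tau>))))
      \<le> E * log_weight r \<tau>"
    unfolding E_def
    using nodes step_range[OF j] r by (intro norm_AS_residual admissible_g[OF j] g_bound) fastforce+
  then show ?thesis
    using tau unfolding defect_def blinfun.scaleR_right by (simp add: mult_left_mono mult.assoc)
qed

text \<open>For \<open>j > 0\<close> the value \<open>g (j * \<tau>)\<close> may be subtracted from all the values of \<open>g\<close> in the defect, as
  the weights add up to \<open>\<phi>\<^sub>1\<close>.\<close>

lemma norm_defect:
  assumes j: "real (Suc j) * \<tau> \<le> T0"
  shows "norm (defect j) \<le> 2 * E * \<tau> / (real j + 1)"
proof -
  have \<tau>T: "\<tau> \<le> T" using tau_le[OF j] T0 by linarith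
  note ran = step_range[OF j]
  have B: "0 \<le> B" using admissible_nonneg[OF admissible_g[OF j]] .
  then have E: "0 \<le> E" using C_pos total_weight_nonneg by (simp add: E_def)
  define t where "t = real j * \<tau>"
  show ?thesis
  proof (cases "j = 0")
    case True
    have "norm (residual (\<lambda>i. g (real j * \<tau> + c i * \<tau>)) (\<lambda>\<xi>. g (real j * \<tau> + \<xi> * \<tau>))) \<le> E"
      unfolding E_def
      using nodes ran by (intro norm_residual admissible_g[OF j] g_bound \<tau>T) fastforce+
    then have "norm (defect j) \<le> \<tau> * E"
      using tau by (simp add: defect_def mult_left_mono)
    also have "\<dots> \<le> 2 * E * \<tau>" using E tau by simp
    finally show ?thesis using True by simp
  next
    case False
    then have t: "0 < t" using tau by (simp add: t_def)
    \<comment> \<open>The Lipschitz constant \<open>B / t\<close> with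
      \<open>t = real j * \<tau>\<close>, times a distance of at most \<tau>.\<close>
    have lip: "norm (g (t + \<xi> * \<tau>) - g t) \<le> B / real j" if "\<xi> \<in> {0..1}" for \<xi>
    proof -
      have "norm (g (t + \<xi> * \<tau>) - g t) \<le> B / t * \<bar>t + \<xi> * \<tau> - t\<bar>"
        using ran[OF that] by (intro g_lipschitz[OF t]) (auto simp: t_def)
      also have "\<dots> \<le> B / t * \<tau>"
        using ran[OF that] B t that tau by (intro mult_left_mono) auto
      also have "\<dots> = B / real j" using tau False by (simp add: t_def)
      finally show ?thesis .
    qed
    have adm: "admissible (\<lambda>\<xi>. g (t + \<xi> * \<tau>)) B" using admissible_g[OF j] by (simp add: t_def)
    have adm': "admissible (\<lambda>\<xi>. g (t + \<xi> * \<tau>) - g t) (B / real j)"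
      using adm lip unfolding admissible_def by (auto intro!: continuous_intros)
    have "residual (\<lambda>i. g (t + c i * \<tau>)) (\<lambda>\<xi>. g (t + \<xi> * \<tau>)) =
        residual (\<lambda>i. g (t + c i * \<tau>) - g t) (\<lambda>\<xi>. g (t + \<xi> * \<tau>) - g t)"
      unfolding residual_def weight_op_diff[OF tau \<tau>T] sum_subtractf conv_diff[OF adm admissible_const tau \<tau>T]
        sum_weight_op[OF \<tau>T]
      by simp
    also have "norm \<dots> \<le> C * (B / real j) * (total_weight + 1)"
      by (rule norm_residual[OF _ adm' \<tau>T]) (use nodes lip in auto)
    also have "\<dots> = E / real j" by (simp add: E_def)
    \<comment> \<open>Since \<open>1 \<le> j\<close>, passing from \<open>1 / j\<close> to
      \<open>1 / (j + 1)\<close> costs a factor 2; the shifted form includes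
      \<open>j = 0\<close>.\<close>
    also have "\<dots> \<le> 2 * E / (real j + 1)"
      using False E mult_right_mono[of 1 "real j" E] by (simp add: field_simps)
    finally have "\<tau> * norm (residual (\<lambda>i. g (t + c i * \<tau>)) (\<lambda>\<xi>. g (t + \<xi> * \<tau>))) \<le> \<tau> * (2 * E / (real j + 1))"
      using tau by (intro mult_left_mono) auto
    moreover have "norm (defect j) = \<tau> * norm (residual (\<lambda>i. g (t + c i * \<tau>)) (\<lambda>\<xi>. g (t + \<xi> * \<tau>)))"
      using tau by (simp add: defect_def t_def)
    ultimately show ?thesis by (simp add: mult.commute)
  qed
qed

section \<open>Accumulation of the defects\<close>

lemma mild_step:
  assumes j: "real (Suc j) * \<tau> \<le> T0"
  shows "mild_solution D A g u0 (real (Suc j) * \<tau>) =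
     blinfun_apply (S \<tau>) (mild_solution D A g u0 (real j * \<tau>)) + \<tau> *\<^sub>R conv \<tau> (\<lambda>\<xi>. g (real j * \<tau> + \<xi> * \<tau>))"
proof -
  define t where "t = real j * \<tau>"
  have Suc: "real (Suc j) * \<tau> = t + \<tau>" by (simp add: t_def algebra_simps)
  have t: "0 \<le> t" "t + \<tau> \<le> T0" using tau j Suc by (simp_all add: t_def)
  have mild: "mild_solution D A g u0 r = blinfun_apply (S r) u0 + integral {0..r} (\<lambda>\<xi>. blinfun_apply (S (r - \<xi>)) (g \<xi>))"
    if "0 \<le> r" for r
    unfolding mild_solution_def S_apply[OF that]
    by (auto intro!: Henstock_Kurzweil_Integration.integral_cong simp: S_apply)
  have int: "(\<lambda>\<xi>. blinfun_apply (S (r - \<xi>)) (g \<xi>)) integrable_on {0..r}" if r: "r \<le> T0" for r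
  proof (rule integrable_bounded_continuous_interior)
    show "continuous_on {0<..<r} (\<lambda>\<xi>. blinfun_apply (S (r - \<xi>)) (g \<xi>))"
      using r by (intro continuous_intros continuous_on_compose2[OF continuous_S] continuous_on_subset[OF g_cont]) auto
    fix \<xi> assume \<xi>: "\<xi> \<in> {0<..<r}"
    have "norm (blinfun_apply (S (r - \<xi>)) (g \<xi>)) \<le> C * norm (g \<xi>)"
      using \<xi> r T0 by (intro norm_S_apply) auto
    also have "\<dots> \<le> C * B" using \<xi> r C_pos by (intro mult_left_mono g_bound) auto
    finally show "norm (blinfun_apply (S (r - \<xi>)) (g \<xi>)) \<le> C * B" .
  qed
  define F where "F \<xi> = blinfun_apply (S (t + \<tau> - \<xi>)) (g \<xi>)" for \<xi>
  have F: "F integrable_on {0..t+\<tau>}" unfolding F_def by (rule int[OF t(2)])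
  \<comment> \<open>The past up to \<open>t\<close> is the earlier integral propagated by
    \<open>S \<tau>\<close>; the rest, rescaled to the unit interval, is the convolution.\<close>
  have "integral {0..t} F = integral {0..t} (\<lambda>\<xi>. blinfun_apply (S \<tau>) (blinfun_apply (S (t - \<xi>)) (g \<xi>)))"
    unfolding F_def using tau
    by (intro Henstock_Kurzweil_Integration.integral_cong) (auto simp: S_S algebra_simps)
  also have "\<dots> = blinfun_apply (S \<tau>) (integral {0..t} (\<lambda>\<xi>. blinfun_apply (S (t - \<xi>)) (g \<xi>)))"
    using integral_linear[OF int blinfun.bounded_linear_right[of "S \<tau>"], of t] t tau by (simp add: o_def)
  finally have 1: "integral {0..t} F = blinfun_apply (S \<tau>) (integral {0..t} (\<lambda>\<xi>. blinfun_apply (S (t - \<xi>)) (g \<xi>)))" .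
  have "(F has_integral integral {t..t+\<tau>} F) (cbox t (t + \<tau>))"
    using integrable_subinterval_real[OF F, of t "t+\<tau>"] t by auto
  from has_integral_affinity'[OF this tau, of t]
  have "((\<lambda>x. F (\<tau> * x + t)) has_integral integral {t..t+\<tau>} F /\<^sub>R \<tau>) {0..1}"
    using tau by simp
  moreover have "F (\<tau> * x + t) = blinfun_apply (S ((1 - x) * \<tau>)) (g (t + x * \<tau>))" for x
    by (simp add: F_def algebra_simps)
  ultimately have "conv \<tau> (\<lambda>\<xi>. g (t + \<xi> * \<tau>)) = integral {t..t+\<tau>} F /\<^sub>R \<tau>"
    unfolding conv_def by (simp add: integral_unique)
  then have 2: "integral {t..t+\<tau>} F = \<tau> *\<^sub>R conv \<tau> (\<lambda>\<xi>. g (t + \<xi> * \<tau>))" using tau by simp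
  have "integral {0..t+\<tau>} F = integral {0..t} F + integral {t..t+\<tau>} F"
    by (rule Henstock_Kurzweil_Integration.integral_combine[symmetric, OF _ _ F]) (use t tau in auto)
  then have "mild_solution D A g u0 (t + \<tau>) = blinfun_apply (S (\<tau> + t)) u0 + (integral {0..t} F + integral {t..t+\<tau>} F)"
    using mild[of "t + \<tau>"] t tau by (simp add: F_def[abs_def] add.commute)
  also have "\<dots> = blinfun_apply (S \<tau>) (mild_solution D A g u0 t) + \<tau> *\<^sub>R conv \<tau> (\<lambda>\<xi>. g (t + \<xi> * \<tau>))"
    unfolding 1 2 mild[OF t(1)] using t tau by (simp add: blinfun.add_right S_S)
  finally show ?thesis unfolding Suc t_def[symmetric] .
qed

lemma error_representation:
  assumes "real n * \<tau> \<le> T0"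
  shows "exp_rk D A s c K \<beta> g u0 \<tau> n - mild_solution D A g u0 (real n * \<tau>)
    = (\<Sum>j<n. blinfun_apply (S (real (n - 1 - j) * \<tau>)) (defect j))"
  using assms
proof (induction n)
  case 0
  then show ?case by (simp add: mild_solution_def semigroup_of_def)
next
  case (Suc n)
  let ?u = "exp_rk D A s c K \<beta> g u0 \<tau>" and ?v = "\<lambda>n. mild_solution D A g u0 (real n * \<tau>)"
  have "real n * \<tau> \<le> T0" using Suc.prems tau by (simp add: algebra_simps)
  note IH = Suc.IH[OF this]
  have "?u (Suc n) - ?v (Suc n) = blinfun_apply (S \<tau>) (?u n - ?v n) + defect n"
    unfolding mild_step[OF Suc.prems] exp_rk.simps(2)
    using tau by (simp add: S_apply[symmetric] blinfun.diff_right defect_def residual_def scaleR_diff_right)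
  also have "blinfun_apply (S \<tau>) (?u n - ?v n) = (\<Sum>j<n. blinfun_apply (S (real (Suc n - 1 - j) * \<tau>)) (defect j))"
    unfolding IH blinfun.sum_right
  proof (rule sum.cong[OF refl])
    fix j assume "j \<in> {..<n}"
    then have "\<tau> + real (n - 1 - j) * \<tau> = real (Suc n - 1 - j) * \<tau>"
      by (simp add: of_nat_diff algebra_simps)
    then show "blinfun_apply (S \<tau>) (blinfun_apply (S (real (n - 1 - j) * \<tau>)) (defect j)) =
        blinfun_apply (S (real (Suc n - 1 - j) * \<tau>)) (defect j)"
      using S_S[of \<tau> "real (n - 1 - j) * \<tau>"] tau by simp
  qed
  also have "\<dots> + defect n = (\<Sum>j<Suc n. blinfun_apply (S (real (Suc n - 1 - j) * \<tau>)) (defect j))"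
    by (simp add: S_zero)
  finally show ?case .
qed

text \<open>\<open>V\<close> and \<open>N\<close> enter through subadditivity and the smoothing
  estimate \<open>emb\<close>, which treats \<alpha> = 0 and \<alpha> > 0 alike. Each of the terms
  with \<open>j < n - 1\<close> is smoothed by a semigroup operator at a time of at least
  \<tau>.\<close>

lemma error_bound:
  assumes n: "real n * \<tau> \<le> T0" and "0 < T0"
    and V0: "0 \<in> V" "N 0 = 0"
    and Vadd: "\<And>x y. x \<in> V \<Longrightarrow> y \<in> V \<Longrightarrow> x + y \<in> V \<and> N (x + y) \<le> N x + N y"
    and \<kappa>: "0 \<le> \<kappa>" and \<alpha>: "0 \<le> \<alpha>"
    and emb: "\<And>t x Q. 0 < t \<Longrightarrow> t \<le> T0 \<Longrightarrow> norm x \<le> Q \<Longrightarrow>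
       (\<And>r. r \<in> {0<..<1} \<Longrightarrow> norm (blinfun_apply (AS r) x) \<le> Q * log_weight r t) \<Longrightarrow>
       x \<in> V \<and> N x \<le> \<kappa> * Q * t powr (- \<alpha>)"
  shows "exp_rk D A s c K \<beta> g u0 \<tau> n - mild_solution D A g u0 (real n * \<tau>) \<in> V \<and>
     N (exp_rk D A s c K \<beta> g u0 \<tau> n - mild_solution D A g u0 (real n * \<tau>))
       \<le> 2 * \<kappa> * E * (C + 1) * (2 + \<bar>ln T0\<bar>) * \<tau> powr (1 - \<alpha>) * (\<bar>ln \<tau>\<bar> + 1)"
proof -
  have "norm (g 0) \<le> B" by (rule g_bound) (use \<open>0 < T0\<close> in simp)
  then have "0 \<le> B" using norm_ge_zero[of "g 0"] by linarith
  then have E: "0 \<le> E" using C_pos total_weight_nonneg by (simp add: E_def)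
  show ?thesis
  proof (cases "n = 0")
    case True
    have "0 \<le> 2 * \<kappa> * E * (C + 1) * (2 + \<bar>ln T0\<bar>) * \<tau> powr (1 - \<alpha>) * (\<bar>ln \<tau>\<bar> + 1)"
      using \<kappa> C_pos E by (intro mult_nonneg_nonneg) auto
    then show ?thesis using True V0 by (simp add: mild_solution_def semigroup_of_def)
  next
    case False
    define M0 where "M0 = 2 * \<kappa> * E * (C + 1) * \<tau> powr (1 - \<alpha>)"
    define x where "x j = blinfun_apply (S (real (n - 1 - j) * \<tau>)) (defect j)" for j
    have Sj: "real (Suc j) * \<tau> \<le> T0" if "j < n" for j
      by (rule order_trans[OF mult_right_mono n]) (use that tau in auto)
    have \<tau>\<alpha>: "\<tau> * \<tau> powr (- \<alpha>) = \<tau> powr (1 - \<alpha>)" using tau by (simp add: powr_diff powr_minus field_simps)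
    have M0: "0 \<le> M0" unfolding M0_def using \<kappa> E C_pos by (intro mult_nonneg_nonneg) auto
    \<comment> \<open>The additional 1 is for the last term, because \<open>norm_AS_defect\<close>
      has no factor \<open>1 / (j + 1)\<close>. The factor \<open>C + 1\<close> in \<open>M0\<close>
      dominates both the \<open>C\<close> of the earlier terms and the 1 of the last.\<close>
    have xj_bound: "x j \<in> V \<and> N (x j) \<le> M0 * (1 / (real j + 1) + (if j = n - 1 then 1 else 0))" if j: "j < n" for j
    proof (cases "j = n - 1")
      case True
      have xj: "x j = defect j" by (simp add: x_def True S_zero)
      have emb_x: "x j \<in> V \<and> N (x j) \<le> \<kappa> * (2 * E * \<tau>) * \<tau> powr (- \<alpha>)"
      proof (rule emb[OF tau tau_le[OF Sj[OF j]]])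
        have "2 * E * \<tau> / (real j + 1) \<le> 2 * E * \<tau>"
          using E tau by (intro divide_left_mono[where b=1 and a="real j + 1" and c="2 * E * \<tau>", simplified]) auto
        then show "norm (x j) \<le> 2 * E * \<tau>" using norm_defect[OF Sj[OF j]] xj by simp
        fix r :: real assume r: "r \<in> {0<..<1}"
        have "norm (blinfun_apply (AS r) (x j)) \<le> \<tau> * E * log_weight r \<tau>"
          using norm_AS_defect[OF Sj[OF j], of r] r xj by simp
        also have "\<dots> \<le> 2 * E * \<tau> * log_weight r \<tau>"
          using E tau log_weight_nonneg[of r \<tau>] r by (intro mult_right_mono) auto
        finally show "norm (blinfun_apply (AS r) (x j)) \<le> 2 * E * \<tau> * log_weight r \<tau>" .
      qed
      then have "N (x j) \<le> \<kappa> * (2 * E * \<tau>) * \<tau> powr (- \<alpha>)" ..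
      also have "\<dots> = (2 * \<kappa> * E * \<tau> powr (1 - \<alpha>)) * 1"
        by (simp flip: \<tau>\<alpha>)
      also have "\<dots> \<le> (2 * \<kappa> * E * \<tau> powr (1 - \<alpha>)) * ((C + 1) * (1 / (real j + 1) + 1))"
      proof (intro mult_left_mono)
        have "1 * 1 \<le> (C + 1) * (1 / (real j + 1) + 1)" using C_pos by (intro mult_mono) auto
        then show "1 \<le> (C + 1) * (1 / (real j + 1) + 1)" by simp
      qed (use \<kappa> E in auto)
      also have "\<dots> = M0 * (1 / (real j + 1) + (if j = n - 1 then 1 else 0))"
        using True by (simp add: M0_def)
      finally show ?thesis using emb_x by blast
    next
      case False
      define m where "m = n - 1 - j"
      have m: "1 \<le> m" "m \<le> n" using False j by (auto simp: m_def)
      define t where "t = real m * \<tau>"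
      have t: "0 < t" "t \<le> T0" "\<tau> \<le> t"
        using m tau order_trans[OF mult_right_mono[of "real m" "real n" \<tau>] n] mult_right_mono[of 1 "real m" \<tau>]
        by (auto simp: t_def)
      have d: "norm (defect j) \<le> 2 * E * \<tau> / (real j + 1)" by (rule norm_defect[OF Sj[OF j]])
      define Q where "Q = C * (2 * E * \<tau> / (real j + 1))"
      have xj: "x j = blinfun_apply (S t) (defect j)" by (simp add: x_def t_def m_def)
      have "x j \<in> V \<and> N (x j) \<le> \<kappa> * Q * t powr (- \<alpha>)"
      proof (rule emb[OF t(1,2)])
        have "norm (x j) \<le> C * norm (defect j)"
          unfolding xj by (rule norm_S_apply) (use t T0 in auto)
        also have "\<dots> \<le> Q" unfolding Q_def using d C_pos by (intro mult_left_mono) auto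
        finally show "norm (x j) \<le> Q" .
        fix r :: real assume r: "r \<in> {0<..<1}"
        have "norm (blinfun_apply (AS r) (x j)) = norm (blinfun_apply (AS (r + t)) (defect j))"
          unfolding xj using r t by (simp add: AS_S)
        also have "\<dots> \<le> C / (r + t) * norm (defect j)"
          by (rule norm_AS_apply) (use r t T0 in auto)
        also have "\<dots> \<le> C / (r + t) * (2 * E * \<tau> / (real j + 1))"
          using d C_pos r t by (intro mult_left_mono) auto
        also have "\<dots> = Q * (1 / (r + t))" by (simp add: Q_def)
        also have "\<dots> \<le> Q * log_weight r t"
          using inverse_add_le_log_weight[of r t] r t C_pos E tau by (intro mult_left_mono) (auto simp: Q_def)
        finally show "norm (blinfun_apply (AS r) (x j)) \<le> Q * log_weight r t" .
      qed
      \<comment> \<open>Every smoothing time is replaced by the smallest one, \<tau>; the summable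
        quantity is then \<open>1 / (j + 1)\<close> alone.\<close>
      moreover have "\<kappa> * Q * t powr (- \<alpha>) \<le> \<kappa> * Q * \<tau> powr (- \<alpha>)"
        using \<kappa> C_pos E tau t \<alpha> by (intro mult_left_mono powr_mono2') (auto simp: Q_def)
      moreover have "\<kappa> * Q * \<tau> powr (- \<alpha>) = (2 * \<kappa> * E * \<tau> powr (1 - \<alpha>) / (real j + 1)) * C"
        by (simp add: Q_def flip: \<tau>\<alpha>)
      moreover have "\<dots> \<le> (2 * \<kappa> * E * \<tau> powr (1 - \<alpha>) / (real j + 1)) * (C + 1)"
        using \<kappa> E by (intro mult_left_mono) auto
      ultimately show ?thesis using False by (auto simp: M0_def mult_ac)
    qed
    have sum: "(\<Sum>j<m. x j) \<in> V \<and> N (\<Sum>j<m. x j) \<le> (\<Sum>j<m. M0 * (1 / (real j + 1) + (if j = n - 1 then 1 else 0)))" if "m \<le> n" for m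
      using that
    proof (induction m)
      case (Suc m)
      then show ?case using xj_bound[of m] Vadd[of "\<Sum>j<m. x j" "x m"] by fastforce
    qed (simp add: V0)
    have "(\<Sum>j<n. M0 * (1 / (real j + 1) + (if j = n - 1 then 1 else 0))) =
        M0 * ((\<Sum>j<n. 1 / (real j + 1)) + 1)"
      using False by (simp add: sum.distrib flip: sum_distrib_left)
    also have "(\<Sum>j<n. 1 / (real j + 1)) = harm n"
      by (simp add: harm_def sum.atLeast1_atMost_eq inverse_eq_divide add.commute)
    \<comment> \<open>\<open>harm n - ln n\<close> decreases from its value 1 at
      \<open>n = 1\<close>, and \<open>n \<le> T0 / \<tau>\<close> turns \<open>ln n\<close> into
      logarithms of \<open>T0\<close> and \<tau>, removing the dependence on
      \<open>n\<close>.\<close>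
    also have "M0 * (harm n + 1) \<le> M0 * ((2 + \<bar>ln T0\<bar>) * (\<bar>ln \<tau>\<bar> + 1))"
    proof (rule mult_left_mono[OF _ M0])
      have n0: "0 < n" using False by simp
      have "real n \<le> T0 / \<tau>" using n tau by (simp add: field_simps)
      then have "ln (real n) \<le> ln (T0 / \<tau>)"
        using n0 \<open>0 < T0\<close> tau by (subst ln_le_cancel_iff) auto
      also have "\<dots> \<le> \<bar>ln T0\<bar> + \<bar>ln \<tau>\<bar>" using \<open>0 < T0\<close> tau by (simp add: ln_div)
      finally have "harm n \<le> \<bar>ln T0\<bar> + \<bar>ln \<tau>\<bar> + 1"
        using euler_mascheroni_sequence_decreasing[of 1 n] n0 by (simp add: harm_expand)
      moreover have "(2 + \<bar>ln T0\<bar>) * (\<bar>ln \<tau>\<bar> + 1) = 2 + 2 * \<bar>ln \<tau>\<bar> + \<bar>ln T0\<bar> + \<bar>ln T0\<bar> * \<bar>ln \<tau>\<bar>"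
        by (simp add: algebra_simps)
      moreover have "0 \<le> \<bar>ln T0\<bar> * \<bar>ln \<tau>\<bar>" by simp
      ultimately show "harm n + 1 \<le> (2 + \<bar>ln T0\<bar>) * (\<bar>ln \<tau>\<bar> + 1)" by linarith
    qed
    finally show ?thesis
      unfolding error_representation[OF n] x_def[symmetric] using sum[of n]
      by (auto simp: M0_def mult_ac)
  qed
qed

end

theorem theorem3p1:
  fixes D :: "'a::complex_banach set" and A :: "'a \<Rightarrow> 'a"
    and X\<^sub>\<alpha> :: "'a set" and norm\<^sub>\<alpha> :: "'a \<Rightarrow> real"
    and \<alpha> T B\<^sub>1 :: real
    and s K :: nat and c :: "nat \<Rightarrow> real" and \<beta> :: "nat \<Rightarrow> nat \<Rightarrow> complex"
  assumes "sectorial D A"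
    and "0 \<le> \<alpha>" and "\<alpha> < 1"
    and "intermediate_space D A \<alpha> X\<^sub>\<alpha> norm\<^sub>\<alpha>"
    and "0 < T"
    and "\<And>i. i \<in> {1..s} \<Longrightarrow> c i \<in> {0..1}"
    and "\<And>z. (\<Sum>i=1..s. weight K (\<beta> i) z) = phi 1 z"
  shows "\<exists>C. \<forall>g g' u\<^sub>0.
    (\<forall>t\<in>{0..T}. norm (g t) \<le> B\<^sub>1) \<and>
    (\<forall>t\<in>{0<..T}. (g has_vector_derivative g' t) (at t within {0..T}) \<and>
       norm (g' t) \<le> B\<^sub>1 * inverse t) \<and>
    u\<^sub>0 \<in> X\<^sub>\<alpha> \<longrightarrow>
    (\<forall>\<tau>>0. \<forall>n. real n * \<tau> \<le> T \<longrightarrow>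
       exp_rk D A s c K \<beta> g u\<^sub>0 \<tau> n - mild_solution D A g u\<^sub>0 (real n * \<tau>) \<in> X\<^sub>\<alpha> \<and>
       norm\<^sub>\<alpha> (exp_rk D A s c K \<beta> g u\<^sub>0 \<tau> n - mild_solution D A g u\<^sub>0 (real n * \<tau>))
         \<le> C * \<tau> powr (1 - \<alpha>) * (\<bar>ln \<tau>\<bar> + 1))"
proof -
  obtain S AS C where sg: "analytic_semigroup D A S AS (T + 1) C"
    using sectorial_imp_analytic_semigroup[OF assms(1)] by blast
  interpret analytic_semigroup D A S AS "T + 1" C by (rule sg)
  obtain \<kappa> where \<kappa>: "0 \<le> \<kappa>" and emb: "\<And>t x Q. 0 < t \<Longrightarrow> t \<le> T \<Longrightarrow> norm x \<le> Q \<Longrightarrow>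
       (\<And>r. r \<in> {0<..<1} \<Longrightarrow> norm (blinfun_apply (AS r) x) \<le> Q * log_weight r t) \<Longrightarrow>
       x \<in> X\<^sub>\<alpha> \<and> norm\<^sub>\<alpha> x \<le> \<kappa> * Q * t powr (- \<alpha>)"
    using intermediate_space_bound[OF assms(2,3,4,5)] by metis
  have V0: "0 \<in> X\<^sub>\<alpha>" "norm\<^sub>\<alpha> 0 = 0"
    and Vadd: "\<And>x y. x \<in> X\<^sub>\<alpha> \<Longrightarrow> y \<in> X\<^sub>\<alpha> \<Longrightarrow> x + y \<in> X\<^sub>\<alpha> \<and> norm\<^sub>\<alpha> (x + y) \<le> norm\<^sub>\<alpha> x + norm\<^sub>\<alpha> y"
    using assms(4)
    by (auto simp: intermediate_space_def banach_subspace_def csubspace_def norm_triangle_ineq split: if_splits)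
  \<comment> \<open>The constant \<open>E\<close> of \<open>exp_rk_problem\<close>, written out
    because it must be fixed before \<open>g\<close>, the initial value, \<tau> and
    \<open>n\<close>.\<close>
  define E where "E = C * B\<^sub>1 * ((\<Sum>i=1..s. \<Sum>k\<le>K. cmod (\<beta> i k)) + 1)"
  show ?thesis
  proof (intro exI[of _ "2 * \<kappa> * E * (C + 1) * (2 + \<bar>ln T\<bar>)"] allI impI)
    fix g g' :: "real \<Rightarrow> 'a" and u\<^sub>0 :: 'a and \<tau> :: real and n :: nat
    assume g: "(\<forall>t\<in>{0..T}. norm (g t) \<le> B\<^sub>1) \<and>
        (\<forall>t\<in>{0<..T}. (g has_vector_derivative g' t) (at t within {0..T}) \<and> norm (g' t) \<le> B\<^sub>1 * inverse t) \<and>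
        u\<^sub>0 \<in> X\<^sub>\<alpha>"
      and \<tau>: "0 < \<tau>" and n: "real n * \<tau> \<le> T"
    have dg: "(g has_vector_derivative g' t) (at t within {0..T})" "norm (g' t) \<le> B\<^sub>1 * inverse t"
      if "t \<in> {0<..T}" for t
      using g that by auto
    have cont: "continuous_on {0<..T} g"
      unfolding continuous_on_eq_continuous_within
    proof
      fix t assume t: "t \<in> {0<..T}"
      have "(g has_vector_derivative g' t) (at t within {0<..T})"
        by (rule has_vector_derivative_within_subset[OF dg(1)[OF t]]) auto
      then show "continuous (at t within {0<..T}) g" by (rule has_vector_derivative_continuous)
    qed
    \<comment> \<open>The mean value inequality on \<open>{a..T}\<close>, where the derivative is at
      most \<open>B\<^sub>1 / a\<close>.\<close>
    have lip: "norm (g x - g y) \<le> B\<^sub>1 / a * \<bar>x - y\<bar>" if a: "0 < a" and xy: "x \<in> {a..T}" "y \<in> {a..T}" for a x y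
    proof -
      have "norm (g x - g y) \<le> B\<^sub>1 / a * norm (x - y)"
      proof (rule differentiable_bound[OF _ _ _ xy])
        fix t assume t: "t \<in> {a..T}"
        then have t': "t \<in> {0<..T}" using a by auto
        show "(g has_derivative (\<lambda>h. h *\<^sub>R g' t)) (at t within {a..T})"
          using has_vector_derivative_within_subset[OF dg(1)[OF t'], of "{a..T}"] a
          by (simp add: has_vector_derivative_def)
        have "0 \<le> B\<^sub>1" using g assms(5) by (meson atLeastAtMost_iff less_imp_le norm_ge_zero order_refl order_trans)
        then have "B\<^sub>1 * inverse t \<le> B\<^sub>1 * inverse a"
          using t a by (intro mult_left_mono le_imp_inverse_le) auto
        then have "norm (g' t) \<le> B\<^sub>1 / a" using dg(2)[OF t'] by (simp add: divide_inverse)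
        then have "norm (h *\<^sub>R g' t) \<le> B\<^sub>1 / a * norm h" for h
          using mult_right_mono[of "norm (g' t)" "B\<^sub>1 / a" "\<bar>h\<bar>"] by (simp add: mult.commute)
        then show "onorm (\<lambda>h. h *\<^sub>R g' t) \<le> B\<^sub>1 / a" by (rule onorm_le)
      qed simp
      then show ?thesis by simp
    qed
    interpret problem: exp_rk_problem D A S AS "T + 1" C g B\<^sub>1 T \<tau> s K c \<beta>
    proof (rule exp_rk_problem.intro[OF sg], rule exp_rk_problem_axioms.intro)
      show "1 \<le> K" by (rule weights_coefficients(1)[OF assms(7)])
      show "(\<Sum>i=1..s. \<beta> i k) = (if k = 1 then 1 else 0)" if "k \<le> K" for k
        by (rule weights_coefficients(2)[OF assms(7) that])
    qed (use g assms(6) \<tau> cont lip in auto)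
    show "exp_rk D A s c K \<beta> g u\<^sub>0 \<tau> n - mild_solution D A g u\<^sub>0 (real n * \<tau>) \<in> X\<^sub>\<alpha> \<and>
       norm\<^sub>\<alpha> (exp_rk D A s c K \<beta> g u\<^sub>0 \<tau> n - mild_solution D A g u\<^sub>0 (real n * \<tau>))
         \<le> 2 * \<kappa> * E * (C + 1) * (2 + \<bar>ln T\<bar>) * \<tau> powr (1 - \<alpha>) * (\<bar>ln \<tau>\<bar> + 1)"
      using problem.error_bound[OF n assms(5) V0 Vadd \<kappa> assms(2) emb]
      unfolding E_def problem.E_def problem.total_weight_def .
  qed
qed

end
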